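(* The region $\mathcal{R}\subset\mathbb{R}^2$ is simply connected, and its boundary $\partial\mathcal{R}$ has the following properties: (i) $\partial\mathcal{R}$ is a loop with polar form $r=f(\theta)$, $0\le\theta\le\frac{\pi}{2}$; (ii) the tangent lines of $\partial\mathcal{R}$ near the origin $(0,0)$ converge to the horizontal and vertical coordinate axes; that is, as the point $(h,k)=(h,th)$ moves along $\partial\mathcal{R}$ to the origin with $(h,t)\to(0^+,0^+)$ the tangent line converges to the horizontal axis, and as it moves along $\partial\mathcal{R}$ to the origin with $(k,t)\to(0^+,\infty)$ the tangent line converges to the vertical axis; (iii) $\operatorname{card}\big(\partial\mathcal{R}\cap\{(a,k):k\in\mathbb{R}\}\big)=2$ for every $a$ with $0<a<h_M$; (iv) $\operatorname{card}\big(\partial\mathcal{R}\cap\{(h,b):h\in\mathbb{R}\}\big)=2$ for every $b$ with $0<b<k_M$.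
   Context: Weighted shift: for a bounded sequence $\alpha=\{\alpha_n\}_{n\ge0}$ of positive reals, $W_\alpha$ is the bounded operator on $\ell^2(\mathbb{Z}_{\ge 0})$ (complex scalars) with $W_\alpha e_n=\alpha_n e_{n+1}$. An operator $T$ is hyponormal if $T^*T\ge TT^*$; it is semi-cubically hyponormal if $T+sT^3$ is hyponormal for every complex number $s$. Stampfli completion: for $0<\alpha_0<\alpha_1<\alpha_2$, $(\alpha_0,\alpha_1,\alpha_2)^\wedge$ denotes the bounded sequence $\{\widehat\alpha_n\}_{n\ge0}$ with $\widehat\alpha_i=\alpha_i$ for $0\le i\le2$ and $\widehat\alpha_n=\left(\Psi_1+\Psi_0/\widehat\alpha_{n-1}^2\right)^{1/2}$ for $n\ge3$, where $\Psi_0=-\frac{\alpha_0^2\alpha_1^2(\alpha_2^2-\alpha_1^2)}{\alpha_1^2-\alpha_0^2}$ and $\Psi_1=\frac{\alpha_1^2(\alpha_2^2-\alpha_0^2)}{\alpha_1^2-\alpha_0^2}$. For $1<x<y$ let $\alpha(x,y):1,(1,\sqrt{x},\sqrt{y})^\wedge$ be the weight sequence whose first weight is $1$, followed by the terms of $(1,\sqrt x,\sqrt y)^\wedge$. Write $x=1+h$, $y=1+h+k$ with $h,k>0$, and set $$\mathcal{R}=\{(h,k): h>0,\ k>0,\ W_{\alpha(1+h,\,1+h+k)}\text{ is semi-cubically hyponormal}\}.$$ Points of the quadrant are also written $(h,k)=(h,th)$ with $t=k/h$. Here $h$ is the horizontal and $k$ the vertical coordinate. $\partial\mathcal{R}$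 is the boundary of $\mathcal{R}$ in $\mathbb{R}^2$. Set $h_M=\max\{h:(h,k)\in\mathcal{R}\text{ for some }k\}$ and $k_M=\max\{k:(h,k)\in\mathcal{R}\text{ for some }h\}$ (these maxima exist). $\operatorname{card}$ denotes cardinality. A loop with polar form $r=f(\theta)$, $0\le\theta\le\pi/2$, is a closed curve $\{(f(\theta)\cos\theta,f(\theta)\sin\theta):0\le\theta\le\pi/2\}$ through the origin, with $f$ continuous, nonnegative, and $f(0)=f(\pi/2)=0$. *)

theory Defs
  imports "HOL-Analysis.Analysis"
begin

section \<open>Bounded operators on the complex sequence space \<open>\<ell>\<^sup>2\<close>\<close>

text \<open>
  The Hilbert space is the carrier set \<open>ell2\<close> of square-summable complex sequences; operators are
  total functions on sequences of which only the values on \<open>ell2\<close> matter.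
\<close>

definition ell2 :: "(nat \<Rightarrow> complex) set" where
  "ell2 = {f. summable (\<lambda>n. (cmod (f n))\<^sup>2)}"

definition ell2_inner :: "(nat \<Rightarrow> complex) \<Rightarrow> (nat \<Rightarrow> complex) \<Rightarrow> complex" where
  "ell2_inner f g = (\<Sum>n. f n * cnj (g n))"

definition ell2_norm :: "(nat \<Rightarrow> complex) \<Rightarrow> real" where
  "ell2_norm f = sqrt (\<Sum>n. (cmod (f n))\<^sup>2)"

type_synonym seq_op = "(nat \<Rightarrow> complex) \<Rightarrow> (nat \<Rightarrow> complex)"

definition ell2_bounded_op :: "seq_op \<Rightarrow> bool" where
  "ell2_bounded_op T \<longleftrightarrow>
     (\<forall>f\<in>ell2. T f \<in> ell2) \<and>
     (\<forall>f\<in>ell2. \<forall>g\<in>ell2. T (\<lambda>n. f n + g n) = (\<lambda>n. T f n + T g n)) \<and>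
     (\<forall>f\<in>ell2. \<forall>c. T (\<lambda>n. c * f n) = (\<lambda>n. c * T f n)) \<and>
     (\<exists>K. \<forall>f\<in>ell2. ell2_norm (T f) \<le> K * ell2_norm f)"

text \<open>
  For a bounded operator the defining condition determines the adjoint uniquely on \<open>ell2\<close>; the
  choice operator only fixes the irrelevant values elsewhere.
\<close>

definition ell2_adjoint :: "seq_op \<Rightarrow> seq_op" where
  "ell2_adjoint T =
     (SOME S. ell2_bounded_op S \<and>
        (\<forall>f\<in>ell2. \<forall>g\<in>ell2. ell2_inner (T f) g = ell2_inner f (S g)))"

definition ell2_op_le :: "seq_op \<Rightarrow> seq_op \<Rightarrow> bool" where
  "ell2_op_le A B \<longleftrightarrow> (\<forall>f\<in>ell2. ell2_inner (\<lambda>n. B f n - A f n) f \<in> \<real>\<^sub>\<ge>\<^sub>0)"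

definition hyponormal :: "seq_op \<Rightarrow> bool" where
  "hyponormal T \<longleftrightarrow>
     ell2_bounded_op T \<and> ell2_op_le (T \<circ> ell2_adjoint T) (ell2_adjoint T \<circ> T)"

definition semi_cubically_hyponormal :: "seq_op \<Rightarrow> bool" where
  "semi_cubically_hyponormal T \<longleftrightarrow>
     (\<forall>s::complex. hyponormal (\<lambda>f n. T f n + s * (T ^^ 3) f n))"


section \<open>Weighted shifts and the Stampfli completion\<close>

definition weighted_shift :: "(nat \<Rightarrow> real) \<Rightarrow> seq_op" where
  "weighted_shift \<alpha> f = (\<lambda>n. case n of 0 \<Rightarrow> 0 | Suc m \<Rightarrow> complex_of_real (\<alpha> m) * f m)"

definition stampfli_Psi0 :: "real \<Rightarrow> real \<Rightarrow> real \<Rightarrow> real" where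
  "stampfli_Psi0 a0 a1 a2 = - (a0\<^sup>2 * a1\<^sup>2 * (a2\<^sup>2 - a1\<^sup>2) / (a1\<^sup>2 - a0\<^sup>2))"

definition stampfli_Psi1 :: "real \<Rightarrow> real \<Rightarrow> real \<Rightarrow> real" where
  "stampfli_Psi1 a0 a1 a2 = a1\<^sup>2 * (a2\<^sup>2 - a0\<^sup>2) / (a1\<^sup>2 - a0\<^sup>2)"

fun stampfli :: "real \<Rightarrow> real \<Rightarrow> real \<Rightarrow> nat \<Rightarrow> real" where
  "stampfli a0 a1 a2 0 = a0"
| "stampfli a0 a1 a2 (Suc 0) = a1"
| "stampfli a0 a1 a2 (Suc (Suc 0)) = a2"
| "stampfli a0 a1 a2 (Suc (Suc (Suc n))) =
     sqrt (stampfli_Psi1 a0 a1 a2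
           + stampfli_Psi0 a0 a1 a2 / (stampfli a0 a1 a2 (Suc (Suc n)))\<^sup>2)"

definition alpha_xy :: "real \<Rightarrow> real \<Rightarrow> nat \<Rightarrow> real" where
  "alpha_xy x y n = (case n of 0 \<Rightarrow> 1 | Suc m \<Rightarrow> stampfli 1 (sqrt x) (sqrt y) m)"

definition region_R :: "(real \<times> real) set" where
  "region_R = {(h, k). h > 0 \<and> k > 0 \<and>
     semi_cubically_hyponormal (weighted_shift (alpha_xy (1 + h) (1 + h + k)))}"

definition h_M :: real where
  "h_M = (GREATEST h. \<exists>k. (h, k) \<in> region_R)"

definition k_M :: real where
  "k_M = (GREATEST k. \<exists>h. (h, k) \<in> region_R)"


section \<open>Plane curves\<close>

definition polar_loop :: "(real \<Rightarrow> real) \<Rightarrow> (real \<times> real) set \<Rightarrow> bool" where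
  "polar_loop f C \<longleftrightarrow>
     continuous_on {0..pi/2} f \<and> (\<forall>\<theta>\<in>{0..pi/2}. f \<theta> \<ge> 0) \<and> f 0 = 0 \<and> f (pi/2) = 0 \<and>
     C = (\<lambda>\<theta>. (f \<theta> * cos \<theta>, f \<theta> * sin \<theta>)) ` {0..pi/2}"

text \<open>
  Lines are affine hulls of two distinct points.  A family of lines converges to a line if suitable
  spanning pairs of points converge to a spanning pair of the limit; this is convergence in the
  usual topology of the set of affine lines.
\<close>

definition lines_converge ::
    "('i \<Rightarrow> (real \<times> real) set) \<Rightarrow> (real \<times> real) set \<Rightarrow> 'i filter \<Rightarrow> bool" where
  "lines_converge L L0 F \<longleftrightarrow>
     (\<exists>a b a0 b0. a0 \<noteq> b0 \<and> L0 = affine hull {a0, b0} \<and>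
        (\<forall>\<^sub>F i in F. a i \<noteq> b i \<and> L i = affine hull {a i, b i}) \<and>
        (a \<longlongrightarrow> a0) F \<and> (b \<longlongrightarrow> b0) F)"

text \<open>
  The tangent line at \<open>p\<close> is the limit of the secants through \<open>p\<close> and a point \<open>q\<close> of the curve
  tending to \<open>p\<close> (from either side); as \<open>p\<close> is a limit point of the curve, it is unique.
\<close>

definition tangent_line_at ::
    "(real \<times> real) set \<Rightarrow> real \<times> real \<Rightarrow> (real \<times> real) set \<Rightarrow> bool" where
  "tangent_line_at C p L \<longleftrightarrow>
     p \<in> C \<and> p islimpt C \<and> lines_converge (\<lambda>q. affine hull {p, q}) L (at p within C)"

text \<open>
  The point \<open>(h, k) = (h, t h)\<close> moves along the curve with \<open>(h, t) \<longlonglongrightarrow> (0+, 0+)\<close>,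
  respectively \<open>(k, t) \<longlonglongrightarrow> (0+, \<infinity>)\<close>.
\<close>

definition to_origin_along_h_axis :: "(real \<times> real) set \<Rightarrow> (real \<times> real) filter" where
  "to_origin_along_h_axis C =
     inf (filtercomap (\<lambda>(h, k). (h, k / h)) (at_right 0 \<times>\<^sub>F at_right 0)) (principal C)"

definition to_origin_along_k_axis :: "(real \<times> real) set \<Rightarrow> (real \<times> real) filter" where
  "to_origin_along_k_axis C =
     inf (filtercomap (\<lambda>(h, k). (k, k / h)) (at_right 0 \<times>\<^sub>F at_top)) (principal C)"

text \<open>
  All curve points sufficiently far along \<open>F\<close> have a tangent line, and these converge to \<open>L0\<close>.
  The condition \<open>F \<noteq> bot\<close> says that the curve does have points moving along \<open>F\<close>, so that
  the statement is not vacuous.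
\<close>

definition tangent_lines_converge ::
    "(real \<times> real) set \<Rightarrow> (real \<times> real) filter \<Rightarrow> (real \<times> real) set \<Rightarrow> bool" where
  "tangent_lines_converge C F L0 \<longleftrightarrow>
     F \<noteq> bot \<and>
     (\<exists>\<tau>. (\<forall>\<^sub>F p in F. tangent_line_at C p (\<tau> p)) \<and> lines_converge \<tau> L0 F)"

end

theory Submission
  imports Defs
begin

text \<open>
  \<^bold>\<open>Reduction to an inequality.\<close> Put \<open>T = W + s W\<^sup>3\<close>. Its self-commutator \<open>T\<^sup>* T - T T\<^sup>*\<close> only couples the
  indices \<open>n\<close> and \<open>n + 2\<close>, so its quadratic form is tridiagonal on the even and on the odd indices, with
  diagonal \<open>u\<^sub>n + t v\<^sub>n\<close>, \<open>t = \<bar>s\<bar>\<^sup>2\<close>, and off-diagonal entries \<open>s c\<^sub>n\<close>. The squared weights of the Stampfli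
  completion are the quotients \<open>\<gamma>\<^sub>n\<^sub>+\<^sub>1 / \<gamma>\<^sub>n\<close> of the moments of a measure with two atoms \<open>p < 1 < q\<close>. The
  two-by-two minors of a two-atom moment sequence factor, which gives \<open>c\<^sub>n\<^sup>2 = u\<^sub>n v\<^sub>n\<^sub>+\<^sub>2\<close> for \<open>n \<ge> 2\<close> and
  \<open>v\<^sub>n \<le> u\<^sub>n / t\<^sub>0\<close> for \<open>n \<ge> 4\<close>, where \<open>t\<^sub>0 = p\<^sup>2 / (p\<^sup>2 + p q + q\<^sup>2)\<^sup>2\<close>. Completing squares along a chain
  from its far end, with pivots at least \<open>t v\<^sub>n + u\<^sub>n max 0 (1 - t / t\<^sub>0)\<close>, therefore works at every \<open>n \<ge> 2\<close>. The
  even chain never fails at its first index. The odd chain starts with \<open>u\<^sub>1 = 0\<close>, because the first two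
  weights are both 1; there the pivot condition, divided by \<open>t\<close>, is affine on \<open>[0, t\<^sub>0]\<close>, so only \<open>t = 0\<close> and
  \<open>t = t\<^sub>0\<close> matter, and the condition at \<open>t\<^sub>0\<close> implies the one at \<open>0\<close>. At \<open>t = t\<^sub>0\<close> it is also necessary:
  the null solution of the tail, cut off linearly over \<open>N\<close> steps, has energy \<open>O(1/N)\<close>. This is
  \<open>region_R_iff\<close>: the region is \<open>crit h k \<le> lower_atom h k\<close>, where \<open>lower_atom\<close> is \<open>p\<close>.

  \<^bold>\<open>Shape of the region.\<close> On a ray \<open>k = t h\<close> the atom \<open>p\<close> decreases and \<open>crit\<close> strictly increases with
  \<open>h\<close>, so the region is a half-open segment \<open>0 < h \<le> ray_end t\<close> of each ray. Since \<open>ray_end\<close> is continuous,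
  the region is homeomorphic to \<open>(0,\<infinity>) \<times> (0,1]\<close>; since it is squeezed to the origin by \<open>h\<^sup>3 \<le> 2 k\<^sup>2\<close> and
  \<open>h\<^sup>2 + h k + k\<^sup>2 \<le> 2 h\<close>, its boundary consists of the points \<open>(ray_end t, t ray_end t)\<close> and the
  origin.

  \<^bold>\<open>Sections.\<close> On a vertical or on a horizontal line, parametrised by the slope \<open>t = k / h\<close>, the atom \<open>p\<close>
  is concave because its inverse function is an explicit convex function, and \<open>crit\<close> is strictly convex,
  which is the positivity of a polynomial all of whose coefficients are positive. So such a line meets
  the boundary at most twice; below the maximal abscissa or ordinate it contains an interior point of the
  region and therefore meets the boundary exactly twice.

  \<^bold>\<open>Tangents.\<close> The boundary curve lies in the zero set of \<open>level = 2 (ln p - ln crit)\<close>. The logarithmic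
  partial derivatives \<open>h \<partial>\<^sub>h level\<close> and \<open>k \<partial>\<^sub>k level\<close> tend to \<open>-3\<close> and \<open>2\<close> as \<open>(h, t)\<close> tends to \<open>(0, 0)\<close>, and to
  \<open>2\<close> and \<open>-3\<close> as \<open>(k, t)\<close> tends to \<open>(0, \<infinity>)\<close>. Dividing by \<open>h\<close> and by \<open>k\<close> makes the gradient vertical in the
  first limit and horizontal in the second.
\<close>

section \<open>Bounded operators on \<open>\<ell>\<^sup>2\<close> and their adjoints\<close>

lemma ell2_le:
  assumes "f \<in> ell2" and "\<And>n. cmod (g n) \<le> C * cmod (f n)"
  shows "g \<in> ell2"
proof -
  have le: "(cmod (g n))\<^sup>2 \<le> C\<^sup>2 * (cmod (f n))\<^sup>2" for n
    using power_mono[OF assms(2)[of n], of 2] by (simp add: power_mult_distrib)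
  have "summable (\<lambda>n. C\<^sup>2 * (cmod (f n))\<^sup>2)"
    using assms(1) by (simp add: ell2_def)
  then show ?thesis
    unfolding ell2_def mem_Collect_eq
    by (rule summable_comparison_test'[where N = 0]) (simp add: le)
qed

lemma cmod_add_sq_le: "(cmod (a + b))\<^sup>2 \<le> 2 * (cmod a)\<^sup>2 + 2 * (cmod b)\<^sup>2"
proof -
  have "(cmod (a + b))\<^sup>2 \<le> (cmod a + cmod b)\<^sup>2"
    by (intro power_mono norm_triangle_ineq) auto
  also have "\<dots> \<le> 2 * (cmod a)\<^sup>2 + 2 * (cmod b)\<^sup>2"
    using sum_squares_bound[of "cmod a" "cmod b"] by (simp add: power2_sum)
  finally show ?thesis .
qed

lemma ell2_add:
  assumes "f \<in> ell2" "g \<in> ell2"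
  shows "(\<lambda>n. f n + g n) \<in> ell2"
proof -
  have "summable (\<lambda>n. 2 * (cmod (f n))\<^sup>2 + 2 * (cmod (g n))\<^sup>2)"
    using assms by (intro summable_add summable_mult) (simp_all add: ell2_def)
  then show ?thesis
    unfolding ell2_def mem_Collect_eq
  proof (rule summable_comparison_test'[where N = 0])
    show "norm ((cmod (f n + g n))\<^sup>2) \<le> 2 * (cmod (f n))\<^sup>2 + 2 * (cmod (g n))\<^sup>2" for n
      unfolding real_norm_def abs_power2 by (rule cmod_add_sq_le)
  qed
qed

lemma ell2_scale: "f \<in> ell2 \<Longrightarrow> (\<lambda>n. c * f n) \<in> ell2"
  by (erule ell2_le[where C = "cmod c"]) (simp add: norm_mult)

lemma ell2_shift: "f \<in> ell2 \<Longrightarrow> (\<lambda>n. f (n + j)) \<in> ell2"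
  unfolding ell2_def mem_Collect_eq
  using summable_iff_shift[of "\<lambda>n. (cmod (f n))\<^sup>2" j] by blast

lemma ell2_finite_support: "(\<And>n. n \<ge> N \<Longrightarrow> f n = 0) \<Longrightarrow> f \<in> ell2"
  unfolding ell2_def mem_Collect_eq
  by (rule summable_finite[of "{..<N}"]) (auto simp: not_less)

lemma ell2_summable_mult:
  assumes "f \<in> ell2" "g \<in> ell2"
  shows "summable (\<lambda>n. f n * cnj (g n))"
proof (rule summable_comparison_test'[where N = 0 and g = "\<lambda>n. (cmod (f n))\<^sup>2 + (cmod (g n))\<^sup>2"])
  show "summable (\<lambda>n. (cmod (f n))\<^sup>2 + (cmod (g n))\<^sup>2)"
    using assms by (auto simp: ell2_def intro: summable_add)
  show "norm (f n * cnj (g n)) \<le> (cmod (f n))\<^sup>2 + (cmod (g n))\<^sup>2" for n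
    using sum_squares_bound[of "cmod (f n)" "cmod (g n)"]
      mult_nonneg_nonneg[OF norm_ge_zero[of "f n"] norm_ge_zero[of "g n"]]
    unfolding norm_mult complex_mod_cnj by linarith
qed

lemma ell2_inner_add_left:
  "\<lbrakk>f \<in> ell2; f' \<in> ell2; g \<in> ell2\<rbrakk> \<Longrightarrow>
     ell2_inner (\<lambda>n. f n + c * f' n) g = ell2_inner f g + c * ell2_inner f' g"
  unfolding ell2_inner_def
  by (simp add: distrib_right mult.assoc suminf_add[symmetric] suminf_mult ell2_summable_mult
      summable_mult)

lemma ell2_inner_add_right:
  "\<lbrakk>f \<in> ell2; g \<in> ell2; g' \<in> ell2\<rbrakk> \<Longrightarrow>
     ell2_inner f (\<lambda>n. g n + cnj c * g' n) = ell2_inner f g + c * ell2_inner f g'"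
  unfolding ell2_inner_def
  by (simp add: distrib_left mult.left_commute[of _ c] suminf_add[symmetric] suminf_mult
      ell2_summable_mult summable_mult)

lemma ell2_inner_self:
  assumes "f \<in> ell2" shows "ell2_inner f f = of_real (\<Sum>n. (cmod (f n))\<^sup>2)"
proof -
  have "ell2_inner f f = (\<Sum>n. of_real ((cmod (f n))\<^sup>2))"
    unfolding ell2_inner_def by (simp add: complex_norm_square del: of_real_power)
  also have "\<dots> = of_real (\<Sum>n. (cmod (f n))\<^sup>2)"
    using assms unfolding ell2_def by (intro suminf_of_real[symmetric]) auto
  finally show ?thesis .
qed

lemma ell2_inner_commute:
  assumes "f \<in> ell2" "g \<in> ell2"
  shows "ell2_inner g f = cnj (ell2_inner f g)"
proof -
  have "(\<lambda>n. f n * cnj (g n)) sums ell2_inner f g"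
    unfolding ell2_inner_def by (intro summable_sums ell2_summable_mult assms)
  then have "(\<lambda>n. g n * cnj (f n)) sums cnj (ell2_inner f g)"
    by (subst (asm) sums_cnj[symmetric]) (simp add: mult.commute)
  then show ?thesis
    unfolding ell2_inner_def by (simp add: sums_iff)
qed

text \<open>
  The adjoint is defined by a choice; exhibiting one operator with the adjoint property determines it on \<open>\<ell>\<^sup>2\<close>.
\<close>

definition adjoint_pair :: "seq_op \<Rightarrow> seq_op \<Rightarrow> bool" where
  "adjoint_pair T S \<longleftrightarrow> ell2_bounded_op T \<and> ell2_bounded_op S \<and>
     (\<forall>f\<in>ell2. \<forall>g\<in>ell2. ell2_inner (T f) g = ell2_inner f (S g))"

lemma ell2_bounded_op_add_scale:
  assumes A: "ell2_bounded_op A" and B: "ell2_bounded_op B"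
  shows "ell2_bounded_op (\<lambda>f n. A f n + c * B f n)"
proof -
  obtain K where K: "\<And>f. f \<in> ell2 \<Longrightarrow> ell2_norm (A f) \<le> K * ell2_norm f"
    using A unfolding ell2_bounded_op_def by blast
  obtain M where M: "\<And>f. f \<in> ell2 \<Longrightarrow> ell2_norm (B f) \<le> M * ell2_norm f"
    using B unfolding ell2_bounded_op_def by blast
  have AB: "A f \<in> ell2" "B f \<in> ell2" if "f \<in> ell2" for f
    using A B that unfolding ell2_bounded_op_def by blast+
  have nn: "ell2_norm f \<ge> 0" if "f \<in> ell2" for f
    using that unfolding ell2_norm_def ell2_def by (auto intro!: suminf_nonneg)
  have sq: "(ell2_norm f)\<^sup>2 = (\<Sum>n. (cmod (f n))\<^sup>2)" if "f \<in> ell2" for f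
    using that unfolding ell2_norm_def ell2_def by (auto intro!: real_sqrt_pow2 suminf_nonneg)
  have "ell2_norm (\<lambda>n. A f n + c * B f n)
      \<le> sqrt (2 * K\<^sup>2 + 2 * (cmod c)\<^sup>2 * M\<^sup>2) * ell2_norm f" if f: "f \<in> ell2" for f
  proof -
    have S: "summable (\<lambda>n. (cmod (A f n))\<^sup>2)" "summable (\<lambda>n. (cmod (B f n))\<^sup>2)"
      using AB[OF f] by (auto simp: ell2_def)
    have l: "(\<lambda>n. A f n + c * B f n) \<in> ell2"
      using AB[OF f] by (intro ell2_add ell2_scale)
    have "(\<Sum>n. (cmod (A f n + c * B f n))\<^sup>2)
        \<le> (\<Sum>n. 2 * (cmod (A f n))\<^sup>2 + 2 * (cmod c)\<^sup>2 * (cmod (B f n))\<^sup>2)"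
    proof (rule suminf_le)
      show "(cmod (A f n + c * B f n))\<^sup>2 \<le> 2 * (cmod (A f n))\<^sup>2 + 2 * (cmod c)\<^sup>2 * (cmod (B f n))\<^sup>2" for n
        using cmod_add_sq_le[of "A f n" "c * B f n"] by (simp add: norm_mult power_mult_distrib)
    next
      show "summable (\<lambda>n. (cmod (A f n + c * B f n))\<^sup>2)"
        using l by (simp add: ell2_def)
      show "summable (\<lambda>n. 2 * (cmod (A f n))\<^sup>2 + 2 * (cmod c)\<^sup>2 * (cmod (B f n))\<^sup>2)"
        by (intro summable_add summable_mult S)
    qed
    also have "\<dots> = 2 * (ell2_norm (A f))\<^sup>2 + 2 * (cmod c)\<^sup>2 * (ell2_norm (B f))\<^sup>2"
      using S AB[OF f] by (simp add: sq suminf_add[symmetric] suminf_mult summable_mult)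
    also have "\<dots> \<le> 2 * (K * ell2_norm f)\<^sup>2 + 2 * (cmod c)\<^sup>2 * (M * ell2_norm f)\<^sup>2"
      using K[OF f] M[OF f] nn AB[OF f]
      by (intro add_mono mult_left_mono power_mono) auto
    also have "\<dots> = (2 * K\<^sup>2 + 2 * (cmod c)\<^sup>2 * M\<^sup>2) * (ell2_norm f)\<^sup>2"
      by (simp add: power_mult_distrib algebra_simps)
    finally have "(ell2_norm (\<lambda>n. A f n + c * B f n))\<^sup>2
        \<le> (2 * K\<^sup>2 + 2 * (cmod c)\<^sup>2 * M\<^sup>2) * (ell2_norm f)\<^sup>2"
      by (simp add: sq[OF l])
    then have "sqrt ((ell2_norm (\<lambda>n. A f n + c * B f n))\<^sup>2)
        \<le> sqrt ((2 * K\<^sup>2 + 2 * (cmod c)\<^sup>2 * M\<^sup>2) * (ell2_norm f)\<^sup>2)"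
      by (rule real_sqrt_le_mono)
    then show ?thesis
      using nn[OF f] nn[OF l] by (simp add: real_sqrt_mult)
  qed
  note bound = this
  have add: "A (\<lambda>n. f n + g n) = (\<lambda>n. A f n + A g n)" "B (\<lambda>n. f n + g n) = (\<lambda>n. B f n + B g n)"
    if "f \<in> ell2" "g \<in> ell2" for f g
    using A B that unfolding ell2_bounded_op_def by blast+
  have scale: "A (\<lambda>n. d * f n) = (\<lambda>n. d * A f n)" "B (\<lambda>n. d * f n) = (\<lambda>n. d * B f n)"
    if "f \<in> ell2" for f d
    using A B that unfolding ell2_bounded_op_def by blast+
  show ?thesis
    unfolding ell2_bounded_op_def
  proof (intro conjI ballI allI)
    fix f assume f: "f \<in> ell2"
    show "(\<lambda>n. A f n + c * B f n) \<in> ell2"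
      by (intro ell2_add ell2_scale AB f)
    show "(\<lambda>n. A (\<lambda>n. d * f n) n + c * B (\<lambda>n. d * f n) n) = (\<lambda>n. d * (A f n + c * B f n))" for d
      unfolding scale[OF f] by (simp add: algebra_simps)
    show "(\<lambda>n. A (\<lambda>n. f n + g n) n + c * B (\<lambda>n. f n + g n) n)
        = (\<lambda>n. A f n + c * B f n + (A g n + c * B g n))" if "g \<in> ell2" for g
      unfolding add[OF f that] by (simp add: algebra_simps)
  next
    show "\<exists>K. \<forall>f\<in>ell2. ell2_norm (\<lambda>n. A f n + c * B f n) \<le> K * ell2_norm f"
      using bound by blast
  qed
qed

lemma adjoint_pair_add_scale:
  assumes "adjoint_pair A A'" "adjoint_pair B B'"
  shows "adjoint_pair (\<lambda>f n. A f n + c * B f n) (\<lambda>f n. A' f n + cnj c * B' f n)"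
proof -
  have "A f \<in> ell2" "A' f \<in> ell2" "B f \<in> ell2" "B' f \<in> ell2" if "f \<in> ell2" for f
    using assms that unfolding adjoint_pair_def ell2_bounded_op_def by simp_all
  then show ?thesis
    using assms unfolding adjoint_pair_def
    by (auto simp: ell2_inner_add_left ell2_inner_add_right intro!: ell2_bounded_op_add_scale)
qed

text \<open>
  Testing the defining identity on the unit vectors recovers every coordinate of the adjoint.
\<close>

lemma ell2_adjoint_eq:
  assumes "adjoint_pair T S" and g: "g \<in> ell2"
  shows "ell2_adjoint T g = S g"
proof
  fix n
  let ?P = "\<lambda>S. ell2_bounded_op S \<and> (\<forall>f\<in>ell2. \<forall>g\<in>ell2. ell2_inner (T f) g = ell2_inner f (S g))"
  have PS: "?P S" using assms by (simp add: adjoint_pair_def)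
  have "?P (ell2_adjoint T)"
    unfolding ell2_adjoint_def by (rule someI[of ?P, OF PS])
  moreover define e :: "nat \<Rightarrow> complex" where "e = (\<lambda>i. if i = n then 1 else 0)"
  have e: "e \<in> ell2"
    by (rule ell2_finite_support[of "Suc n"]) (auto simp: e_def)
  ultimately have eq: "ell2_inner e (ell2_adjoint T g) = ell2_inner e (S g)"
    using PS g by metis
  have coord: "ell2_inner e f = cnj (f n)" for f
  proof -
    have "(\<lambda>i. e i * cnj (f i)) = (\<lambda>i. if i = n then cnj (f i) else 0)"
      by (auto simp: e_def)
    then show ?thesis
      unfolding ell2_inner_def using sums_single[of n "\<lambda>i. cnj (f i)"] by (simp add: sums_iff)
  qed
  from eq show "ell2_adjoint T g n = S g n"
    by (simp add: coord)
qed

text \<open>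
  \<open>\<langle>T\<^sup>* T f, f\<rangle> = \<parallel>T f\<parallel>\<^sup>2\<close> and \<open>\<langle>T T\<^sup>* f, f\<rangle> = \<parallel>T\<^sup>* f\<parallel>\<^sup>2\<close>, so both sides of the operator inequality are
  squared norms.
\<close>

lemma hyponormal_iff_norm_le:
  assumes TS: "adjoint_pair T S"
  shows "hyponormal T \<longleftrightarrow> (\<forall>f\<in>ell2. (\<Sum>n. (cmod (S f n))\<^sup>2) \<le> (\<Sum>n. (cmod (T f n))\<^sup>2))"
proof -
  have mem: "T f \<in> ell2" "S f \<in> ell2" if "f \<in> ell2" for f
    using TS that unfolding adjoint_pair_def ell2_bounded_op_def by blast+
  have adj: "ell2_inner (T f) g = ell2_inner f (S g)" if "f \<in> ell2" "g \<in> ell2" for f g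
    using TS that unfolding adjoint_pair_def by blast
  have "ell2_inner (\<lambda>n. S (T f) n - T (S f) n) f
      = of_real ((\<Sum>n. (cmod (T f n))\<^sup>2) - (\<Sum>n. (cmod (S f n))\<^sup>2))" if f: "f \<in> ell2" for f
  proof -
    have "ell2_inner (\<lambda>n. S (T f) n - T (S f) n) f = ell2_inner (S (T f)) f - ell2_inner (T (S f)) f"
      using ell2_inner_add_left[of "S (T f)" "T (S f)" f "-1"] mem f by simp
    also have "ell2_inner (S (T f)) f = ell2_inner (T f) (T f)"
      using ell2_inner_commute[of f "S (T f)"] ell2_inner_commute[of "T f" "T f"] adj[of f "T f"] mem f
      by simp
    also have "ell2_inner (T (S f)) f = ell2_inner (S f) (S f)"
      using adj[of "S f" f] mem f by simp
    finally show ?thesis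
      using mem f by (simp add: ell2_inner_self)
  qed
  moreover have "ell2_bounded_op T" using TS by (simp add: adjoint_pair_def)
  ultimately show ?thesis
    unfolding hyponormal_def ell2_op_le_def
    by (auto simp: ell2_adjoint_eq[OF TS] mem nonneg_Reals_of_real_iff simp del: of_real_diff)
qed

text \<open>
  Shifting by \<open>j\<close> steps at once makes \<open>W\<close> and \<open>W\<^sup>3\<close> instances of one operator.
\<close>

definition fwd_shift :: "nat \<Rightarrow> (nat \<Rightarrow> real) \<Rightarrow> seq_op" where
  "fwd_shift j w f = (\<lambda>n. if n < j then 0 else of_real (w (n - j)) * f (n - j))"

definition bwd_shift :: "nat \<Rightarrow> (nat \<Rightarrow> real) \<Rightarrow> seq_op" where
  "bwd_shift j w f = (\<lambda>n. of_real (w n) * f (n + j))"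

lemma sums_shift_zero:
  fixes F :: "nat \<Rightarrow> 'a::real_normed_vector"
  assumes "\<And>n. n < j \<Longrightarrow> F n = 0"
  shows "F sums c \<longleftrightarrow> (\<lambda>n. F (n + j)) sums c"
  using sums_iff_shift[of F j c] assms by simp

lemma adjoint_pair_shift:
  assumes C: "\<And>n. \<bar>w n\<bar> \<le> C"
  shows "adjoint_pair (fwd_shift j w) (bwd_shift j w)"
proof -
  have C0: "C \<ge> 0" using C[of 0] by linarith
  have wf: "(\<lambda>n. of_real (w n) * f n) \<in> ell2" if "f \<in> ell2" for f
    using that by (rule ell2_le[where C = C]) (auto simp: norm_mult C intro!: mult_right_mono)
  have wle: "(cmod (of_real (w n) * z))\<^sup>2 \<le> C\<^sup>2 * (cmod z)\<^sup>2" for n z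
    using C[of n] C0 by (simp add: norm_mult power_mult_distrib abs_le_square_iff[symmetric] mult_right_mono)
  have F: "fwd_shift j w f \<in> ell2" if "f \<in> ell2" for f
  proof -
    have "summable (\<lambda>n. (cmod (fwd_shift j w f (n + j)))\<^sup>2)"
      using wf[OF that] by (simp add: fwd_shift_def ell2_def)
    then show ?thesis
      unfolding ell2_def mem_Collect_eq
      using summable_iff_shift[of "\<lambda>n. (cmod (fwd_shift j w f n))\<^sup>2" j] by blast
  qed
  have B: "bwd_shift j w f \<in> ell2" if "f \<in> ell2" for f
    unfolding bwd_shift_def
    using ell2_shift[OF that, of j] by (rule ell2_le[where C = C]) (auto simp: norm_mult C intro!: mult_right_mono)
  have Fn: "ell2_norm (fwd_shift j w f) \<le> C * ell2_norm f" if f: "f \<in> ell2" for f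
  proof -
    have "(\<lambda>n. (cmod (fwd_shift j w f n))\<^sup>2) sums (\<Sum>n. (cmod (fwd_shift j w f n))\<^sup>2)"
      using F[OF f] by (simp add: ell2_def summable_sums)
    then have "(\<lambda>n. (cmod (of_real (w n) * f n))\<^sup>2) sums (\<Sum>n. (cmod (fwd_shift j w f n))\<^sup>2)"
      by (subst (asm) sums_shift_zero[of j]) (auto simp: fwd_shift_def)
    then have "(\<Sum>n. (cmod (fwd_shift j w f n))\<^sup>2) = (\<Sum>n. (cmod (of_real (w n) * f n))\<^sup>2)"
      by (simp add: sums_iff)
    also have "\<dots> \<le> (\<Sum>n. C\<^sup>2 * (cmod (f n))\<^sup>2)"
      using f wf[OF f] wle by (intro suminf_le) (auto simp: ell2_def)
    also have "\<dots> = C\<^sup>2 * (\<Sum>n. (cmod (f n))\<^sup>2)"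
      using f by (simp add: suminf_mult ell2_def)
    finally show ?thesis
      unfolding ell2_norm_def using C0
      by (metis real_sqrt_le_mono real_sqrt_mult real_sqrt_abs abs_of_nonneg)
  qed
  have Bn: "ell2_norm (bwd_shift j w f) \<le> C * ell2_norm f" if f: "f \<in> ell2" for f
  proof -
    have "(\<Sum>n. (cmod (bwd_shift j w f n))\<^sup>2) \<le> (\<Sum>n. C\<^sup>2 * (cmod (f (n + j)))\<^sup>2)"
      using ell2_shift[OF f, of j] B[OF f] wle
      by (intro suminf_le) (auto simp: ell2_def bwd_shift_def)
    also have "\<dots> = C\<^sup>2 * (\<Sum>n. (cmod (f (n + j)))\<^sup>2)"
      using ell2_shift[OF f, of j] by (simp add: suminf_mult ell2_def)
    also have "\<dots> \<le> C\<^sup>2 * (\<Sum>n. (cmod (f n))\<^sup>2)"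
      using f suminf_split_initial_segment[of "\<lambda>n. (cmod (f n))\<^sup>2" j]
      by (intro mult_left_mono) (auto simp: ell2_def intro!: sum_nonneg)
    finally show ?thesis
      unfolding ell2_norm_def using C0
      by (metis real_sqrt_le_mono real_sqrt_mult real_sqrt_abs abs_of_nonneg)
  qed
  have I: "ell2_inner (fwd_shift j w f) g = ell2_inner f (bwd_shift j w g)"
    if "f \<in> ell2" "g \<in> ell2" for f g
  proof -
    have "(\<lambda>n. fwd_shift j w f n * cnj (g n)) sums ell2_inner (fwd_shift j w f) g"
      unfolding ell2_inner_def by (intro summable_sums ell2_summable_mult F that)
    then have "(\<lambda>n. f n * cnj (bwd_shift j w g n)) sums ell2_inner (fwd_shift j w f) g"
      by (subst (asm) sums_shift_zero[of j]) (auto simp: fwd_shift_def bwd_shift_def mult_ac)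
    then show ?thesis
      unfolding ell2_inner_def by (simp add: sums_iff)
  qed
  have "ell2_bounded_op (fwd_shift j w)"
    unfolding ell2_bounded_op_def using F Fn
    by (auto simp: fwd_shift_def fun_eq_iff algebra_simps)
  moreover have "ell2_bounded_op (bwd_shift j w)"
    unfolding ell2_bounded_op_def using B Bn
    by (auto simp: bwd_shift_def fun_eq_iff algebra_simps)
  ultimately show ?thesis
    unfolding adjoint_pair_def using I by blast
qed

section \<open>The self-commutator of \<open>W + s W\<^sup>3\<close>\<close>

lemma ell2_mult_bounded:
  "f \<in> ell2 \<Longrightarrow> (\<And>n. \<bar>w n\<bar> \<le> C) \<Longrightarrow> (\<lambda>n. complex_of_real (w n) * f n) \<in> ell2"
  by (rule ell2_le[where C = C]) (auto simp: norm_mult intro!: mult_right_mono)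

lemma summable_weighted_cross_term:
  assumes "f \<in> ell2" "g \<in> ell2" "\<And>n. \<bar>w n\<bar> \<le> C"
  shows "summable (\<lambda>n. w n * Re (s * f n * cnj (g n)))"
proof -
  have "summable (\<lambda>n. complex_of_real (w n) * (s * f n) * cnj (g n))"
    using assms by (intro ell2_summable_mult ell2_mult_bounded[where C = C] ell2_scale) auto
  then have "summable (\<lambda>n. Re (complex_of_real (w n) * (s * f n) * cnj (g n)))"
    by (rule summable_Re)
  then show ?thesis
    by (simp add: mult.assoc)
qed

lemma summable_weighted_square:
  assumes "f \<in> ell2" "\<And>n. \<bar>w n\<bar> \<le> C"
  shows "summable (\<lambda>n. w n * (cmod (f n))\<^sup>2)"
proof -
  have "f n * cnj (f n) = of_real ((cmod (f n))\<^sup>2)" for n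
    by (rule complex_norm_square[symmetric])
  then show ?thesis
    using summable_weighted_cross_term[of f f w C 1] assms by simp
qed

definition triple :: "(nat \<Rightarrow> real) \<Rightarrow> nat \<Rightarrow> real" where
  "triple a n = a n * a (n + 1) * a (n + 2)"

definition shift_poly :: "(nat \<Rightarrow> real) \<Rightarrow> complex \<Rightarrow> seq_op" where
  "shift_poly a s = (\<lambda>f n. weighted_shift a f n + s * (weighted_shift a ^^ 3) f n)"

definition shift_poly_adj :: "(nat \<Rightarrow> real) \<Rightarrow> complex \<Rightarrow> seq_op" where
  "shift_poly_adj a s = (\<lambda>f n. bwd_shift 1 a f n + cnj s * bwd_shift 3 (triple a) f n)"

lemma weighted_shift_eq: "weighted_shift a f = fwd_shift 1 a f"
  by (auto simp: weighted_shift_def fwd_shift_def fun_eq_iff split: nat.split)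

lemma weighted_shift_cube: "(weighted_shift a ^^ 3) f = fwd_shift 3 (triple a) f"
proof
  fix n :: nat
  consider "n = 0" | "n = 1" | "n = 2" | m where "n = m + 3"
  proof -
    have "n = 0 \<or> n = 1 \<or> n = 2 \<or> n = (n - 3) + 3" by arith
    then show ?thesis using that by blast
  qed
  then show "(weighted_shift a ^^ 3) f n = fwd_shift 3 (triple a) f n"
    by cases (simp_all add: numeral_3_eq_3 numeral_2_eq_2 weighted_shift_def fwd_shift_def triple_def mult_ac)
qed

lemma triple_bounded:
  assumes "\<And>n. \<bar>a n\<bar> \<le> C" shows "\<bar>triple a n\<bar> \<le> C * C * C"
  unfolding triple_def abs_mult
  using assms order_trans[OF abs_ge_zero assms] by (intro mult_mono) auto

lemma adjoint_pair_shift_poly: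
  assumes "\<And>n. \<bar>a n\<bar> \<le> C"
  shows "adjoint_pair (shift_poly a s) (shift_poly_adj a s)"
  unfolding shift_poly_def shift_poly_adj_def weighted_shift_eq[abs_def] weighted_shift_cube[unfolded weighted_shift_eq[abs_def]]
  by (intro adjoint_pair_add_scale adjoint_pair_shift[where C = C] adjoint_pair_shift[where C = "C * C * C"]
      triple_bounded assms)

text \<open>
  The diagonal of the self-commutator of \<open>W + s W\<^sup>3\<close>: the contributions of \<open>W\<close> and, with the factor
  \<open>t = \<bar>s\<bar>\<^sup>2\<close>, of \<open>W\<^sup>3\<close>. Weights with a negative index count as 0.
\<close>

definition comm_diag :: "(nat \<Rightarrow> real) \<Rightarrow> real \<Rightarrow> nat \<Rightarrow> real" where
  "comm_diag a t n = (a n)\<^sup>2 + t * (triple a n)\<^sup>2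
     - (if n < 1 then 0 else (a (n - 1))\<^sup>2) - (if n < 3 then 0 else t * (triple a (n - 3))\<^sup>2)"

text \<open>
  The entry at \<open>(n, n + 2)\<close>, up to the factor \<open>s\<close>; it comes from the mixed commutator of \<open>W\<close> and \<open>W\<^sup>3\<close>.
\<close>

definition comm_off :: "(nat \<Rightarrow> real) \<Rightarrow> nat \<Rightarrow> real" where
  "comm_off a n = a (n + 2) * triple a n - (if n < 1 then 0 else a (n - 1) * triple a (n - 1))"

definition comm_term :: "(nat \<Rightarrow> real) \<Rightarrow> complex \<Rightarrow> (nat \<Rightarrow> complex) \<Rightarrow> nat \<Rightarrow> real" where
  "comm_term a s f n = comm_diag a ((cmod s)\<^sup>2) n * (cmod (f n))\<^sup>2
     + 2 * comm_off a n * Re (s * f n * cnj (f (n + 2)))"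

lemma cmod_sq_sum:
  "(cmod (of_real x * z + s * (of_real y * w)))\<^sup>2
   = x\<^sup>2 * (cmod z)\<^sup>2 + (cmod s)\<^sup>2 * y\<^sup>2 * (cmod w)\<^sup>2 + 2 * (x * y) * Re (s * w * cnj z)"
  by (simp only: cmod_power2) (simp add: power2_eq_square algebra_simps)

text \<open>
  Both squared norms are expanded termwise. Every resulting series converges absolutely, so those
  belonging to different powers of the shift can be re-indexed separately and recombined at \<open>f\<^sub>n\<close>.
\<close>

lemma commutator_form:
  assumes C: "\<And>n. \<bar>a n\<bar> \<le> C" and f: "f \<in> ell2"
  shows "comm_term a s f sums
    ((\<Sum>n. (cmod (shift_poly a s f n))\<^sup>2) - (\<Sum>n. (cmod (shift_poly_adj a s f n))\<^sup>2))"
proof -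
  define b where "b = triple a"
  define t where "t = (cmod s)\<^sup>2"
  have b: "\<bar>b n\<bar> \<le> C * C * C" for n
    unfolding b_def by (rule triple_bounded[OF C])
  have C0: "0 \<le> C" using C[of 0] by linarith
  have a2: "\<bar>(a n)\<^sup>2\<bar> \<le> C\<^sup>2" for n
    using power_mono[OF C[of n], of 2] by simp
  have b2: "\<bar>t * (b n)\<^sup>2\<bar> \<le> t * (C * C * C)\<^sup>2" for n
    using power_mono[OF b[of n], of 2] by (simp add: t_def mult_left_mono)
  have ab: "\<bar>2 * (a i * b j)\<bar> \<le> 2 * (C * (C * C * C))" for i j
    using mult_mono[OF C[of i] b[of j]] C0 by (simp add: abs_mult)
  define P where "P = (\<lambda>n. (a n)\<^sup>2 * (cmod (f n))\<^sup>2)"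
  define Q where "Q = (\<lambda>n. t * (b n)\<^sup>2 * (cmod (f n))\<^sup>2)"
  define R where "R = (\<lambda>n. 2 * (a (n + 2) * b n) * Re (s * f n * cnj (f (n + 2))))"
  define P' where "P' = (\<lambda>n. if n < 1 then 0 else (a (n - 1))\<^sup>2 * (cmod (f n))\<^sup>2)"
  define Q' where "Q' = (\<lambda>n. if n < 3 then 0 else t * (b (n - 3))\<^sup>2 * (cmod (f n))\<^sup>2)"
  define R' where "R' = (\<lambda>n. if n < 1 then 0 else
      2 * (a (n - 1) * b (n - 1)) * Re (s * f n * cnj (f (n + 2))))"
  have sP: "P sums suminf P"
    unfolding P_def using f a2 by (intro summable_sums summable_weighted_square)
  have sQ: "Q sums suminf Q"
    unfolding Q_def using f b2 by (intro summable_sums summable_weighted_square)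
  have sR: "R sums suminf R"
    unfolding R_def using f ab by (intro summable_sums summable_weighted_cross_term ell2_shift)
  have "summable (\<lambda>n. P' (n + 1))" "summable (\<lambda>n. Q' (n + 3))"
    using summable_weighted_square[where w = "\<lambda>n. (a n)\<^sup>2", OF ell2_shift[OF f, of 1] a2]
      summable_weighted_square[where w = "\<lambda>n. t * (b n)\<^sup>2", OF ell2_shift[OF f, of 3] b2]
    by (simp_all add: P'_def Q'_def)
  moreover have "summable (\<lambda>n. R' (n + 1))"
    using summable_weighted_cross_term[where w = "\<lambda>n. 2 * (a n * b n)" and s = s,
        OF ell2_shift[OF f, of 1] ell2_shift[OF f, of 3] ab]
    by (simp add: R'_def eval_nat_numeral)
  ultimately have sP': "(\<lambda>n. P' (n + 1)) sums (\<Sum>n. P' (n + 1))" and sQ': "(\<lambda>n. Q' (n + 3)) sums (\<Sum>n. Q' (n + 3))"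
    and sR': "(\<lambda>n. R' (n + 1)) sums (\<Sum>n. R' (n + 1))"
    by (auto intro: summable_sums)
  have T: "(\<lambda>n. (cmod (shift_poly a s f n))\<^sup>2) sums (suminf P + suminf Q + suminf R)"
  proof -
    define Q2 where "Q2 = (\<lambda>n. if n < 2 then 0 else Q (n - 2) + R (n - 2))"
    have "(\<lambda>n. Q2 (n + 2)) sums (suminf Q + suminf R)"
      unfolding Q2_def using sums_add[OF sQ sR] by simp
    then have "Q2 sums (suminf Q + suminf R)"
      by (subst sums_shift_zero[of 2]) (auto simp: Q2_def)
    from sums_add[OF sP this] have "(\<lambda>n. P n + Q2 n) sums (suminf P + suminf Q + suminf R)"
      by (simp add: add_ac)
    also have "(\<lambda>n. P n + Q2 n) = (\<lambda>n. (cmod (shift_poly a s f (n + 1)))\<^sup>2)"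
    proof
      fix n
      have e: "shift_poly a s f (n + 1) = of_real (a n) * f n + s * (if n < 2 then 0 else of_real (b (n - 2)) * f (n - 2))"
        by (auto simp: shift_poly_def weighted_shift_cube weighted_shift_eq fwd_shift_def b_def)
      have "\<not> n < 2 \<Longrightarrow> Suc (Suc (n - 2)) = n" by arith
      then show "P n + Q2 n = (cmod (shift_poly a s f (n + 1)))\<^sup>2"
        unfolding e using cmod_sq_sum[of "a n" "f n" s "b (n - 2)" "f (n - 2)"]
        by (auto simp: P_def Q2_def Q_def R_def t_def norm_mult power_mult_distrib)
    qed
    finally show ?thesis
      by (subst sums_shift_zero[of 1])
         (auto simp: shift_poly_def weighted_shift_cube weighted_shift_eq fwd_shift_def)
  qed
  have S: "(\<lambda>n. (cmod (shift_poly_adj a s f n))\<^sup>2) sums ((\<Sum>n. P' (n + 1)) + (\<Sum>n. Q' (n + 3)) + (\<Sum>n. R' (n + 1)))"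
  proof -
    have "(cmod (shift_poly_adj a s f n))\<^sup>2 = P' (n + 1) + Q' (n + 3) + R' (n + 1)" for n
    proof -
      have r: "Re (cnj s * f (n + 3) * cnj (f (n + 1))) = Re (s * f (n + 1) * cnj (f (n + 3)))"
        by (simp add: algebra_simps)
      have "shift_poly_adj a s f n = of_real (a n) * f (n + 1) + cnj s * (of_real (b n) * f (n + 3))"
        by (simp add: shift_poly_adj_def bwd_shift_def b_def)
      then show ?thesis
        by (simp only: cmod_sq_sum r) (simp add: P'_def Q'_def R'_def t_def eval_nat_numeral)
    qed
    then show ?thesis
      using sums_add[OF sums_add[OF sP' sQ'] sR'] by simp
  qed
  have zP: "P' sums (\<Sum>n. P' (n + 1))"
    using sP' by (subst sums_shift_zero[of 1]) (auto simp: P'_def)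
  have zQ: "Q' sums (\<Sum>n. Q' (n + 3))"
    using sQ' by (subst sums_shift_zero[of 3]) (auto simp: Q'_def)
  have zR: "R' sums (\<Sum>n. R' (n + 1))"
    using sR' by (subst sums_shift_zero[of 1]) (auto simp: R'_def)
  have "(\<lambda>n. P n + Q n + R n - (P' n + Q' n + R' n)) sums
      (suminf P + suminf Q + suminf R - ((\<Sum>n. P' (n + 1)) + (\<Sum>n. Q' (n + 3)) + (\<Sum>n. R' (n + 1))))"
    by (intro sums_diff sums_add sP sQ sR zP zQ zR)
  also have "(\<lambda>n. P n + Q n + R n - (P' n + Q' n + R' n)) = comm_term a s f"
    by (auto simp: fun_eq_iff comm_term_def comm_diag_def comm_off_def P_def Q_def R_def P'_def Q'_def R'_def
        b_def t_def algebra_simps)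
  finally show ?thesis
    using T S by (simp add: sums_iff)
qed

lemma semi_cubically_hyponormal_iff:
  assumes C: "\<And>n. \<bar>a n\<bar> \<le> C"
  shows "semi_cubically_hyponormal (weighted_shift a) \<longleftrightarrow>
     (\<forall>s. \<forall>f\<in>ell2. 0 \<le> suminf (comm_term a s f))"
proof -
  have "hyponormal (shift_poly a s) \<longleftrightarrow> (\<forall>f\<in>ell2. 0 \<le> suminf (comm_term a s f))" for s
  proof -
    have "adjoint_pair (shift_poly a s) (shift_poly_adj a s)"
      using C by (rule adjoint_pair_shift_poly)
    moreover have "comm_term a s f sums
        ((\<Sum>n. (cmod (shift_poly a s f n))\<^sup>2) - (\<Sum>n. (cmod (shift_poly_adj a s f n))\<^sup>2))"
      if "f \<in> ell2" for f
      using C that by (rule commutator_form)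
    ultimately show ?thesis
      by (auto simp: hyponormal_iff_norm_le sums_iff)
  qed
  then show ?thesis
    by (simp add: semi_cubically_hyponormal_def shift_poly_def)
qed

section \<open>Positivity of the self-commutator form\<close>

text \<open>
  Multiplied by \<open>d\<close>, the form dominates the square of \<open>\<bar>c\<bar> \<bar>s\<bar> \<bar>z\<bar> - d \<bar>w\<bar>\<close>.
\<close>

lemma quadratic_form_nonneg:
  fixes z w s :: complex and c D d :: real
  assumes d: "0 < d" and le: "c\<^sup>2 * (cmod s)\<^sup>2 \<le> D * d"
  shows "0 \<le> D * (cmod z)\<^sup>2 + d * (cmod w)\<^sup>2 + 2 * c * Re (s * z * cnj w)"
proof -
  define X where "X = Re (s * z * cnj w)"
  have "\<bar>X\<bar> \<le> cmod s * cmod z * cmod w"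
    using abs_Re_le_cmod[of "s * z * cnj w"] by (simp only: norm_mult complex_mod_cnj X_def)
  then have "\<bar>c\<bar> * \<bar>X\<bar> \<le> \<bar>c\<bar> * (cmod s * cmod z * cmod w)"
    by (rule mult_left_mono) simp
  moreover have "- (\<bar>c\<bar> * \<bar>X\<bar>) \<le> c * X"
    by (simp add: abs_mult[symmetric])
  ultimately have cr: "- (\<bar>c\<bar> * cmod s * cmod z * cmod w) \<le> c * X"
    by linarith
  have "0 \<le> (\<bar>c\<bar> * cmod s * cmod z - d * cmod w)\<^sup>2"
    by simp
  also have "\<dots> = c\<^sup>2 * (cmod s)\<^sup>2 * (cmod z)\<^sup>2 + d * (d * (cmod w)\<^sup>2 - 2 * (\<bar>c\<bar> * cmod s * cmod z * cmod w))"
    by (simp add: power2_eq_square algebra_simps)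
  also have "\<dots> \<le> D * d * (cmod z)\<^sup>2 + d * (d * (cmod w)\<^sup>2 + 2 * (c * X))"
    using le d cr by (intro add_mono mult_right_mono mult_left_mono) (linarith | simp)+
  also have "\<dots> = d * (D * (cmod z)\<^sup>2 + d * (cmod w)\<^sup>2 + 2 * c * X)"
    by (simp add: algebra_simps)
  finally show ?thesis
    unfolding X_def[symmetric] using d by (simp add: zero_le_mult_iff)
qed

text \<open>
  Here \<open>\<phi>\<^sub>n\<close> bounds the pivot at \<open>n\<close> from below when squares are completed from the far end towards the
  first index. Each term then dominates \<open>\<phi>\<^sub>n \<bar>f\<^sub>n\<bar>\<^sup>2 - \<phi>\<^sub>n\<^sub>+\<^sub>2 \<bar>f\<^sub>n\<^sub>+\<^sub>2\<bar>\<^sup>2\<close>, and the sum telescopes to its two heads.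
\<close>

lemma suminf_comm_term_nonneg:
  assumes C: "\<And>n. \<bar>a n\<bar> \<le> C" and f: "f \<in> ell2"
    and nn: "\<And>n. 0 \<le> \<phi> n" and pos: "\<And>n. 0 < \<phi> (n + 2)" and B: "\<And>n. \<phi> n \<le> B"
    and le: "\<And>n. (comm_off a n)\<^sup>2 * (cmod s)\<^sup>2 \<le> (comm_diag a ((cmod s)\<^sup>2) n - \<phi> n) * \<phi> (n + 2)"
  shows "0 \<le> suminf (comm_term a s f)"
proof -
  define g where "g = (\<lambda>n. \<phi> n * (cmod (f n))\<^sup>2)"
  have g0: "g n \<ge> 0" for n
    using nn by (simp add: g_def)
  have "summable (\<lambda>n. B * (cmod (f n))\<^sup>2)"
    using f by (simp add: ell2_def)
  then have lim: "(\<lambda>n. B * (cmod (f n))\<^sup>2) \<longlonglongrightarrow> 0"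
    by (rule summable_LIMSEQ_zero)
  have "\<forall>\<^sub>F n in sequentially. norm (g n) \<le> B * (cmod (f n))\<^sup>2"
    using nn B by (auto simp: g_def mult_right_mono)
  then have g: "g \<longlonglongrightarrow> 0"
    using lim by (rule Lim_null_comparison)
  have "(\<lambda>n. g n + g (n + 1)) \<longlonglongrightarrow> 0 + 0"
    using LIMSEQ_ignore_initial_segment[OF g, of 1] by (intro tendsto_add g)
  then have tele: "(\<lambda>n. g n - g (n + 2)) sums (g 0 + g 1)"
    using telescope_sums'[of "\<lambda>n. g n + g (n + 1)" 0] by (simp add: eval_nat_numeral)
  have "g n - g (n + 2) \<le> comm_term a s f n" for n
    using quadratic_form_nonneg[OF pos le, of n "f n" "f (n + 2)"]
    unfolding g_def comm_term_def left_diff_distrib by linarith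
  then have "g 0 + g 1 \<le> suminf (comm_term a s f)"
    using tele commutator_form[where a = a and s = s, OF C f]
    by (intro sums_le[OF _ tele]) (auto simp: sums_iff)
  then show ?thesis
    using g0[of 0] g0[of 1] by linarith
qed

text \<open>
  When \<open>r\<^sup>2 c\<^sub>n\<^sup>2 = U V'\<close> along the odd tail, the tail form is a sum of squares
  \<open>(\<surd>U\<^sub>j x\<^sub>j + \<surd>V\<^sub>j\<^sub>+\<^sub>1 x\<^sub>j\<^sub>+\<^sub>1)\<^sup>2\<close> plus \<open>V\<^sub>0 x\<^sub>0\<^sup>2\<close>. The solution \<open>x\<^sub>j = (-1)\<^sup>j \<surd>R\<^sub>j\<close> kills every square but need not lie
  in \<open>\<ell>\<^sup>2\<close>. Boundedness of \<open>U\<^sub>j R\<^sub>j\<close> is the critical case: cutting this solution off linearly costs only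
  \<open>O(1/N)\<close>, so the tail contributes no more than \<open>V\<^sub>0\<close> to the first pivot.
\<close>

lemma tail_critical_necessary:
  fixes a :: "nat \<Rightarrow> real" and r :: real and U V R :: "nat \<Rightarrow> real"
  assumes nonneg: "\<And>f. f \<in> ell2 \<Longrightarrow> 0 \<le> suminf (comm_term a (of_real r) f)"
    and diag: "\<And>j. comm_diag a (r\<^sup>2) (2 * j + 3) = U j + V j"
    and off: "\<And>j. r * comm_off a (2 * j + 3) = sqrt (U j * V (Suc j))"
    and pos: "\<And>j. 0 < U j" "\<And>j. 0 < V j" "\<And>j. 0 < R j"
    and R: "R 0 = 1" "\<And>j. V (Suc j) * R (Suc j) = U j * R j" "\<And>j. U j * R j \<le> C"
  shows "0 \<le> comm_diag a (r\<^sup>2) 1 * z\<^sup>2 + 2 * (r * comm_off a 1) * z + V 0"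
proof -
  define c0 where "c0 = comm_diag a (r\<^sup>2) 1 * z\<^sup>2 + 2 * (r * comm_off a 1) * z + V 0"
  have "0 \<le> c0 + C / real N" if N: "N > 0" for N
  proof -
    \<comment> \<open>the null solution of the tail, cut off linearly; its support ends at \<open>j = N - 1\<close>\<close>
    define G where "G = (\<lambda>j. (-1) ^ j * sqrt (R j) * (if j \<le> N then 1 - real j / real N else 0))"
    define f where "f = (\<lambda>n. if n = 1 then complex_of_real z else
        if odd n then complex_of_real (G (n div 2 - 1)) else 0)"
    have f1: "f 1 = of_real z" by (simp add: f_def)
    have fodd: "f (2 * j + 3) = of_real (G j)" for j
      by (simp add: f_def)
    have fz: "f n = 0" if "n \<ge> 2 * N + 3" for n
    proof -
      have "n \<noteq> 1" "\<not> n div 2 - 1 < N" using that by auto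
      then show ?thesis using N by (auto simp: f_def G_def)
    qed
    have "f \<in> ell2" using fz by (rule ell2_finite_support)
    then have "0 \<le> suminf (comm_term a (of_real r) f)" by (rule nonneg)
    also have "comm_term a (of_real r) f sums sum (comm_term a (of_real r) f) (insert 1 ((\<lambda>j. 2 * j + 3) ` {..<N}))"
    proof (rule sums_finite)
      fix n assume n: "n \<notin> insert 1 ((\<lambda>j. 2 * j + 3) ` {..<N})"
      have "f n = 0"
      proof (cases "odd n \<and> n < 2 * N + 3")
        case True
        then obtain i where i: "n = 2 * i + 1" by (auto elim: oddE)
        with n have "i \<noteq> 0" by auto
        with i have "n = 2 * (i - 1) + 3" by simp
        moreover have "i - 1 < N" using True i \<open>i \<noteq> 0\<close> by simp
        ultimately show ?thesis using n by blast
      next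
        case False
        then show ?thesis using fz[of n] by (cases "even n") (auto simp: f_def)
      qed
      then show "comm_term a (of_real r) f n = 0"
        by (simp add: comm_term_def)
    qed simp
    then have "suminf (comm_term a (of_real r) f) = sum (comm_term a (of_real r) f) (insert 1 ((\<lambda>j. 2 * j + 3) ` {..<N}))"
      by (simp add: sums_iff)
    also have "\<dots> = comm_term a (of_real r) f 1 + (\<Sum>j<N. comm_term a (of_real r) f (2 * j + 3))"
      by (subst sum.insert) (auto simp: sum.reindex inj_on_def)
    also have "comm_term a (of_real r) f 1 = c0 - V 0"
      using fodd[of 0] f1 R(1) N
      by (simp add: comm_term_def c0_def G_def eval_nat_numeral)
    also have "(\<Sum>j<N. comm_term a (of_real r) f (2 * j + 3)) = (\<Sum>j<N. U j * R j / (real N)\<^sup>2 + (V j * (G j)\<^sup>2 - V (Suc j) * (G (Suc j))\<^sup>2))"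
    proof (rule sum.cong[OF refl])
      fix j assume "j \<in> {..<N}"
      then have j: "j < N" by simp
      have "sqrt (U j) * sqrt (R j) = sqrt (V (Suc j)) * sqrt (R (Suc j))"
        using R(2)[of j] by (simp add: real_sqrt_mult[symmetric])
      moreover have "sqrt (U j) * G j + sqrt (V (Suc j)) * G (Suc j)
          = (-1) ^ j * ((sqrt (U j) * sqrt (R j)) * (1 - real j / real N)
              - (sqrt (V (Suc j)) * sqrt (R (Suc j))) * (1 - real (Suc j) / real N))"
        using j unfolding G_def by (simp only: power_Suc less_imp_le Suc_leI if_True) algebra
      ultimately have "sqrt (U j) * G j + sqrt (V (Suc j)) * G (Suc j)
          = (-1) ^ j * (sqrt (U j) * sqrt (R j)) * (1 - real j / real N - (1 - real (Suc j) / real N))"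
        by (simp only: right_diff_distrib mult.assoc)
      \<comment> \<open>consecutive values of the cut-off differ by \<open>1 / N\<close>, so each square is \<open>U\<^sub>j R\<^sub>j / N\<^sup>2\<close>\<close>
      also have "1 - real j / real N - (1 - real (Suc j) / real N) = 1 / real N"
        using N by (simp add: field_simps)
      finally have "(sqrt (U j) * G j + sqrt (V (Suc j)) * G (Suc j))\<^sup>2 = U j * R j / (real N)\<^sup>2"
        using pos(1,3)[of j] by (simp add: power_mult_distrib power_divide flip: power_mult)
      moreover have "(sqrt (U j) * G j + sqrt (V (Suc j)) * G (Suc j))\<^sup>2
          = U j * (G j)\<^sup>2 + V (Suc j) * (G (Suc j))\<^sup>2 + 2 * (sqrt (U j * V (Suc j))) * G j * G (Suc j)"
        using pos(1)[of j] pos(2)[of "Suc j"]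
        by (simp add: power2_sum power_mult_distrib real_sqrt_mult)
      moreover have "comm_term a (of_real r) f (2 * j + 3)
          = (U j + V j) * (G j)\<^sup>2 + 2 * (sqrt (U j * V (Suc j))) * G j * G (Suc j)"
      proof -
        have "f (2 * j + 3 + 2) = of_real (G (Suc j))"
          using fodd[of "Suc j"] by (simp add: algebra_simps eval_nat_numeral)
        then show ?thesis
          unfolding comm_term_def by (simp add: fodd diag off[symmetric])
      qed
      ultimately show "comm_term a (of_real r) f (2 * j + 3)
          = U j * R j / (real N)\<^sup>2 + (V j * (G j)\<^sup>2 - V (Suc j) * (G (Suc j))\<^sup>2)"
        by (simp add: algebra_simps)
    qed
    also have "\<dots> = (\<Sum>j<N. U j * R j / (real N)\<^sup>2) + (V 0 * (G 0)\<^sup>2 - V N * (G N)\<^sup>2)"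
      by (simp add: sum.distrib sum_lessThan_telescope'[of "\<lambda>j. V j * (G j)\<^sup>2"])
    also have "(\<Sum>j<N. U j * R j / (real N)\<^sup>2) \<le> (\<Sum>j<N. C / (real N)\<^sup>2)"
      by (intro sum_mono divide_right_mono R(3)) auto
    also have "(\<Sum>j<N. C / (real N)\<^sup>2) = C / real N"
      using N by (simp add: power2_eq_square)
    also have "V 0 * (G 0)\<^sup>2 - V N * (G N)\<^sup>2 = V 0"
      using N R(1) by (simp add: G_def)
    finally show ?thesis by simp
  qed
  then have ev: "\<forall>\<^sub>F N in sequentially. 0 \<le> c0 + C / real N"
    by (intro eventually_mono[OF eventually_gt_at_top[of "0::nat"]])
  have "(\<lambda>N. c0 + C / real N) \<longlonglongrightarrow> c0 + 0"
    by (intro tendsto_add tendsto_const lim_const_over_n)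
  then have "0 \<le> c0 + 0"
    using ev by (rule tendsto_lowerbound) simp
  then show ?thesis by (simp add: c0_def)
qed

section \<open>Weights generated by two atoms\<close>

text \<open>
  The mean of the measure with atoms \<open>p\<close> and \<open>q\<close> is normalised to 1, which fixes the two masses as
  \<open>(q - 1) / (q - p)\<close> and \<open>(1 - p) / (q - p)\<close>.
\<close>

locale two_atoms =
  fixes p q :: real
  assumes p: "0 < p" "p < 1" and q: "1 < q"
begin

definition gam :: "nat \<Rightarrow> real" where
  "gam n = ((q - 1) * p ^ n + (1 - p) * q ^ n) / (q - p)"

text \<open>
  The variance of the measure; it is the coordinate \<open>h\<close> of the region.
\<close>

definition variance :: real where
  "variance = (1 - p) * (q - 1)"

definition wt :: "nat \<Rightarrow> real" where
  "wt n = (case n of 0 \<Rightarrow> 1 | Suc m \<Rightarrow> sqrt (gam (Suc m) / gam m))"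

lemma pq: "p < q" "0 < q" "0 < q - p" "0 < 1 - p" "0 < q - 1"
  using p q by auto

lemma variance_pos: "0 < variance"
  using pq by (simp add: variance_def)

lemma gam_pos: "0 < gam n"
  unfolding gam_def using p pq by (intro divide_pos_pos add_pos_pos mult_pos_pos) auto

lemma gam_0 [simp]: "gam 0 = 1" and gam_1 [simp]: "gam (Suc 0) = 1"
  using pq by (simp_all add: gam_def field_simps)

lemma gam_rec: "gam (Suc (Suc n)) = (p + q) * gam (Suc n) - p * q * gam n"
  unfolding gam_def times_divide_eq_right diff_divide_distrib[symmetric] power_Suc
  by (rule arg_cong[where f = "\<lambda>z. z / (q - p)"]) algebra

lemma gam_Suc_le: "gam (Suc n) \<le> q * gam n"
proof -
  have "(q - 1) * p ^ n * p \<le> (q - 1) * p ^ n * q"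
    using p pq by (intro mult_left_mono) auto
  then have "(q - 1) * p ^ Suc n + (1 - p) * q ^ Suc n \<le> q * ((q - 1) * p ^ n + (1 - p) * q ^ n)"
    by (simp add: algebra_simps)
  then show ?thesis
    unfolding gam_def times_divide_eq_right using pq by (intro divide_right_mono) auto
qed

lemma gam_ge: "(1 - p) / (q - p) * q ^ n \<le> gam n"
  unfolding gam_def times_divide_eq_left using pq p by (intro divide_right_mono) auto

text \<open>
  A minor of a two-atom moment sequence only sees the product of the two masses: the squares of the
  individual atoms cancel. This factorisation is the source of every identity for the self-commutator.
\<close>

lemma gam_minor:
  "gam (n + i + j) * gam n - gam (n + i) * gam (n + j)
   = variance * (p * q) ^ n * ((q ^ i - p ^ i) / (q - p)) * ((q ^ j - p ^ j) / (q - p))"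
proof -
  have "gam (n + i + j) * gam n - gam (n + i) * gam (n + j)
      = (((q - 1) * p ^ (n + i + j) + (1 - p) * q ^ (n + i + j)) * ((q - 1) * p ^ n + (1 - p) * q ^ n)
       - ((q - 1) * p ^ (n + i) + (1 - p) * q ^ (n + i)) * ((q - 1) * p ^ (n + j) + (1 - p) * q ^ (n + j))) / ((q - p) * (q - p))"
    unfolding gam_def times_divide_times_eq diff_divide_distrib by simp
  also have "((q - 1) * p ^ (n + i + j) + (1 - p) * q ^ (n + i + j)) * ((q - 1) * p ^ n + (1 - p) * q ^ n)
       - ((q - 1) * p ^ (n + i) + (1 - p) * q ^ (n + i)) * ((q - 1) * p ^ (n + j) + (1 - p) * q ^ (n + j))
      = variance * (p * q) ^ n * (q ^ i - p ^ i) * (q ^ j - p ^ j)"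
    unfolding variance_def power_add power_mult_distrib by algebra
  finally show ?thesis by simp
qed

lemma quotient_cube: "(q ^ 3 - p ^ 3) / (q - p) = p\<^sup>2 + p * q + q\<^sup>2"
proof -
  have "q ^ 3 - p ^ 3 = (p\<^sup>2 + p * q + q\<^sup>2) * (q - p)"
    by algebra
  then show ?thesis using pq by simp
qed

text \<open>
  The quotient \<open>(q\<^sup>3 - p\<^sup>3) / (q - p)\<close>.
\<close>

definition kap :: real where
  "kap = p\<^sup>2 + p * q + q\<^sup>2"

lemma kap_pos: "0 < kap"
  unfolding kap_def using p pq by (intro add_pos_pos mult_pos_pos) auto

lemma gam_minor_11: "gam (n + 2) * gam n - (gam (n + 1))\<^sup>2 = variance * (p * q) ^ n"
  using gam_minor[of n 1 1] pq by (simp add: power2_eq_square eval_nat_numeral)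

lemma gam_minor_13: "gam (n + 4) * gam n - gam (n + 1) * gam (n + 3) = variance * (p * q) ^ n * kap"
proof -
  have "n + 1 + 3 = n + 4" by simp
  then show ?thesis
    using gam_minor[of n 1 3] pq unfolding quotient_cube kap_def by (simp add: add.commute)
qed

lemma gam_minor_33: "gam (n + 6) * gam n - (gam (n + 3))\<^sup>2 = variance * (p * q) ^ n * kap\<^sup>2"
proof -
  have "gam (n + 3 + 3) * gam n - gam (n + 3) * gam (n + 3) = variance * (p * q) ^ n * kap * kap"
    using gam_minor[of n 3 3] unfolding quotient_cube kap_def .
  moreover have "n + 3 + 3 = n + 6" by simp
  ultimately show ?thesis by (simp add: power2_eq_square mult_ac)
qed

lemma wt_0 [simp]: "wt 0 = 1"
  by (simp add: wt_def)

lemma wt_pos: "0 < wt n"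
  by (cases n) (simp_all add: wt_def gam_pos)

lemma wt_Suc_sq: "(wt (Suc n))\<^sup>2 = gam (Suc n) / gam n"
  using gam_pos[of n] gam_pos[of "Suc n"] by (simp add: wt_def)

lemma wt_1 [simp]: "wt (Suc 0) = 1"
  by (simp add: wt_def)

lemma wt_bounded: "\<bar>wt n\<bar> \<le> q"
proof (cases n)
  case (Suc m)
  have "gam (Suc m) / gam m \<le> q"
    using gam_Suc_le[of m] gam_pos[of m] by (simp add: divide_le_eq)
  also have "q \<le> q\<^sup>2"
    using q by (simp add: power2_eq_square)
  finally have "(wt n)\<^sup>2 \<le> q\<^sup>2"
    by (simp add: Suc wt_Suc_sq)
  then show ?thesis
    using q abs_le_square_iff[of "wt n" q] by simp
qed (use q in simp)

lemma triple_0: "(triple wt 0)\<^sup>2 = gam 2"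
  using wt_Suc_sq[of 1] by (simp add: triple_def eval_nat_numeral)

lemma triple_Suc: "(triple wt (Suc n))\<^sup>2 = gam (n + 3) / gam n"
proof -
  have "n + 3 = Suc (Suc (Suc n))" by simp
  then show ?thesis
    unfolding triple_def power_mult_distrib
    using gam_pos[of n] gam_pos[of "Suc n"] gam_pos[of "Suc (Suc n)"]
    by (simp add: wt_Suc_sq \<open>n + 3 = Suc (Suc (Suc n))\<close>)
qed

text \<open>
  The diagonal entry \<open>u\<^sub>n\<close>, used for \<open>n > 0\<close>.
\<close>

definition comm_lin :: "nat \<Rightarrow> real" where
  "comm_lin n = (wt n)\<^sup>2 - (wt (n - 1))\<^sup>2"

text \<open>
  The coefficient \<open>v\<^sub>n\<close> of \<open>t\<close> in the diagonal, used for \<open>n > 0\<close>. At \<open>n = 3\<close> the subtracted term contains the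
  first weight, which does not belong to the moment sequence.
\<close>

definition comm_cub :: "nat \<Rightarrow> real" where
  "comm_cub n = (triple wt n)\<^sup>2 - (if n < 3 then 0 else (triple wt (n - 3))\<^sup>2)"

lemma comm_diag_0: "comm_diag wt t 0 = 1 + t * gam 2"
  by (simp add: comm_diag_def triple_0)

lemma comm_diag_eq: "n > 0 \<Longrightarrow> comm_diag wt t n = comm_lin n + t * comm_cub n"
  by (auto simp: comm_diag_def comm_lin_def comm_cub_def algebra_simps)

lemma comm_lin_1: "comm_lin (Suc 0) = 0"
  by (simp add: comm_lin_def)

lemma comm_cub_1: "comm_cub (Suc 0) = gam 3"
  using triple_Suc[of 0] by (simp add: comm_cub_def)

lemma comm_lin_eq: "comm_lin (n + 2) = variance * (p * q) ^ n / (gam n * gam (n + 1))"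
proof -
  have "comm_lin (n + 2) = gam (n + 2) / gam (n + 1) - gam (n + 1) / gam n"
    by (simp add: comm_lin_def wt_Suc_sq)
  also have "\<dots> = (gam (n + 2) * gam n - (gam (n + 1))\<^sup>2) / (gam n * gam (n + 1))"
    using gam_pos[of n] gam_pos[of "n + 1"] by (simp add: field_simps power2_eq_square)
  finally show ?thesis by (simp only: gam_minor_11)
qed

lemma comm_cub_eq: "comm_cub (n + 4) = variance * (p * q) ^ n * kap\<^sup>2 / (gam n * gam (n + 3))"
proof -
  have "comm_cub (n + 4) = gam (n + 6) / gam (n + 3) - gam (n + 3) / gam n"
    using triple_Suc[of "n + 3"] triple_Suc[of n] by (simp add: comm_cub_def eval_nat_numeral)
  also have "\<dots> = (gam (n + 6) * gam n - (gam (n + 3))\<^sup>2) / (gam n * gam (n + 3))"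
    using gam_pos[of n] gam_pos[of "n + 3"] by (simp add: field_simps power2_eq_square)
  finally show ?thesis by (simp only: gam_minor_33)
qed

lemma comm_cub_2: "comm_cub 2 = gam 4"
  using triple_Suc[of 1] by (simp add: comm_cub_def eval_nat_numeral)

lemma comm_cub_3: "comm_cub 3 = gam 5 / gam 2 - gam 2"
  using triple_Suc[of 2] triple_0 by (simp add: comm_cub_def eval_nat_numeral)

lemma comm_off_pos_form:
  "n > 0 \<Longrightarrow> comm_off wt n = wt n * wt (n + 1) * ((wt (n + 2))\<^sup>2 - (wt (n - 1))\<^sup>2)"
  by (auto simp: comm_off_def triple_def power2_eq_square algebra_simps)

lemma comm_off_0: "comm_off wt 0 = gam 2"
  using wt_Suc_sq[of 1] by (simp add: comm_off_def triple_def power2_eq_square eval_nat_numeral)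

lemma comm_off_1: "(comm_off wt (Suc 0))\<^sup>2 = (gam 3 - gam 2)\<^sup>2 / gam 2"
proof -
  have "(comm_off wt (Suc 0))\<^sup>2 = gam 2 * (gam 3 / gam 2 - 1)\<^sup>2"
    using wt_Suc_sq[of 1] wt_Suc_sq[of 2]
    by (simp add: comm_off_pos_form power_mult_distrib eval_nat_numeral)
  also have "\<dots> = (gam 3 - gam 2)\<^sup>2 / gam 2"
    using gam_pos[of 2] by (simp add: field_simps power2_eq_square)
  finally show ?thesis .
qed

text \<open>
  The tail of the form degenerates exactly: the squared off-diagonal entry is the product of the
  \<open>W\<close>-part at \<open>n\<close> and the \<open>W\<^sup>3\<close>-part at \<open>n + 2\<close>. Both parts, and the off-diagonal entry up to the
  weights in front of it, are minors divided by moments.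
\<close>

lemma comm_off_nonneg: "0 \<le> comm_off wt (n + 2)"
  and comm_off_sq: "(comm_off wt (n + 2))\<^sup>2 = comm_lin (n + 2) * comm_cub (n + 4)"
proof -
  define D where "D = (wt (n + 4))\<^sup>2 - (wt (n + 1))\<^sup>2"
  have c: "comm_off wt (n + 2) = wt (n + 2) * wt (n + 3) * D"
    by (simp add: comm_off_pos_form D_def eval_nat_numeral)
  have "D = gam (n + 4) / gam (n + 3) - gam (n + 1) / gam n"
    using wt_Suc_sq[of "n + 3"] wt_Suc_sq[of n] by (simp add: D_def add.commute)
  also have "\<dots> = (gam (n + 4) * gam n - gam (n + 1) * gam (n + 3)) / (gam n * gam (n + 3))"
    using gam_pos[of n] gam_pos[of "n + 3"] by (simp add: field_simps)
  finally have D: "D = variance * (p * q) ^ n * kap / (gam n * gam (n + 3))"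
    by (simp only: gam_minor_13)
  have "0 \<le> D"
    unfolding D using variance_pos kap_pos p pq gam_pos[of n] gam_pos[of "n + 3"] by simp
  then show "0 \<le> comm_off wt (n + 2)"
    unfolding c using wt_pos[of "n + 2"] wt_pos[of "n + 3"] by simp
  have "(comm_off wt (n + 2))\<^sup>2 = gam (n + 3) / gam (n + 1) * D\<^sup>2"
    using gam_pos[of "n + 2"] wt_Suc_sq[of "n + 1"] wt_Suc_sq[of "n + 2"]
    unfolding c power_mult_distrib by (simp add: eval_nat_numeral)
  also have "\<dots> = comm_lin (n + 2) * comm_cub (n + 4)"
    unfolding D comm_lin_eq comm_cub_eq
    using gam_pos[of n] gam_pos[of "n + 3"] gam_pos[of "n + 1"] by (simp add: field_simps power2_eq_square)
  finally show "(comm_off wt (n + 2))\<^sup>2 = comm_lin (n + 2) * comm_cub (n + 4)" .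
qed

lemma comm_lin_pos: "0 < comm_lin (n + 2)"
  unfolding comm_lin_eq using variance_pos p pq gam_pos by simp

lemma comm_cub_pos_4: "0 < comm_cub (n + 4)"
  unfolding comm_cub_eq using variance_pos kap_pos p pq gam_pos by simp

text \<open>
  The constant is sharp in the limit: \<open>\<gamma>\<^sub>n\<^sub>+\<^sub>2 / \<gamma>\<^sub>n\<close> tends to \<open>q\<^sup>2\<close>.
\<close>

lemma comm_cub_le: "comm_cub (n + 4) \<le> (kap / p)\<^sup>2 * comm_lin (n + 4)"
proof -
  have "gam (n + 2) \<le> q * (q * gam n)"
    using order_trans[OF gam_Suc_le[of "Suc n"] mult_left_mono[OF gam_Suc_le[of n]]] pq by simp
  then have "1 / gam n \<le> q\<^sup>2 / gam (n + 2)"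
    using gam_pos[of n] gam_pos[of "n + 2"] by (simp add: field_simps power2_eq_square)
  then have "variance * (p * q) ^ n * kap\<^sup>2 / gam (n + 3) * (1 / gam n) \<le> variance * (p * q) ^ n * kap\<^sup>2 / gam (n + 3) * (q\<^sup>2 / gam (n + 2))"
    using variance_pos p pq gam_pos[of "n + 3"] by (intro mult_left_mono) auto
  also have "\<dots> = (kap / p)\<^sup>2 * comm_lin (n + 4)"
    using comm_lin_eq[of "n + 2"] p by (simp add: power_divide power_add power_mult_distrib eval_nat_numeral mult_ac)
  finally show ?thesis
    by (simp add: comm_cub_eq mult_ac)
qed

section \<open>Semi-cubic hyponormality of the two-atom shift\<close>

lemma gam_minor_pos: "i > 0 \<Longrightarrow> j > 0 \<Longrightarrow> gam (n + i) * gam (n + j) < gam (n + i + j) * gam n"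
proof -
  assume "i > 0" "j > 0"
  then have "p ^ i < q ^ i" "p ^ j < q ^ j"
    using p pq by (auto intro: power_strict_mono)
  then have "0 < variance * (p * q) ^ n * ((q ^ i - p ^ i) / (q - p)) * ((q ^ j - p ^ j) / (q - p))"
    using variance_pos p pq by (intro mult_pos_pos divide_pos_pos) auto
  then show ?thesis
    using gam_minor[of n i j] by linarith
qed

lemma gam_mult_less: "i > 0 \<Longrightarrow> j > 0 \<Longrightarrow> gam i * gam j < gam (i + j)"
  using gam_minor_pos[of i j 0] by simp

lemma comm_cub_pos: "0 < comm_cub (n + 2)"
proof -
  consider "n = 0" | "n = 1" | m where "n = m + 2"
  proof -
    have "n = 0 \<or> n = 1 \<or> n = (n - 2) + 2" by arith
    then show ?thesis using that by blast
  qed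
  then show ?thesis
  proof cases
    case 1
    then show ?thesis using comm_cub_2 gam_pos[of 4] by (simp add: eval_nat_numeral)
  next
    case 2
    have "gam 2 * gam 2 < gam 3 * gam 2"
      using gam_mult_less[of 2 1] gam_pos[of 2] by (simp add: eval_nat_numeral)
    also have "\<dots> < gam 5"
      using gam_mult_less[of 3 2] by simp
    finally have "gam 2 < gam 5 / gam 2"
      using gam_pos[of 2] by (simp add: less_divide_eq)
    then show ?thesis using comm_cub_3 2 by (simp add: eval_nat_numeral)
  next
    case 3
    have "n + 2 = m + 4" using 3 by simp
    then show ?thesis using comm_cub_pos_4[of m] by (simp only:)
  qed
qed

lemma comm_diag_bounded: "t \<ge> 0 \<Longrightarrow> comm_diag wt t n \<le> q\<^sup>2 + t * (q * q * q)\<^sup>2"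
proof -
  assume t: "t \<ge> 0"
  have "(wt n)\<^sup>2 \<le> q\<^sup>2"
    using wt_bounded[of n] by (meson abs_le_square_iff order_trans abs_ge_self)
  moreover have "(triple wt n)\<^sup>2 \<le> (q * q * q)\<^sup>2"
    using triple_bounded[of wt q n, OF wt_bounded] by (meson abs_le_square_iff order_trans abs_ge_self)
  ultimately have "(wt n)\<^sup>2 + t * (triple wt n)\<^sup>2 \<le> q\<^sup>2 + t * (q * q * q)\<^sup>2"
    using t by (intro add_mono mult_left_mono)
  moreover have "comm_diag wt t n \<le> (wt n)\<^sup>2 + t * (triple wt n)\<^sup>2"
  proof -
    have "0 \<le> (if n < 1 then 0 else (wt (n - 1))\<^sup>2)" by simp
    moreover have "0 \<le> (if n < 3 then 0 else t * (triple wt (n - 3))\<^sup>2)" using t by simp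
    ultimately show ?thesis unfolding comm_diag_def by linarith
  qed
  ultimately show ?thesis by linarith
qed

text \<open>
  The lower bounds for the pivots. At \<open>n < 2\<close>, where a chain starts, a nonnegative pivot is enough.
\<close>

definition minorant :: "real \<Rightarrow> nat \<Rightarrow> real" where
  "minorant t n = (if n < 2 then 0 else t * comm_cub n + comm_lin n * max 0 (1 - (kap / p)\<^sup>2 * t))"

lemma minorant_pos:
  assumes "t \<ge> 0" shows "0 < minorant t (n + 2)"
proof (cases "t = 0")
  case True
  then show ?thesis using comm_lin_pos[of n] by (simp add: minorant_def)
next
  case False
  then have "0 < t * comm_cub (n + 2)" using assms comm_cub_pos[of n] by simp
  moreover have "0 \<le> comm_lin (n + 2) * max 0 (1 - (kap / p)\<^sup>2 * t)"
    using comm_lin_pos[of n] by simp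
  ultimately show ?thesis by (simp add: minorant_def)
qed

text \<open>
  From \<open>n = 2\<close> on the step reduces to \<open>comm_cub_le\<close>, that is to \<open>v \<le> d / t\<^sub>0\<close> with \<open>t\<^sub>0 = (p / kap)\<^sup>2\<close>.
  At \<open>n = 1\<close> the required inequality is affine in \<open>t\<close> on \<open>[0, t\<^sub>0]\<close> after division by \<open>t\<close>; the two hypotheses are its values at the two ends.
\<close>

lemma minorant_step:
  assumes t: "t \<ge> 0"
    and main: "(gam 3 - gam 2)\<^sup>2 / gam 2 \<le> (p / kap)\<^sup>2 * (gam 3 * comm_cub 3)"
    and zero: "(gam 3 - gam 2)\<^sup>2 / gam 2 \<le> gam 3 * comm_lin 3"
  shows "(comm_off wt n)\<^sup>2 * t \<le> (comm_diag wt t n - minorant t n) * minorant t (n + 2)"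
proof -
  define e where "e = max 0 (1 - (kap / p)\<^sup>2 * t)"
  have e: "0 \<le> e" "e \<le> 1" using t by (auto simp: e_def)
  have m: "minorant t (n + 2) = t * comm_cub (n + 2) + comm_lin (n + 2) * e" for n
    by (simp add: minorant_def e_def)
  consider "n = 0" | "n = 1" | j where "n = j + 2"
  proof -
    have "n = 0 \<or> n = 1 \<or> n = (n - 2) + 2" by arith
    then show ?thesis using that by blast
  qed
  then show ?thesis
  proof cases
    case 1
    have "(gam 2)\<^sup>2 * t \<le> gam 4 * t"
      using gam_mult_less[of 2 2] t by (intro mult_right_mono) (auto simp: power2_eq_square)
    also have "\<dots> \<le> minorant t 2"
      using m[of 0] comm_cub_2 comm_lin_pos[of 0] e by (simp add: eval_nat_numeral mult_ac)
    also have "\<dots> \<le> (1 + t * gam 2) * minorant t 2"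
      using minorant_pos[OF t, of 0] t gam_pos[of 2] by (simp add: distrib_right eval_nat_numeral)
    finally have "(gam 2)\<^sup>2 * t \<le> (1 + t * gam 2) * minorant t 2" .
    moreover have "minorant t 0 = 0" by (simp add: minorant_def)
    ultimately show ?thesis
      unfolding 1 comm_off_0 comm_diag_0 add_0 by simp
  next
    case 2
    define M where "M = (gam 3 - gam 2)\<^sup>2 / gam 2"
    have "M \<le> gam 3 * minorant t 3"
    proof (cases "(kap / p)\<^sup>2 * t \<le> 1")
      case True
      then have e1: "1 - e = (kap / p)\<^sup>2 * t" by (simp add: e_def)
      have "M = (1 - e) * M + e * M" by (simp add: algebra_simps)
      also have "\<dots> \<le> (1 - e) * ((p / kap)\<^sup>2 * (gam 3 * comm_cub 3)) + e * (gam 3 * comm_lin 3)"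
        using e main zero by (intro add_mono mult_left_mono) (auto simp: M_def)
      also have "(1 - e) * ((p / kap)\<^sup>2 * (gam 3 * comm_cub 3)) = t * (gam 3 * comm_cub 3)"
        unfolding e1 using p kap_pos by (simp add: power_divide)
      also have "t * (gam 3 * comm_cub 3) + e * (gam 3 * comm_lin 3) = gam 3 * minorant t 3"
        using m[of 1] by (simp add: algebra_simps eval_nat_numeral)
      finally show ?thesis .
    next
      case False
      then have "e = 0" by (simp add: e_def)
      have "1 = (p / kap)\<^sup>2 * (kap / p)\<^sup>2"
        using p kap_pos by (simp add: power_divide)
      then have "(p / kap)\<^sup>2 \<le> (p / kap)\<^sup>2 * ((kap / p)\<^sup>2 * t)"
        using False mult_left_mono[of 1 "(kap / p)\<^sup>2 * t" "(p / kap)\<^sup>2"] by simp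
      also have "\<dots> = t"
        using p kap_pos by (simp add: power_divide)
      finally have "(p / kap)\<^sup>2 * (gam 3 * comm_cub 3) \<le> t * (gam 3 * comm_cub 3)"
        using gam_pos[of 3] comm_cub_pos[of 1] by (intro mult_right_mono) (auto simp: eval_nat_numeral)
      also have "\<dots> = gam 3 * minorant t 3"
        using m[of 1] \<open>e = 0\<close> by (simp add: algebra_simps eval_nat_numeral)
      finally show ?thesis using main by (simp add: M_def)
    qed
    then have "M * t \<le> gam 3 * minorant t 3 * t"
      using t by (rule mult_right_mono)
    moreover have "comm_diag wt t 1 - minorant t 1 = gam 3 * t" "(comm_off wt 1)\<^sup>2 = M" "1 + 2 = (3::nat)"
      by (simp_all add: comm_off_1 comm_diag_eq comm_lin_1 comm_cub_1 minorant_def M_def)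
    ultimately show ?thesis
      unfolding 2 by (simp only: mult_ac)
  next
    case 3
    define u v d where "u = comm_lin (j + 2)" and "v = comm_cub (j + 4)" and "d = comm_lin (j + 4)"
    have u: "0 < u" unfolding u_def by (rule comm_lin_pos)
    have d: "0 < d" using comm_lin_pos[of "j + 2"] by (simp add: d_def eval_nat_numeral)
    have dv: "v \<le> (kap / p)\<^sup>2 * d" unfolding v_def d_def by (rule comm_cub_le)
    have "e * (t * v) \<le> (1 - e) * (d * e)"
    proof (cases "e = 0")
      case False
      then have "1 - e = (kap / p)\<^sup>2 * t" by (auto simp: e_def max_def split: if_splits)
      then have "(1 - e) * (d * e) = e * (t * ((kap / p)\<^sup>2 * d))" by (simp only: mult_ac)
      moreover have "e * (t * v) \<le> e * (t * ((kap / p)\<^sup>2 * d))"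
        using dv t e by (intro mult_left_mono)
      ultimately show ?thesis by (simp only:)
    qed simp
    then have "t * v \<le> (1 - e) * (t * v + d * e)"
      by (simp add: algebra_simps)
    then have "u * (t * v) \<le> u * ((1 - e) * (t * v + d * e))"
      using u by (intro mult_left_mono) auto
    moreover have "comm_diag wt t n - minorant t n = u * (1 - e)"
      unfolding 3 by (simp add: comm_diag_eq m u_def algebra_simps del: add_2_eq_Suc')
    moreover have "minorant t (n + 2) = t * v + d * e"
      using m[of "j + 2"] 3 by (simp add: v_def d_def eval_nat_numeral)
    moreover have "(comm_off wt n)\<^sup>2 = u * v"
      unfolding 3 u_def v_def by (rule comm_off_sq)
    ultimately show ?thesis by (simp add: mult_ac)
  qed
qed

lemma semi_cubically_hyponormal_if:
  assumes main: "(gam 3 - gam 2)\<^sup>2 / gam 2 \<le> (p / kap)\<^sup>2 * (gam 3 * comm_cub 3)"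
    and zero: "(gam 3 - gam 2)\<^sup>2 / gam 2 \<le> gam 3 * comm_lin 3"
  shows "semi_cubically_hyponormal (weighted_shift wt)"
proof (subst semi_cubically_hyponormal_iff[of wt q, OF wt_bounded], intro allI ballI)
  fix s :: complex and f assume f: "f \<in> ell2"
  define t where "t = (cmod s)\<^sup>2"
  have t: "t \<ge> 0" by (simp add: t_def)
  have nn: "0 \<le> minorant t n" for n
  proof (cases "n < 2")
    case False
    then have "n = (n - 2) + 2" by simp
    then show ?thesis using minorant_pos[OF t, of "n - 2"] by simp
  qed (simp add: minorant_def)
  have le: "minorant t n \<le> q\<^sup>2 + t * (q * q * q)\<^sup>2" for n
  proof (cases "n < 2")
    case True
    then show ?thesis using t by (simp add: minorant_def)
  next
    case False
    then have n: "n = (n - 2) + 2" by simp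
    have "comm_lin n * max 0 (1 - (kap / p)\<^sup>2 * t) \<le> comm_lin n * 1"
      using comm_lin_pos[of "n - 2"] n t by (intro mult_left_mono) auto
    then have "minorant t n \<le> comm_diag wt t n"
      using False by (simp add: minorant_def comm_diag_eq)
    also have "\<dots> \<le> q\<^sup>2 + t * (q * q * q)\<^sup>2" using t by (rule comm_diag_bounded)
    finally show ?thesis .
  qed
  show "0 \<le> suminf (comm_term wt s f)"
    using wt_bounded f nn minorant_pos[OF t] le minorant_step[OF t main zero]
    unfolding t_def by (rule suminf_comm_term_nonneg)
qed

text \<open>
  Only the critical value \<open>\<bar>s\<bar> = p / kap\<close> is tested. There \<open>R\<^sub>j\<close> is the squared null solution of the odd tail, and
  \<open>U\<^sub>j R\<^sub>j\<close> is a multiple of \<open>q\<^sup>n / \<gamma>\<^sub>n\<close>, hence bounded.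
\<close>

lemma semi_cubically_hyponormal_only_if:
  assumes "semi_cubically_hyponormal (weighted_shift wt)"
  shows "(gam 3 - gam 2)\<^sup>2 / gam 2 \<le> (p / kap)\<^sup>2 * (gam 3 * comm_cub 3)"
proof -
  define r where "r = p / kap"
  have r: "0 < r" using p kap_pos by (simp add: r_def)
  define c where "c = comm_off wt 1"
  \<comment> \<open>the minimiser of the quadratic polynomial in \<open>z\<close> that the tail criterion bounds below\<close>
  define z where "z = - (r * c) / (r\<^sup>2 * gam 3)"
  have "0 \<le> comm_diag wt (r\<^sup>2) 1 * z\<^sup>2 + 2 * (r * comm_off wt 1) * z + r\<^sup>2 * comm_cub (2 * 0 + 3)"
  proof (rule tail_critical_necessary[where U = "\<lambda>j. comm_lin (2 * j + 3)" and V = "\<lambda>j. r\<^sup>2 * comm_cub (2 * j + 3)"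
        and R = "\<lambda>j. gam (2 * j + 2) / (gam 2 * p ^ (2 * j))" and C = "variance * p * q / gam 2 * ((q - p) / (1 - p))"])
    fix j
    have e3: "2 * j + 3 = (2 * j + 1) + 2" and e5: "2 * Suc j + 3 = (2 * j + 1) + 4" by simp_all
    have di: "comm_lin (2 * j + 3) = variance * (p * q) ^ (2 * j + 1) / (gam (2 * j + 1) * gam (2 * j + 2))"
      unfolding e3 comm_lin_eq by simp
    have dc: "comm_cub (2 * Suc j + 3) = variance * (p * q) ^ (2 * j + 1) * kap\<^sup>2 / (gam (2 * j + 1) * gam (2 * j + 4))"
      unfolding e5 comm_cub_eq by (simp add: add.commute)
    show "comm_diag wt (r\<^sup>2) (2 * j + 3) = comm_lin (2 * j + 3) + r\<^sup>2 * comm_cub (2 * j + 3)"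
      by (simp add: comm_diag_eq)
    have "(r * comm_off wt (2 * j + 3))\<^sup>2 = comm_lin (2 * j + 3) * (r\<^sup>2 * comm_cub (2 * Suc j + 3))"
      unfolding power_mult_distrib e3 comm_off_sq e5 by simp
    then show "r * comm_off wt (2 * j + 3) = sqrt (comm_lin (2 * j + 3) * (r\<^sup>2 * comm_cub (2 * Suc j + 3)))"
      using r comm_off_nonneg[of "2 * j + 1"] unfolding e3 by (intro real_sqrt_unique[symmetric]) auto
    show "0 < comm_lin (2 * j + 3)" unfolding e3 by (rule comm_lin_pos)
    show "0 < r\<^sup>2 * comm_cub (2 * j + 3)" unfolding e3 using comm_cub_pos r by simp
    show "0 < gam (2 * j + 2) / (gam 2 * p ^ (2 * j))" using gam_pos p by simp
    define G where "G = gam (2 * Suc j + 2)"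
    have G4: "gam (2 * j + 4) = G"
      unfolding G_def by (rule arg_cong[where f = gam]) simp
    have G: "0 < G" unfolding G_def by (rule gam_pos)
    have pj: "p ^ (2 * Suc j) = p\<^sup>2 * p ^ (2 * j)" by (simp add: power2_eq_square)
    show "r\<^sup>2 * comm_cub (2 * Suc j + 3) * (gam (2 * Suc j + 2) / (gam 2 * p ^ (2 * Suc j)))
      = comm_lin (2 * j + 3) * (gam (2 * j + 2) / (gam 2 * p ^ (2 * j)))"
      unfolding dc di r_def G_def[symmetric] G4 pj using G gam_pos[of "2 * j + 1"] gam_pos[of "2 * j + 2"] gam_pos[of 2] p kap_pos
      by (simp add: power_divide)
    have "(1 - p) / (q - p) * q ^ (2 * j + 1) \<le> gam (2 * j + 1)"
      by (rule gam_ge)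
    then have "q ^ (2 * j + 1) / gam (2 * j + 1) \<le> (q - p) / (1 - p)"
      using gam_pos[of "2 * j + 1"] pq by (simp add: divide_simps mult_ac)
    then have "variance * p / gam 2 * (q ^ (2 * j + 1) / gam (2 * j + 1)) \<le> variance * p / gam 2 * ((q - p) / (1 - p))"
      using variance_pos p gam_pos[of 2] by (intro mult_left_mono) auto
    also have "\<dots> \<le> variance * p * q / gam 2 * ((q - p) / (1 - p))"
      using variance_pos p q gam_pos[of 2] pq by (intro mult_right_mono divide_right_mono) auto
    also have "variance * p / gam 2 * (q ^ (2 * j + 1) / gam (2 * j + 1))
        = comm_lin (2 * j + 3) * (gam (2 * j + 2) / (gam 2 * p ^ (2 * j)))"
      unfolding di using gam_pos[of "2 * j + 2"] p by (simp add: power_mult_distrib mult_ac)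
    finally show "comm_lin (2 * j + 3) * (gam (2 * j + 2) / (gam 2 * p ^ (2 * j)))
      \<le> variance * p * q / gam 2 * ((q - p) / (1 - p))" .
  next
    show "gam (2 * 0 + 2) / (gam 2 * p ^ (2 * 0)) = 1"
      using gam_pos[of 2] by (simp only: mult_0_right add_0 power_0 mult_1_right) simp
    show "\<And>f. f \<in> ell2 \<Longrightarrow> 0 \<le> suminf (comm_term wt (complex_of_real r) f)"
      using assms semi_cubically_hyponormal_iff[of wt q, OF wt_bounded] by blast
  qed
  then have "0 \<le> r\<^sup>2 * gam 3 * z\<^sup>2 + 2 * (r * c) * z + r\<^sup>2 * comm_cub 3"
    by (simp add: comm_diag_eq comm_lin_1 comm_cub_1 c_def)
  also have "r\<^sup>2 * gam 3 * z\<^sup>2 + 2 * (r * c) * z = - (c\<^sup>2 / gam 3)"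
    using r gam_pos[of 3] by (simp add: z_def power2_eq_square field_simps)
  finally have "c\<^sup>2 / gam 3 \<le> r\<^sup>2 * comm_cub 3" by simp
  then have "c\<^sup>2 \<le> r\<^sup>2 * (gam 3 * comm_cub 3)"
    using gam_pos[of 3] by (simp add: divide_le_eq mult_ac)
  then show ?thesis
    unfolding r_def c_def using comm_off_1 by simp
qed

end

section \<open>The region in the coordinates \<open>h\<close> and \<open>k\<close>\<close>

definition atom_sum :: "real \<Rightarrow> real \<Rightarrow> real" where
  "atom_sum h k = 1 + h + k + k / h"

definition atom_prod :: "real \<Rightarrow> real \<Rightarrow> real" where
  "atom_prod h k = k + k / h"

text \<open>
  The atoms are the roots of \<open>z\<^sup>2 - atom_sum z + atom_prod\<close>; this is their distance.
\<close>

definition atom_gap :: "real \<Rightarrow> real \<Rightarrow> real" where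
  "atom_gap h k = sqrt ((atom_sum h k)\<^sup>2 - 4 * atom_prod h k)"

definition lower_atom :: "real \<Rightarrow> real \<Rightarrow> real" where
  "lower_atom h k = (atom_sum h k - atom_gap h k) / 2"

definition upper_atom :: "real \<Rightarrow> real \<Rightarrow> real" where
  "upper_atom h k = (atom_sum h k + atom_gap h k) / 2"

text \<open>
  In terms of the atoms this is \<open>(p\<^sup>2 + p q + q\<^sup>2) / (1 + h)\<close>.
\<close>

definition quot :: "real \<Rightarrow> real \<Rightarrow> real" where
  "quot h k = (1 + h) * (1 + k / h)\<^sup>2 - k / h"

text \<open>
  The smallest value of \<open>lower_atom\<close> that satisfies the inequality of the region when the other quantities
  in it are kept fixed.
\<close>

definition crit :: "real \<Rightarrow> real \<Rightarrow> real" where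
  "crit h k = sqrt ((1 + h) * (h + k) / ((1 + h + k) * (quot h k + 1))) * quot h k"

context
  fixes h k :: real
  assumes h: "0 < h" and k: "0 < k"
begin

lemma atom_sum_eq: "atom_sum h k = (1 + h) * (1 + k / h)"
  using h by (simp add: atom_sum_def field_simps)

lemma atom_prod_eq: "atom_prod h k = (1 + h) * (k / h)"
  using h by (simp add: atom_prod_def field_simps)

lemma atom_disc_pos: "0 < (atom_sum h k)\<^sup>2 - 4 * atom_prod h k"
proof -
  have "(atom_sum h k)\<^sup>2 - 4 * atom_prod h k = ((1 + h) * (1 - k / h))\<^sup>2 + 4 * (1 + h) * h * (k / h)"
    unfolding atom_sum_eq atom_prod_eq by algebra
  moreover have "0 < 4 * (1 + h) * h * (k / h)"
    using h k by simp
  ultimately show ?thesis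
    using zero_le_power2[of "(1 + h) * (1 - k / h)"] by linarith
qed

lemma atom_gap_pos: "0 < atom_gap h k"
  unfolding atom_gap_def using atom_disc_pos by simp

lemma atom_gap_sq: "(atom_gap h k)\<^sup>2 = (atom_sum h k)\<^sup>2 - 4 * atom_prod h k"
  unfolding atom_gap_def using atom_disc_pos by simp

lemma atoms_add: "lower_atom h k + upper_atom h k = atom_sum h k"
  by (simp add: lower_atom_def upper_atom_def field_simps)

lemma atoms_mult: "lower_atom h k * upper_atom h k = atom_prod h k"
proof -
  have "lower_atom h k * upper_atom h k = ((atom_sum h k)\<^sup>2 - (atom_gap h k)\<^sup>2) / 4"
    by (simp add: lower_atom_def upper_atom_def power2_eq_square algebra_simps)
  then show ?thesis by (simp add: atom_gap_sq)
qed

lemma atoms_less: "lower_atom h k < upper_atom h k"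
  using atom_gap_pos by (simp add: lower_atom_def upper_atom_def)

lemma atoms_separate: "(1 - lower_atom h k) * (upper_atom h k - 1) = h"
proof -
  have "(1 - lower_atom h k) * (upper_atom h k - 1)
      = (lower_atom h k + upper_atom h k) - lower_atom h k * upper_atom h k - 1"
    by (simp add: algebra_simps)
  then show ?thesis
    unfolding atoms_add atoms_mult atom_sum_def atom_prod_def by simp
qed

lemma lower_atom_less_1: "lower_atom h k < 1" and upper_atom_gt_1: "1 < upper_atom h k"
proof -
  have "0 < (1 - lower_atom h k) * (upper_atom h k - 1)"
    using h by (simp add: atoms_separate)
  then have "(0 < 1 - lower_atom h k \<and> 0 < upper_atom h k - 1) \<or> (1 - lower_atom h k < 0 \<and> upper_atom h k - 1 < 0)"
    by (auto simp: zero_less_mult_iff)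
  then show "lower_atom h k < 1" "1 < upper_atom h k"
    using atoms_less by auto
qed

lemma lower_atom_pos: "0 < lower_atom h k"
proof -
  have "0 < lower_atom h k * upper_atom h k"
    using h k by (simp add: atoms_mult atom_prod_def add_pos_pos)
  then show ?thesis
    using upper_atom_gt_1 by (simp add: zero_less_mult_iff)
qed

lemma two_atoms_hk: "two_atoms (lower_atom h k) (upper_atom h k)"
  using lower_atom_pos lower_atom_less_1 upper_atom_gt_1 by unfold_locales

text \<open>
  Below 1, and hence below the upper atom, the quadratic polynomial is nonnegative exactly up to its
  smaller root. This turns every comparison with \<open>lower_atom\<close> into a polynomial inequality.
\<close>

lemma le_lower_atom_iff:
  assumes "z < 1"
  shows "z \<le> lower_atom h k \<longleftrightarrow> 0 \<le> z\<^sup>2 - atom_sum h k * z + atom_prod h k"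
proof -
  have "z\<^sup>2 - atom_sum h k * z + atom_prod h k = (lower_atom h k - z) * (upper_atom h k - z)"
    unfolding atoms_add[symmetric] atoms_mult[symmetric] by algebra
  moreover have "0 < upper_atom h k - z"
    using upper_atom_gt_1 assms by simp
  ultimately show ?thesis
    by (simp add: zero_le_mult_iff)
qed

lemma lower_atom_root: "(lower_atom h k)\<^sup>2 - atom_sum h k * lower_atom h k + atom_prod h k = 0"
  unfolding atoms_add[symmetric] atoms_mult[symmetric] by algebra

lemma lower_atom_less_slope: "lower_atom h k < k / h"
proof (rule ccontr)
  assume "\<not> lower_atom h k < k / h"
  then have le: "k / h \<le> lower_atom h k" by simp
  then have "0 \<le> (k / h)\<^sup>2 - atom_sum h k * (k / h) + atom_prod h k"
    using lower_atom_less_1 le_lower_atom_iff[of "k / h"] by simp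
  also have "\<dots> = - h * (k / h)\<^sup>2"
    unfolding atom_sum_eq atom_prod_eq by algebra
  finally have "h * (k / h)\<^sup>2 \<le> 0" by simp
  moreover have "0 < h * (k / h)\<^sup>2"
    using h k by (intro mult_pos_pos zero_less_power divide_pos_pos) auto
  ultimately show False by simp
qed

lemma quot_gt_1: "1 + k / h + (k / h)\<^sup>2 < quot h k"
proof -
  have "quot h k = 1 + k / h + (k / h)\<^sup>2 + h * (1 + k / h)\<^sup>2"
    unfolding quot_def by algebra
  moreover have "0 < h * (1 + k / h)\<^sup>2"
    using h k by (intro mult_pos_pos zero_less_power add_pos_pos divide_pos_pos) auto
  ultimately show ?thesis by simp
qed

lemma quot_pos: "1 < quot h k"
proof -
  have "0 < k / h" using h k by simp
  then show ?thesis using quot_gt_1 zero_le_power2[of "k / h"] by linarith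
qed

lemma crit_le_iff:
  assumes "0 \<le> z"
  shows "crit h k \<le> z \<longleftrightarrow> (1 + h) * (h + k) * (quot h k)\<^sup>2 \<le> z\<^sup>2 * ((1 + h + k) * (quot h k + 1))"
proof -
  have q: "0 < quot h k" "0 < quot h k + 1" using quot_pos by auto
  have d: "0 < (1 + h + k) * (quot h k + 1)" using h k q by simp
  have "crit h k = sqrt ((1 + h) * (h + k) / ((1 + h + k) * (quot h k + 1)) * (quot h k)\<^sup>2)"
    unfolding crit_def real_sqrt_mult using q by simp
  also have "\<dots> \<le> z \<longleftrightarrow> (1 + h) * (h + k) / ((1 + h + k) * (quot h k + 1)) * (quot h k)\<^sup>2 \<le> z\<^sup>2"
    using assms real_sqrt_le_iff[of _ "z\<^sup>2"] by simp
  also have "\<dots> \<longleftrightarrow> (1 + h) * (h + k) * (quot h k)\<^sup>2 \<le> z\<^sup>2 * ((1 + h + k) * (quot h k + 1))"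
    using d by (simp add: pos_divide_le_eq)
  finally show ?thesis .
qed

end

text \<open>
  The Stampfli recursion is the three-term recursion of the moments, written for their quotients.
\<close>

lemma alpha_xy_eq_wt:
  assumes h: "0 < h" and k: "0 < k"
  shows "alpha_xy (1 + h) (1 + h + k) = two_atoms.wt (lower_atom h k) (upper_atom h k)"
proof -
  interpret two_atoms "lower_atom h k" "upper_atom h k"
    using h k by (rule two_atoms_hk)
  have rec: "gam (Suc (Suc n)) = atom_sum h k * gam (Suc n) - atom_prod h k * gam n" for n
    using gam_rec[of n] by (simp add: atoms_add atoms_mult h k)
  have g2: "gam (Suc (Suc 0)) = 1 + h"
    using rec[of 0] by (simp add: atom_sum_def atom_prod_def)
  have g3: "gam (Suc (Suc (Suc 0))) = (1 + h) * (1 + h + k)"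
  proof -
    have "gam (Suc (Suc (Suc 0))) = (1 + h) * (1 + k / h) * (1 + h) - (1 + h) * (k / h)"
      using rec[of "Suc 0"] g2 by (simp add: atom_sum_eq[OF h k] atom_prod_eq[OF h k])
    also have "\<dots> = (1 + h) * (1 + h + h * (k / h))"
      by algebra
    finally show ?thesis using h by simp
  qed
  have P1: "stampfli_Psi1 1 (sqrt (1 + h)) (sqrt (1 + h + k)) = atom_sum h k"
    using h k by (simp add: stampfli_Psi1_def atom_sum_def field_simps)
  have P0: "stampfli_Psi0 1 (sqrt (1 + h)) (sqrt (1 + h + k)) = - atom_prod h k"
    using h k by (simp add: stampfli_Psi0_def atom_prod_def field_simps)
  have st: "stampfli 1 (sqrt (1 + h)) (sqrt (1 + h + k)) m = sqrt (gam (Suc m) / gam m)" for m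
  proof (induction m rule: induct_nat_012)
    case (ge2 n)
    show ?case
    proof (cases n)
      case 0
      then show ?thesis using h by (simp add: g2 g3)
    next
      case (Suc j)
      have st: "(stampfli 1 (sqrt (1 + h)) (sqrt (1 + h + k)) (Suc n))\<^sup>2 = gam (Suc (Suc n)) / gam (Suc n)"
        using ge2(2) gam_pos[of "Suc (Suc n)"] gam_pos[of "Suc n"] by simp
      have "gam (Suc (Suc (Suc n))) / gam (Suc (Suc n)) = atom_sum h k - atom_prod h k / (gam (Suc (Suc n)) / gam (Suc n))"
        using rec[of "Suc n"] gam_pos[of "Suc (Suc n)"] gam_pos[of "Suc n"] by (simp add: field_simps)
      then show ?thesis using st Suc by (simp add: P1 P0)
    qed
  qed (simp_all add: g2)
  show ?thesis
    by (auto simp: fun_eq_iff alpha_xy_def wt_def st split: nat.split)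
qed

text \<open>
  The two hypotheses of the sufficient criterion become \<open>crit h k \<le> lower_atom h k\<close> and \<open>h (1 + t) \<le> t\<close>,
  and the first implies the second: if \<open>t < h (1 + t)\<close>, then \<open>quot h k\<close> exceeds \<open>2 t (1 + t)\<close>, whereas
  \<open>lower_atom h k < t\<close> gives \<open>h quot h k < 2 t\<^sup>2\<close>.
\<close>

lemma region_R_iff:
  "(h, k) \<in> region_R \<longleftrightarrow> 0 < h \<and> 0 < k \<and> crit h k \<le> lower_atom h k"
proof (cases "0 < h \<and> 0 < k")
  case True
  then have h: "0 < h" and k: "0 < k" by auto
  interpret two_atoms "lower_atom h k" "upper_atom h k"
    using h k by (rule two_atoms_hk)
  define E m t x y pp where "E = quot h k" and "m = h + k" and "t = k / h" and "x = 1 + h" and "y = 1 + h + k"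
    and "pp = lower_atom h k"
  have t: "0 < t" "k = t * h" using h k by (auto simp: t_def)
  have s: "atom_sum h k = x * (1 + t)" and r: "atom_prod h k = x * t"
    using atom_sum_eq[OF h k] atom_prod_eq[OF h k] by (simp_all add: x_def t_def)
  have pos: "0 < x" "0 < y" "0 < m" "1 < E" "0 < pp"
    using h k quot_pos[OF h k] lower_atom_pos[OF h k] by (auto simp: x_def y_def m_def E_def pp_def)
  have E: "E = x * (1 + t)\<^sup>2 - t" by (simp add: E_def quot_def x_def t_def)
  have ym: "y = 1 + m" "x = 1 + h" "m = h * (1 + t)"
    using t by (simp_all add: y_def m_def x_def algebra_simps)
  have rec: "gam (Suc (Suc n)) = x * (1 + t) * gam (Suc n) - x * t * gam n" for n
    using gam_rec[of n] by (simp add: atoms_add atoms_mult h k s r)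
  have g2: "gam 2 = x"
    using rec[of 0] by (simp add: eval_nat_numeral algebra_simps)
  have g3: "gam 3 = x * y"
    using rec[of 1] g2 by (simp add: eval_nat_numeral ym algebra_simps)
  have g4: "gam 4 = x * (1 + t) * (x * y) - x * t * x"
    using rec[of 2] g2 g3 by (simp add: eval_nat_numeral)
  have g5: "gam 5 = x * (1 + t) * (x * (1 + t) * (x * y) - x * t * x) - x * t * (x * y)"
    using rec[of 3] g4 g3 by (simp add: eval_nat_numeral)
  have kap: "kap = x * E"
  proof -
    have "kap = (lower_atom h k + upper_atom h k)\<^sup>2 - lower_atom h k * upper_atom h k"
      by (simp add: kap_def power2_eq_square algebra_simps)
    also have "\<dots> = x * E"
      unfolding atoms_add[OF h k] atoms_mult[OF h k] s r E by algebra
    finally show ?thesis .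
  qed
  have d3: "comm_cub 3 = x * m * (E + 1)"
  proof -
    have "gam 5 / gam 2 = (1 + t) * (x * (1 + t) * (x * y) - x * t * x) - x * t * y"
      unfolding g5 g2 using pos by (simp add: field_simps)
    then show ?thesis
      unfolding comm_cub_3 g2 E ym by algebra
  qed
  have i3: "comm_lin 3 = k"
  proof -
    have "comm_lin 3 = variance * (x * t) / x"
      using comm_lin_eq[of 1] g2 by (simp add: eval_nat_numeral atoms_mult h k r)
    also have "variance = h" using atoms_separate[OF h k] by (simp add: variance_def)
    finally show ?thesis using pos t by simp
  qed
  have L: "(gam 3 - gam 2)\<^sup>2 / gam 2 = x * m\<^sup>2"
    unfolding g3 g2 ym(1) using pos by (simp add: field_simps power2_eq_square)
  have A: "(pp / kap)\<^sup>2 * (gam 3 * comm_cub 3) = m / E\<^sup>2 * (pp\<^sup>2 * (y * (E + 1)))"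
    unfolding kap g3 d3 using pos by (simp add: field_simps power2_eq_square)
  have B: "x * m\<^sup>2 = m / E\<^sup>2 * (x * m * E\<^sup>2)"
    using pos by (simp add: field_simps power2_eq_square)
  have C: "0 < m / E\<^sup>2" using pos by simp
  have main: "(gam 3 - gam 2)\<^sup>2 / gam 2 \<le> (pp / kap)\<^sup>2 * (gam 3 * comm_cub 3)
      \<longleftrightarrow> x * m * E\<^sup>2 \<le> pp\<^sup>2 * (y * (E + 1))"
    unfolding L A B by (rule mult_le_cancel_left_pos[OF C])
  also have "\<dots> \<longleftrightarrow> crit h k \<le> lower_atom h k"
    using crit_le_iff[OF h k, of "lower_atom h k"] pos by (simp add: x_def y_def m_def E_def pp_def)
  finally have main': "(gam 3 - gam 2)\<^sup>2 / gam 2 \<le> (pp / kap)\<^sup>2 * (gam 3 * comm_cub 3)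
      \<longleftrightarrow> crit h k \<le> lower_atom h k" .
  have zero: "(gam 3 - gam 2)\<^sup>2 / gam 2 \<le> gam 3 * comm_lin 3" if c: "x * m * E\<^sup>2 \<le> pp\<^sup>2 * (y * (E + 1))"
  proof -
    have "h * (1 + t) \<le> t"
    proof (rule ccontr)
      assume "\<not> h * (1 + t) \<le> t"
      then have ht: "t < h * (1 + t)" by simp
      have "pp\<^sup>2 < t\<^sup>2"
        using lower_atom_less_slope[OF h k] pos by (intro power_strict_mono) (auto simp: pp_def t_def)
      have "x * (1 + t) * (h * E\<^sup>2) \<le> pp\<^sup>2 * (y * (E + 1))"
        using c by (simp add: ym mult_ac)
      also have "\<dots> < t\<^sup>2 * (y * (E + 1))"
        using \<open>pp\<^sup>2 < t\<^sup>2\<close> pos by (intro mult_strict_right_mono) auto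
      also have "\<dots> \<le> t\<^sup>2 * ((x * (1 + t)) * (E + E))"
        using pos t h by (intro mult_left_mono mult_mono) (auto simp: ym algebra_simps)
      also have "\<dots> = x * (1 + t) * (E * (2 * t\<^sup>2))" by algebra
      finally have "x * (1 + t) * (E * (h * E)) < x * (1 + t) * (E * (2 * t\<^sup>2))"
        by (simp add: power2_eq_square mult_ac)
      then have hE: "h * E < 2 * t\<^sup>2"
        using pos t by (simp add: mult_less_cancel_left_pos)
      have "E = (1 + t)\<^sup>2 - t + (h * (1 + t)) * (1 + t)"
        unfolding E ym by algebra
      also have "\<dots> \<ge> (1 + t)\<^sup>2 - t + t * (1 + t)"
        using ht t by (intro add_left_mono mult_right_mono) auto
      finally have "2 * t * (1 + t) \<le> E"
        by (simp add: power2_eq_square algebra_simps)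
      then have "h * (2 * t * (1 + t)) \<le> h * E" using h by (intro mult_left_mono) auto
      with hE have "(h * (1 + t)) * (2 * t) < t * (2 * t)" by (simp add: power2_eq_square mult_ac)
      then show False using ht t by (simp add: mult_less_cancel_right_pos)
    qed
    then have "h * (h * (1 + t)) \<le> h * t" using h by (intro mult_left_mono) auto
    then have "m\<^sup>2 \<le> y * k"
      unfolding ym t(2) by (simp add: power2_eq_square algebra_simps)
    then have "x * m\<^sup>2 \<le> x * (y * k)" using pos by (intro mult_left_mono) auto
    then show ?thesis unfolding L unfolding g3 i3 by (simp add: mult_ac)
  qed
  have "semi_cubically_hyponormal (weighted_shift wt) \<longleftrightarrow> crit h k \<le> lower_atom h k"
    using semi_cubically_hyponormal_if semi_cubically_hyponormal_only_if main main' zero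
    unfolding pp_def by blast
  then show ?thesis
    using h k by (simp add: region_R_def alpha_xy_eq_wt)
qed (auto simp: region_R_def)

section \<open>Monotonicity along rays\<close>

definition slack :: "real \<Rightarrow> real \<Rightarrow> real" where
  "slack h k = lower_atom h k - crit h k"

lemma region_R_iff_slack: "(h, k) \<in> region_R \<longleftrightarrow> 0 < h \<and> 0 < k \<and> 0 \<le> slack h k"
  by (simp add: region_R_iff slack_def)

definition quadrant :: "(real \<times> real) set" where
  "quadrant = {z. 0 < fst z \<and> 0 < snd z}"

lemma open_quadrant: "open quadrant"
proof -
  have eq: "quadrant = {0<..} \<times> {0<..}" by (auto simp: quadrant_def)
  show ?thesis unfolding eq by (intro open_Times open_greaterThan)
qed

lemma continuous_on_quot: "continuous_on quadrant (\<lambda>z. quot (fst z) (snd z))"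
  unfolding quot_def by (intro continuous_intros) (auto simp: quadrant_def)

lemma continuous_on_slack: "continuous_on quadrant (\<lambda>z. slack (fst z) (snd z))"
proof -
  have "(1 + fst z + snd z) * (quot (fst z) (snd z) + 1) \<noteq> 0" if "z \<in> quadrant" for z
    using that quot_pos[of "fst z" "snd z"] by (simp add: quadrant_def)
  then have "continuous_on quadrant (\<lambda>z. crit (fst z) (snd z))"
    unfolding crit_def by (intro continuous_intros continuous_on_quot) auto
  moreover have "continuous_on quadrant (\<lambda>z. lower_atom (fst z) (snd z))"
    unfolding lower_atom_def atom_gap_def atom_sum_def atom_prod_def
    by (intro continuous_intros) (auto simp: quadrant_def)
  ultimately show ?thesis
    unfolding slack_def by (intro continuous_intros)
qed

lemma continuous_on_slack_compose:
  assumes "continuous_on S u" "continuous_on S v" "\<And>s. s \<in> S \<Longrightarrow> 0 < u s" "\<And>s. s \<in> S \<Longrightarrow> 0 < v s"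
  shows "continuous_on S (\<lambda>s. slack (u s) (v s))"
proof -
  have "continuous_on S ((\<lambda>z. slack (fst z) (snd z)) \<circ> (\<lambda>s. (u s, v s)))"
    using assms
    by (intro continuous_on_compose continuous_intros continuous_on_subset[OF continuous_on_slack])
       (auto simp: quadrant_def)
  then show ?thesis by (simp add: o_def)
qed

lemma lower_atom_ge:
  assumes h: "0 < h" and t: "0 < t"
  shows "t / (1 + t) \<le> lower_atom h (t * h)"
proof -
  have k: "0 < t * h" using h t by simp
  have "t / (1 + t) * (1 + t) = t" using t by simp
  then have "(t / (1 + t))\<^sup>2 - atom_sum h (t * h) * (t / (1 + t)) + atom_prod h (t * h) = (t / (1 + t))\<^sup>2"
    using atom_sum_eq[OF h k] atom_prod_eq[OF h k] h by (simp add: mult_ac)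
  then show ?thesis
    using t by (subst le_lower_atom_iff[OF h k]) auto
qed

text \<open>
  The smaller root \<open>z\<close> for \<open>h'\<close> satisfies \<open>z\<^sup>2 = (1 + h') ((1 + t) z - t)\<close> with a nonnegative last factor, so
  decreasing \<open>h'\<close> makes the quadratic polynomial nonnegative at \<open>z\<close>.
\<close>

lemma lower_atom_antimono_ray:
  assumes h: "0 < h" "h < h'" and t: "0 < t"
  shows "lower_atom h' (t * h') \<le> lower_atom h (t * h)"
proof -
  have h': "0 < h'" using h by simp
  define z where "z = lower_atom h' (t * h')"
  have z1: "z < 1" unfolding z_def using h' t by (intro lower_atom_less_1) auto
  have "t / (1 + t) \<le> z"
    using lower_atom_ge[OF h' t] unfolding z_def .
  then have tz: "t \<le> (1 + t) * z" using t by (simp add: field_simps)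
  have "z\<^sup>2 = (1 + h') * ((1 + t) * z - t)"
    using lower_atom_root[of h' "t * h'"] atom_sum_eq[of h' "t * h'"] atom_prod_eq[of h' "t * h'"] h' t
    unfolding z_def by (simp add: algebra_simps)
  also have "\<dots> \<ge> (1 + h) * ((1 + t) * z - t)"
    using tz h by (intro mult_right_mono) auto
  finally have "0 \<le> z\<^sup>2 - atom_sum h (t * h) * z + atom_prod h (t * h)"
    using atom_sum_eq[of h "t * h"] atom_prod_eq[of h "t * h"] h t by (simp add: algebra_simps)
  then show ?thesis
    using z1 h t unfolding z_def[symmetric] by (subst le_lower_atom_iff) auto
qed

lemma quot_ray: "h \<noteq> 0 \<Longrightarrow> quot h (t * h) = (1 + t + t\<^sup>2) + h * (1 + t)\<^sup>2"
  unfolding quot_def by simp algebra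

lemma crit_strict_mono_ray:
  assumes h: "0 < h" "h < h'" and t: "0 < t"
  shows "crit h (t * h) < crit h' (t * h')"
proof -
  have h': "0 < h'" using h by simp
  define E E' where "E = quot h (t * h)" and "E' = quot h' (t * h')"
  have E: "1 < E" "E < E'"
    using quot_pos[of h "t * h"] h t unfolding E_def E'_def by (auto simp: quot_ray)
  have c0: "0 \<le> crit h (t * h)"
    using h t E unfolding crit_def E_def by simp
  have sq: "(crit a (t * a))\<^sup>2 = ((1 + a) * (a + t * a) / (1 + a + t * a)) * ((quot a (t * a))\<^sup>2 / (quot a (t * a) + 1))"
    if "0 < a" for a
    using that t quot_pos[of a "t * a"] by (simp add: crit_def power_mult_distrib)
  have m: "(1 + h) * (h + t * h) / (1 + h + t * h) < (1 + h') * (h' + t * h') / (1 + h' + t * h')"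
  proof -
    have *: "(1 + a) * (a + t * a) / (1 + a + t * a) = (1 + a) * (1 - 1 / (1 + a + t * a))" if "0 < a" for a
      using that t add_pos_pos[of "1 + a" "t * a"] by (simp add: field_simps)
    have "t * h < t * h'" using h t by simp
    then have "1 + h + t * h < 1 + h' + t * h'" using h by linarith
    then have "1 / (1 + h' + t * h') < 1 / (1 + h + t * h)"
      using h t h' by (intro divide_strict_left_mono mult_pos_pos add_pos_pos) auto
    moreover have "1 / (1 + h + t * h) < 1" using h t by (simp add: add_pos_pos divide_less_eq)
    ultimately show ?thesis
      unfolding *[OF h(1)] *[OF h'] using h h' by (intro mult_strict_mono') auto
  qed
  have e: "E\<^sup>2 / (E + 1) \<le> E'\<^sup>2 / (E' + 1)"
  proof -
    have *: "e\<^sup>2 / (e + 1) = e * (1 - 1 / (e + 1))" if "1 < e" for e :: real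
      using that by (simp add: field_simps power2_eq_square)
    have "1 / (E' + 1) \<le> 1 / (E + 1)" using E by (intro divide_left_mono) auto
    moreover have "1 / (E + 1) \<le> 1" using E by simp
    ultimately show ?thesis
      using E by (subst (1 2) *) (auto intro!: mult_mono)
  qed
  have "(crit h (t * h))\<^sup>2 < (crit h' (t * h'))\<^sup>2"
    unfolding sq[OF h(1)] sq[OF h'] E_def[symmetric] E'_def[symmetric]
    using m e h t E by (intro mult_less_le_imp_less) auto
  moreover have "0 \<le> crit h' (t * h')"
    using h' t E unfolding crit_def E'_def by simp
  ultimately show ?thesis
    using c0 by (simp add: power2_less_imp_less)
qed

lemma slack_antimono_ray:
  assumes "0 < h" "h < h'" "0 < t"
  shows "slack h' (t * h') < slack h (t * h)"
  using lower_atom_antimono_ray[OF assms] crit_strict_mono_ray[OF assms] by (simp add: slack_def)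

text \<open>
  The common source of the a priori bounds: it is the inequality of the region, weakened by
  \<open>1 + h + k \<le> (1 + h) (1 + k / h)\<close> and \<open>quot + 1 \<le> 2 quot\<close>.
\<close>

lemma slack_nonneg_imp:
  assumes h: "0 < h" and k: "0 < k" and s: "0 \<le> slack h k"
  shows "h * quot h k \<le> 2 * (lower_atom h k)\<^sup>2"
proof -
  define E p t where "E = quot h k" and "p = lower_atom h k" and "t = k / h"
  have t: "0 < t" "k = t * h" using h k by (auto simp: t_def)
  have E: "1 < E" unfolding E_def using h k by (rule quot_pos)
  have p: "0 < p" unfolding p_def using h k by (rule lower_atom_pos)
  have "(1 + h) * (h + k) * E\<^sup>2 \<le> p\<^sup>2 * ((1 + h + k) * (E + 1))"
    using s crit_le_iff[OF h k, of p] p by (simp add: slack_def p_def E_def)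
  also have "\<dots> \<le> p\<^sup>2 * (((1 + h) * (1 + t)) * (E + E))"
    using h k t E by (intro mult_left_mono mult_mono) (auto simp: algebra_simps)
  finally have "((1 + h) * (1 + t) * E) * (h * E) \<le> ((1 + h) * (1 + t) * E) * (2 * p\<^sup>2)"
    unfolding t(2) by (simp add: power2_eq_square algebra_simps)
  moreover have "0 < (1 + h) * (1 + t) * E" using h t E by simp
  ultimately show ?thesis
    unfolding E_def p_def by (simp add: mult_le_cancel_left_pos)
qed

text \<open>
  The atom is smaller than \<open>k / h\<close> and than 1; the first estimate is strong near the horizontal axis, the
  second one near the vertical axis.
\<close>

lemma slack_nonneg_bounds:
  assumes h: "0 < h" and k: "0 < k" and s: "0 \<le> slack h k"
  shows "h ^ 3 \<le> 2 * k\<^sup>2" and "h\<^sup>2 + h * k + k\<^sup>2 \<le> 2 * h"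
proof -
  define E p where "E = quot h k" and "p = lower_atom h k"
  have b: "h * E \<le> 2 * p\<^sup>2" unfolding E_def p_def by (rule slack_nonneg_imp[OF assms])
  have p: "0 < p" "p < 1" "p < k / h"
    unfolding p_def using h k lower_atom_pos lower_atom_less_1 lower_atom_less_slope by auto
  have "h * 1 \<le> h * E" using h quot_pos[OF h k] by (intro mult_left_mono) (auto simp: E_def)
  also have "\<dots> \<le> 2 * p\<^sup>2" by (rule b)
  also have "\<dots> \<le> 2 * (k / h)\<^sup>2" using p by (intro mult_left_mono power_mono) auto
  finally have "h * h\<^sup>2 \<le> 2 * (k / h)\<^sup>2 * h\<^sup>2" by (intro mult_right_mono) auto
  then show "h ^ 3 \<le> 2 * k\<^sup>2" using h by (simp add: power_divide power2_eq_square power3_eq_cube)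
  have "h * (1 + k / h + (k / h)\<^sup>2) \<le> h * E" using h quot_gt_1[OF h k] by (intro mult_left_mono) (auto simp: E_def)
  also have "\<dots> \<le> 2 * p\<^sup>2" by (rule b)
  also have "\<dots> \<le> 2 * 1\<^sup>2" using p by (intro mult_left_mono power_mono) auto
  finally have "h * (h * (1 + k / h + (k / h)\<^sup>2)) \<le> h * 2" using h by (intro mult_left_mono) auto
  moreover have "h * (h * (1 + k / h + (k / h)\<^sup>2)) = h\<^sup>2 + h * k + k\<^sup>2"
    using h by (simp add: power2_eq_square field_simps)
  ultimately show "h\<^sup>2 + h * k + k\<^sup>2 \<le> 2 * h" by simp
qed

lemma slack_nonneg_small:
  assumes t: "0 < t"
  shows "\<exists>h>0. 0 \<le> slack h (t * h)"
proof (intro exI conjI)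
  define s where "s = 1 + t"
  \<comment> \<open>small enough that already the lower bound \<open>t / (1 + t)\<close> of the atom is at least \<open>crit\<close>\<close>
  define h where "h = min 1 (t\<^sup>2 / (4 * s ^ 5))"
  have s: "1 < s" using t by (simp add: s_def)
  show h: "0 < h" using s t by (simp add: h_def)
  have h1: "h \<le> 1" "4 * s ^ 5 * h \<le> t\<^sup>2"
  proof -
    show "h \<le> 1" by (simp add: h_def)
    have "h \<le> t\<^sup>2 / (4 * s ^ 5)" by (simp add: h_def)
    then show "4 * s ^ 5 * h \<le> t\<^sup>2" using s by (simp add: field_simps)
  qed
  define E where "E = quot h (t * h)"
  have E: "1 < E" unfolding E_def using h t by (intro quot_pos) auto
  have "h * (1 + t)\<^sup>2 \<le> 1 * (1 + t)\<^sup>2" using h1 by (intro mult_right_mono) auto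
  moreover have "1 + t + t\<^sup>2 \<le> (1 + t)\<^sup>2" using t by (simp add: power2_sum)
  ultimately have "E \<le> (1 + t)\<^sup>2 + 1 * (1 + t)\<^sup>2"
    unfolding E_def using h by (subst quot_ray) auto
  then have E2: "E \<le> 2 * s\<^sup>2" by (simp add: s_def)
  have "(1 + h) * (h + t * h) * E \<le> 2 * (h * s) * (2 * s\<^sup>2)"
    using h h1 t E E2 s by (intro mult_mono) (auto simp: s_def algebra_simps)
  also have "\<dots> = 4 * s ^ 5 * h / s\<^sup>2"
    using s by (simp add: field_simps eval_nat_numeral)
  also have "\<dots> \<le> t\<^sup>2 / s\<^sup>2" using h1 by (intro divide_right_mono) auto
  finally have b: "(1 + h) * (h + t * h) * E \<le> (t / s)\<^sup>2" by (simp add: power_divide)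
  have "(1 + h) * (h + t * h) * E\<^sup>2 = ((1 + h) * (h + t * h) * E) * (1 * E)" by (simp add: power2_eq_square)
  also have "\<dots> \<le> (t / s)\<^sup>2 * ((1 + h + t * h) * (E + 1))"
    using b h t E by (intro mult_mono) (auto simp: add_nonneg_nonneg)
  finally have "crit h (t * h) \<le> t / s"
    using crit_le_iff[of h "t * h" "t / s"] h t s by (simp add: E_def)
  also have "\<dots> \<le> lower_atom h (t * h)" unfolding s_def using h t by (rule lower_atom_ge)
  finally show "0 \<le> slack h (t * h)" by (simp add: slack_def)
qed

lemma ex1_ray_zero:
  assumes t: "0 < t"
  shows "\<exists>!h. 0 < h \<and> slack h (t * h) = 0"
proof -
  obtain a where a: "0 < a" "0 \<le> slack a (t * a)" using slack_nonneg_small[OF t] by blast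
  define b where "b = max (a + 1) (2 * t\<^sup>2 + 1)"
  have b: "a < b" "2 * t\<^sup>2 < b" by (auto simp: b_def)
  have "slack b (t * b) < 0"
  proof (rule ccontr)
    assume "\<not> slack b (t * b) < 0"
    then have "b ^ 3 \<le> 2 * (t * b)\<^sup>2" using slack_nonneg_bounds(1)[of b "t * b"] a b t by simp
    then have "b * b\<^sup>2 \<le> (2 * t\<^sup>2) * b\<^sup>2" by (simp add: power_mult_distrib power2_eq_square power3_eq_cube mult_ac)
    then show False using b a by simp
  qed
  moreover have "continuous_on {a..b} (\<lambda>h. slack h (t * h))"
    using a t by (intro continuous_on_slack_compose continuous_intros) auto
  ultimately obtain h where "a \<le> h" "slack h (t * h) = 0"
    using IVT2'[of "\<lambda>h. slack h (t * h)" b 0 a] a b by auto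
  then show ?thesis
    using a slack_antimono_ray[OF _ _ t] by (metis less_irrefl less_le_trans linorder_neqE_linordered_idom)
qed

definition ray_end :: "real \<Rightarrow> real" where
  "ray_end t = (THE h. 0 < h \<and> slack h (t * h) = 0)"

lemma ray_end: "0 < t \<Longrightarrow> 0 < ray_end t" "0 < t \<Longrightarrow> slack (ray_end t) (t * ray_end t) = 0"
  using theI'[OF ex1_ray_zero, of t] by (auto simp: ray_end_def)

lemma slack_ray_sgn:
  assumes "0 < t" "0 < h"
  shows "0 < slack h (t * h) \<longleftrightarrow> h < ray_end t" and "slack h (t * h) < 0 \<longleftrightarrow> ray_end t < h"
    and "slack h (t * h) = 0 \<longleftrightarrow> h = ray_end t"
  using slack_antimono_ray[of h "ray_end t" t] slack_antimono_ray[of "ray_end t" h t] ray_end[OF assms(1)] assms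
  by (cases "h < ray_end t"; cases "ray_end t < h"; force)+

text \<open>
  Strict monotonicity in \<open>h\<close> with continuity in \<open>t\<close>: a strict sign of \<open>slack\<close> on either side of
  the zero persists for nearby slopes.
\<close>

lemma isCont_ray_end:
  assumes t: "0 < t"
  shows "isCont ray_end t"
proof -
  have cont: "((\<lambda>s. slack a (s * a)) \<longlongrightarrow> slack a (t * a)) (at t)" if "0 < a" for a
  proof -
    have "continuous_on {0<..} (\<lambda>s. slack a (s * a))"
      using that by (intro continuous_on_slack_compose continuous_intros) auto
    then have "isCont (\<lambda>s. slack a (s * a)) t"
      using t by (simp add: continuous_on_eq_continuous_at open_greaterThan)
    then show ?thesis by (simp add: isCont_def)
  qed
  have pos: "\<forall>\<^sub>F s in at t. 0 < s"
    using order_tendstoD(1)[OF tendsto_ident_at t] .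
  show ?thesis
    unfolding isCont_def
  proof (rule order_tendstoI)
    fix a assume a: "a < ray_end t"
    show "\<forall>\<^sub>F s in at t. a < ray_end s"
    proof (cases "0 < a")
      case True
      then have "0 < slack a (t * a)" using a t by (simp add: slack_ray_sgn)
      from order_tendstoD(1)[OF cont[OF True] this] pos show ?thesis
        by eventually_elim (use True in \<open>simp add: slack_ray_sgn\<close>)
    next
      case False
      from pos show ?thesis by eventually_elim (use False ray_end(1) in force)
    qed
  next
    fix a assume a: "ray_end t < a"
    then have a0: "0 < a" using ray_end(1)[OF t] by simp
    then have "slack a (t * a) < 0" using a t by (simp add: slack_ray_sgn)
    from order_tendstoD(2)[OF cont[OF a0] this] pos show "\<forall>\<^sub>F s in at t. ray_end s < a"
      by eventually_elim (use a0 in \<open>simp add: slack_ray_sgn\<close>)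
  qed
qed

lemma ray_end_le:
  assumes t: "0 < t"
  shows "ray_end t \<le> 2 * t\<^sup>2" and "ray_end t * t\<^sup>2 \<le> 2"
proof -
  define h where "h = ray_end t"
  have h: "0 < h" "0 < t * h" "0 \<le> slack h (t * h)" using ray_end[OF t] t by (auto simp: h_def)
  have "h ^ 3 \<le> 2 * (t * h)\<^sup>2" by (rule slack_nonneg_bounds[OF h])
  then have "h * h\<^sup>2 \<le> (2 * t\<^sup>2) * h\<^sup>2" by (simp add: power_mult_distrib power2_eq_square power3_eq_cube mult_ac)
  then show "ray_end t \<le> 2 * t\<^sup>2" using h by (simp add: h_def)
  have "h\<^sup>2 + h * (t * h) + (t * h)\<^sup>2 \<le> 2 * h" by (rule slack_nonneg_bounds[OF h])
  moreover have "0 \<le> h\<^sup>2" "0 \<le> h * (t * h)" using h by auto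
  ultimately have "(t * h)\<^sup>2 \<le> 2 * h" by linarith
  then have "h * (h * t\<^sup>2) \<le> h * 2" by (simp add: power2_eq_square mult_ac)
  then show "ray_end t * t\<^sup>2 \<le> 2" using h by (simp add: h_def)
qed

lemma region_R_ray: "0 < h \<Longrightarrow> (h, k) \<in> region_R \<longleftrightarrow> 0 < k \<and> h \<le> ray_end (k / h)"
  using slack_ray_sgn(2)[of "k / h" h] by (auto simp: region_R_iff_slack not_less[symmetric])

definition curve :: "(real \<times> real) set" where
  "curve = {(h, k). 0 < h \<and> 0 < k \<and> slack h k = 0}"

lemma curve_eq: "curve = (\<lambda>t. (ray_end t, t * ray_end t)) ` {0<..}"
proof -
  have "(h, k) \<in> (\<lambda>t. (ray_end t, t * ray_end t)) ` {0<..}" if "0 < h" "0 < k" "slack h k = 0" for h k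
    using that slack_ray_sgn(3)[of "k / h" h] by (intro image_eqI[of _ _ "k / h"]) auto
  then show ?thesis
    using ray_end by (auto simp: curve_def)
qed

section \<open>Topology of the region and of its boundary\<close>

lemma continuous_on_ray_end: "continuous_on {0<..} ray_end"
  by (simp add: continuous_at_imp_continuous_on isCont_ray_end)

lemma ray_end_tendsto_0: "(ray_end \<longlongrightarrow> 0) (at_right 0)"
proof (rule tendsto_sandwich)
  show "\<forall>\<^sub>F t in at_right 0. 0 \<le> ray_end t"
    using eventually_at_right_less[of 0] by eventually_elim (simp add: ray_end(1) less_imp_le)
  show "\<forall>\<^sub>F t in at_right 0. ray_end t \<le> 2 * t\<^sup>2"
    using eventually_at_right_less[of 0] by eventually_elim (rule ray_end_le)
  have "((\<lambda>t. 2 * t\<^sup>2) \<longlongrightarrow> 2 * 0\<^sup>2) (at_right (0::real))" by (intro tendsto_intros)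
  then show "((\<lambda>t. 2 * t\<^sup>2) \<longlongrightarrow> 0) (at_right (0::real))" by simp
qed simp

lemma curve_subset_region_R: "curve \<subseteq> region_R"
  by (auto simp: curve_def region_R_iff_slack)

lemma region_R_subset_quadrant: "region_R \<subseteq> quadrant"
  by (auto simp: region_R_iff_slack quadrant_def)

lemma zero_in_closure_region_R: "0 \<in> closure region_R"
proof (rule Lim_in_closed_set[where F = "at_right 0" and f = "\<lambda>t. (ray_end t, t * ray_end t)"])
  show "\<forall>\<^sub>F t in at_right 0. (ray_end t, t * ray_end t) \<in> closure region_R"
    using eventually_at_right_less[of 0]
    by eventually_elim (use curve_eq curve_subset_region_R closure_subset in blast)
  have "((\<lambda>t. (ray_end t, t * ray_end t)) \<longlongrightarrow> (0, 0 * 0)) (at_right 0)"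
    by (intro tendsto_intros ray_end_tendsto_0)
  then show "((\<lambda>t. (ray_end t, t * ray_end t)) \<longlongrightarrow> 0) (at_right 0)" by (simp add: zero_prod_def)
qed simp_all

lemma open_slack: "open S \<Longrightarrow> open {z \<in> quadrant. slack (fst z) (snd z) \<in> S}"
  using continuous_open_preimage[OF continuous_on_slack open_quadrant, of S]
  by (simp add: vimage_def Int_def)

text \<open>
  The polynomial bounds are closed conditions, and on the two axes they leave only the origin.
\<close>

lemma closure_region_R: "closure region_R = insert 0 region_R"
proof
  define Z :: "(real \<times> real) set" where
    "Z = {z. 0 \<le> fst z \<and> 0 \<le> snd z \<and> fst z ^ 3 \<le> 2 * (snd z)\<^sup>2 \<and> (fst z)\<^sup>2 + fst z * snd z + (snd z)\<^sup>2 \<le> 2 * fst z}"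
  have "closed Z"
    unfolding Z_def by (intro closed_Collect_conj closed_Collect_le continuous_intros)
  moreover have "region_R \<subseteq> Z"
    using slack_nonneg_bounds by (auto simp: Z_def region_R_iff_slack)
  ultimately have Z: "closure region_R \<subseteq> Z" by (rule closure_minimal[rotated])
  have neg: "closure region_R \<inter> {z \<in> quadrant. slack (fst z) (snd z) \<in> {..<0}} = {}"
    using open_Int_closure_eq_empty[OF open_slack[of "{..<0}"], of region_R]
    by (auto simp: region_R_iff_slack)
  show "closure region_R \<subseteq> insert 0 region_R"
  proof
    fix z assume z: "z \<in> closure region_R"
    obtain h k where hk: "z = (h, k)" by (cases z)
    show "z \<in> insert 0 region_R"
    proof (cases "0 < h \<and> 0 < k")
      case True
      then show ?thesis
        using neg z by (auto simp: hk quadrant_def region_R_iff_slack)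
    next
      case False
      have "0 \<le> h" "0 \<le> k" "h ^ 3 \<le> 2 * k\<^sup>2" "h\<^sup>2 + h * k + k\<^sup>2 \<le> 2 * h"
        using Z z by (auto simp: Z_def hk)
      then have "h = 0 \<and> k = 0" using False
        by (cases "h = 0") (auto simp: not_less power_le_zero_eq dest: antisym)
      then show ?thesis by (simp add: hk zero_prod_def)
    qed
  qed
qed (use zero_in_closure_region_R closure_subset in auto)

text \<open>
  A point of the region with vanishing slack leaves the region when moved outwards along its ray.
\<close>

lemma interior_region_R: "interior region_R = {z \<in> quadrant. slack (fst z) (snd z) \<in> {0<..}}"
proof
  show "{z \<in> quadrant. slack (fst z) (snd z) \<in> {0<..}} \<subseteq> interior region_R"
    by (rule interior_maximal[OF _ open_slack]) (auto simp: region_R_iff_slack quadrant_def)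
  show "interior region_R \<subseteq> {z \<in> quadrant. slack (fst z) (snd z) \<in> {0<..}}"
  proof
    fix z assume z: "z \<in> interior region_R"
    obtain h k where hk: "z = (h, k)" by (cases z)
    have pos: "0 < h" "0 < k"
      using subsetD[OF interior_subset z] by (auto simp: hk region_R_iff_slack)
    \<comment> \<open>the interior also contains the point \<open>c z\<close> for some \<open>c > 1\<close>\<close>
    have "((\<lambda>c. c *\<^sub>R z) \<longlongrightarrow> 1 *\<^sub>R z) (at_right 1)"
      by (intro tendsto_intros)
    from topological_tendstoD[OF this, of "interior region_R"]
    have "\<forall>\<^sub>F c in at_right 1. c *\<^sub>R z \<in> interior region_R"
      using z by simp
    then have "\<forall>\<^sub>F c in at_right 1. 1 < c \<and> c *\<^sub>R z \<in> region_R"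
      using eventually_at_right_less[of 1]
      by eventually_elim (use interior_subset in blast)
    then obtain c where c: "1 < c" "c *\<^sub>R z \<in> region_R"
      using eventually_happens'[of "at_right (1::real)"] by auto
    then have "0 \<le> slack (c * h) (c * k)" by (simp add: hk region_R_iff_slack)
    also have "c * k = k / h * (c * h)" using pos by simp
    also have "slack (c * h) (k / h * (c * h)) < slack h (k / h * h)"
      using c pos by (intro slack_antimono_ray) auto
    finally show "z \<in> {z \<in> quadrant. slack (fst z) (snd z) \<in> {0<..}}"
      using pos by (simp add: hk quadrant_def)
  qed
qed

lemma frontier_region_R: "frontier region_R = insert 0 curve"
  unfolding frontier_def closure_region_R interior_region_R
  by (auto simp: region_R_iff_slack curve_def quadrant_def zero_prod_def)

lemma bounded_region_R: "bounded region_R"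
proof (rule bounded_subset)
  show "region_R \<subseteq> cbox (0, 0) (2, 2)"
  proof
    fix z assume "z \<in> region_R"
    then obtain h k where hk: "z = (h, k)" "0 < h" "0 < k" "0 \<le> slack h k"
      by (cases z) (auto simp: region_R_iff_slack)
    then have b: "h\<^sup>2 + h * k + k\<^sup>2 \<le> 2 * h" by (intro slack_nonneg_bounds(2))
    have "0 < h * k" using hk by simp
    then have "h\<^sup>2 \<le> 2 * h" "k\<^sup>2 \<le> 2 * h"
      using b zero_le_power2[of h] zero_le_power2[of k] by linarith+
    then have "h \<le> 2" using hk by (simp add: power2_eq_square)
    then have "k\<^sup>2 \<le> 2\<^sup>2" using \<open>k\<^sup>2 \<le> 2 * h\<close> by simp
    then have "k \<le> 2" by (rule power2_le_imp_le) simp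
    then show "z \<in> cbox (0, 0) (2, 2)" using hk \<open>h \<le> 2\<close> by (simp add: cbox_Pair_eq)
  qed
qed (rule bounded_cbox)

text \<open>
  The slope and the fraction of the segment on the ray are global coordinates, with a convex range.
\<close>

lemma simply_connected_region_R: "simply_connected region_R"
proof -
  define S :: "(real \<times> real) set" where "S = {0<..} \<times> {0<..1}"
  define F where "F = (\<lambda>(t, r). (r * ray_end t, t * (r * ray_end t)))"
  define G where "G = (\<lambda>(h, k). (k / h, h / ray_end (k / h)))"
  have "homeomorphism S region_R F G"
  proof (rule homeomorphismI)
    show "continuous_on S F"
      unfolding F_def S_def case_prod_beta
      by (intro continuous_intros continuous_on_compose2[OF continuous_on_ray_end]) auto
    show "continuous_on region_R G"
      unfolding G_def case_prod_beta
      by (intro continuous_intros continuous_on_compose2[OF continuous_on_ray_end])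
         (auto simp: region_R_iff ray_end(1) less_imp_neq[THEN not_sym])
    show "F ` S \<subseteq> region_R"
    proof
      fix z assume "z \<in> F ` S"
      then obtain t r where z: "z = (r * ray_end t, t * (r * ray_end t))" "0 < t" "0 < r" "r \<le> 1"
        by (auto simp: F_def S_def)
      moreover have "0 < ray_end t" using z ray_end(1) by simp
      ultimately show "z \<in> region_R" by (simp add: region_R_ray mult_le_cancel_right1)
    qed
    show "G ` region_R \<subseteq> S"
    proof
      fix z assume "z \<in> G ` region_R"
      then obtain h k where "z = G (h, k)" "(h, k) \<in> region_R" by auto
      moreover from this have "0 < h" by (simp add: region_R_iff)
      ultimately show "z \<in> S" using ray_end(1)[of "k / h"]
        by (simp add: region_R_ray S_def G_def)
    qed
    show "G (F z) = z" if "z \<in> S" for z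
      using that ray_end(1)[of "fst z"] by (auto simp: F_def G_def S_def)
    show "F (G z) = z" if "z \<in> region_R" for z
      using that ray_end(1)[of "snd z / fst z"]
      by (cases z) (auto simp: F_def G_def region_R_iff less_imp_neq[THEN not_sym])
  qed
  then have "S homeomorphic region_R" by (auto simp: homeomorphic_def)
  moreover have "contractible S"
    unfolding S_def by (intro convex_imp_contractible convex_Times) (auto intro: is_interval_convex_1 simp: is_interval_convex_1[symmetric])
  ultimately show ?thesis
    using homeomorphic_contractible contractible_imp_simply_connected by blast
qed

definition polar_radius :: "real \<Rightarrow> real" where
  "polar_radius \<theta> = (if 0 < \<theta> \<and> \<theta> < pi / 2 then ray_end (tan \<theta>) / cos \<theta> else 0)"

text \<open>
  At the two ends the radius is squeezed by the bounds \<open>ray_end t \<le> 2 t\<^sup>2\<close> and \<open>ray_end t \<le> 2 / t\<^sup>2\<close>.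
\<close>

lemma continuous_on_polar_radius: "continuous_on {0..pi / 2} polar_radius"
  unfolding continuous_on_eq_continuous_within
proof
  fix a :: real assume a: "a \<in> {0..pi / 2}"
  have nonneg: "0 \<le> polar_radius \<theta>" for \<theta>
    using ray_end(1)[of "tan \<theta>"] tan_gt_zero[of \<theta>] cos_gt_zero[of \<theta>] by (auto simp: polar_radius_def)
  have le: "polar_radius \<theta> \<le> 2 * (sin \<theta>)\<^sup>2 / cos \<theta> ^ 3 \<and> polar_radius \<theta> \<le> 2 * cos \<theta> / (sin \<theta>)\<^sup>2"
    if "\<theta> \<in> {0..pi / 2}" for \<theta>
  proof (cases "0 < \<theta> \<and> \<theta> < pi / 2")
    case True
    then have p: "0 < tan \<theta>" "0 < cos \<theta>" "0 < sin \<theta>"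
      using tan_gt_zero[of \<theta>] cos_gt_zero[of \<theta>] sin_gt_zero[of \<theta>] by auto
    have "ray_end (tan \<theta>) / cos \<theta> \<le> (2 * (tan \<theta>)\<^sup>2) / cos \<theta>"
      using p by (intro divide_right_mono ray_end_le) auto
    moreover have "ray_end (tan \<theta>) / cos \<theta> \<le> (2 / (tan \<theta>)\<^sup>2) / cos \<theta>"
      using p ray_end_le(2)[of "tan \<theta>"] by (intro divide_right_mono) (auto simp: pos_le_divide_eq)
    ultimately show ?thesis
      using p True by (simp add: polar_radius_def tan_def power_divide power2_eq_square power3_eq_cube)
  next
    case False
    then show ?thesis using that sin_ge_zero[of \<theta>] cos_ge_zero[of \<theta>] by (auto simp: polar_radius_def)
  qed
  have end0: "(polar_radius \<longlongrightarrow> 0) (at a within {0..pi / 2})"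
    if g: "(g \<longlongrightarrow> 0) (at a within {0..pi / 2})" and "\<And>\<theta>. \<theta> \<in> {0..pi / 2} \<Longrightarrow> polar_radius \<theta> \<le> g \<theta>" for g
    by (rule tendsto_sandwich[OF _ _ tendsto_const g]) (auto simp: eventually_at_filter nonneg that)
  consider "a = 0" | "a = pi / 2" | "0 < a" "a < pi / 2" using a by fastforce
  then show "continuous (at a within {0..pi / 2}) polar_radius"
  proof cases
    case 1
    have "((\<lambda>\<theta>. 2 * (sin \<theta>)\<^sup>2 / cos \<theta> ^ 3) \<longlongrightarrow> 2 * (sin a)\<^sup>2 / cos a ^ 3) (at a within {0..pi / 2})"
      using 1 by (intro tendsto_intros) auto
    then have "(polar_radius \<longlongrightarrow> 0) (at a within {0..pi / 2})"
      using 1 le by (intro end0) auto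
    then show ?thesis using 1 by (simp add: continuous_within polar_radius_def)
  next
    case 2
    have sc: "sin a = 1" "cos a = 0" unfolding 2 by simp_all
    have "((\<lambda>\<theta>. 2 * cos \<theta> / (sin \<theta>)\<^sup>2) \<longlongrightarrow> 2 * cos a / (sin a)\<^sup>2) (at a within {0..pi / 2})"
      using sc by (intro tendsto_intros) auto
    then have "(polar_radius \<longlongrightarrow> 0) (at a within {0..pi / 2})"
      using sc le by (intro end0) auto
    then show ?thesis unfolding 2 continuous_within by (simp add: polar_radius_def)
  next
    case 3
    have "cos a \<noteq> 0" "0 < tan a" using 3 cos_gt_zero[of a] tan_gt_zero[of a] by auto
    then have "isCont (\<lambda>\<theta>. ray_end (tan \<theta>) / cos \<theta>) a"
      by (intro continuous_intros isCont_o2[OF _ isCont_ray_end]) auto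
    moreover have "\<forall>\<^sub>F \<theta> in nhds a. polar_radius \<theta> = ray_end (tan \<theta>) / cos \<theta>"
      using 3 eventually_nhds_in_open[of "{0<..<pi / 2}" a]
      by (auto elim!: eventually_mono simp: polar_radius_def)
    ultimately have "isCont polar_radius a"
      by (subst isCont_cong)
    then show ?thesis by (rule continuous_at_imp_continuous_at_within)
  qed
qed

lemma polar_loop_frontier: "polar_loop polar_radius (frontier region_R)"
  unfolding polar_loop_def
proof (intro conjI ballI)
  show "continuous_on {0..pi / 2} polar_radius" by (rule continuous_on_polar_radius)
  show "0 \<le> polar_radius \<theta>" for \<theta>
    using ray_end(1)[of "tan \<theta>"] tan_gt_zero[of \<theta>] cos_gt_zero[of \<theta>] by (auto simp: polar_radius_def)
  show "polar_radius 0 = 0" "polar_radius (pi / 2) = 0" by (simp_all add: polar_radius_def)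
  let ?c = "\<lambda>\<theta>. (polar_radius \<theta> * cos \<theta>, polar_radius \<theta> * sin \<theta>)"
  have c: "?c \<theta> = (ray_end (tan \<theta>), tan \<theta> * ray_end (tan \<theta>))" if "0 < \<theta>" "\<theta> < pi / 2" for \<theta>
    using that cos_gt_zero[of \<theta>] by (simp add: polar_radius_def tan_def)
  have "?c ` {0..pi / 2} = insert 0 (?c ` {0<..<pi / 2})"
  proof -
    have "{0..pi / 2} = insert 0 (insert (pi / 2) {0<..<pi / 2})" using pi_half_gt_zero by auto
    then show ?thesis by (simp add: polar_radius_def zero_prod_def)
  qed
  also have "?c ` {0<..<pi / 2} = (\<lambda>t. (ray_end t, t * ray_end t)) ` (tan ` {0<..<pi / 2})"
    unfolding image_image using c by (intro image_cong) auto
  also have "tan ` {0<..<pi / 2} = {0<..}"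
  proof (intro equalityI subsetI)
    fix t :: real assume "t \<in> {0<..}"
    then have "0 < arctan t" "arctan t < pi / 2" "tan (arctan t) = t"
      using arctan_ubound tan_arctan zero_less_arctan_iff by auto
    then show "t \<in> tan ` {0<..<pi / 2}" by (intro image_eqI[of _ _ "arctan t"]) auto
  qed (auto intro: tan_gt_zero)
  finally show "frontier region_R = ?c ` {0..pi / 2}"
    by (simp add: frontier_region_R curve_eq)
qed

section \<open>Strict convexity along lines\<close>

text \<open>
  The second derivative of \<open>exp L\<close> is \<open>exp L (L'\<^sup>2 + L'')\<close>. With \<open>L' = N / (2 M)\<close> its sign is that of a polynomial
  whenever \<open>N\<close> and \<open>M\<close> are polynomials.
\<close>

lemma strictly_convex_exp:
  fixes L N M N' M' :: "real \<Rightarrow> real"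
  assumes L: "\<And>t. 0 < t \<Longrightarrow> (L has_real_derivative N t / (2 * M t)) (at t)"
    and N: "\<And>t. 0 < t \<Longrightarrow> (N has_real_derivative N' t) (at t)"
    and M: "\<And>t. 0 < t \<Longrightarrow> (M has_real_derivative M' t) (at t)" "\<And>t. 0 < t \<Longrightarrow> 0 < M t"
    and pos: "\<And>t. 0 < t \<Longrightarrow> 0 < (N t)\<^sup>2 + 2 * (N' t * M t - N t * M' t)"
    and t: "0 < t1" "t1 < t2" "t2 < t3"
  shows "exp (L t2) * (t3 - t1) < exp (L t1) * (t3 - t2) + exp (L t3) * (t2 - t1)"
proof -
  define g where "g = (\<lambda>t. exp (L t) * (N t / (2 * M t)))"
  have d1: "((\<lambda>t. exp (L t)) has_real_derivative g t) (at t)" if "0 < t" for t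
    unfolding g_def using L[OF that] by (rule DERIV_fun_exp)
  have d2: "\<exists>y. (g has_real_derivative y) (at t) \<and> 0 < y" if "0 < t" for t
  proof (intro exI conjI)
    note m = M(2)[OF that]
    have "((\<lambda>t. N t / (2 * M t)) has_real_derivative
        (N' t * (2 * M t) - N t * (2 * M' t)) / ((2 * M t) * (2 * M t))) (at t)"
      using m by (intro DERIV_divide N DERIV_cmult M(1) that) auto
    from DERIV_mult[OF d1[OF that] this]
    have "(g has_real_derivative g t * (N t / (2 * M t))
        + (N' t * (2 * M t) - N t * (2 * M' t)) / ((2 * M t) * (2 * M t)) * exp (L t)) (at t)"
      by (simp add: g_def)
    also have "g t * (N t / (2 * M t))
        + (N' t * (2 * M t) - N t * (2 * M' t)) / ((2 * M t) * (2 * M t)) * exp (L t)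
        = exp (L t) * (((N t)\<^sup>2 + 2 * (N' t * M t - N t * M' t)) / (4 * (M t)\<^sup>2))"
      using m by (simp add: g_def field_simps power2_eq_square)
    finally show "(g has_real_derivative
        exp (L t) * (((N t)\<^sup>2 + 2 * (N' t * M t - N t * M' t)) / (4 * (M t)\<^sup>2))) (at t)" .
    show "0 < exp (L t) * (((N t)\<^sup>2 + 2 * (N' t * M t - N t * M' t)) / (4 * (M t)\<^sup>2))"
      using pos[OF that] m by simp
  qed
  obtain a where a: "t1 < a" "a < t2" "exp (L t2) - exp (L t1) = (t2 - t1) * g a"
    using MVT2[of t1 t2 "\<lambda>t. exp (L t)" g] d1 t by auto
  obtain b where b: "t2 < b" "b < t3" "exp (L t3) - exp (L t2) = (t3 - t2) * g b"
    using MVT2[of t2 t3 "\<lambda>t. exp (L t)" g] d1 t by auto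
  have "g a < g b"
    using a b t d2 by (intro DERIV_pos_imp_increasing[of a b g]) auto
  then have "0 < (t3 - t2) * (t2 - t1) * (g b - g a)" using t by simp
  also have "\<dots> = (t2 - t1) * (exp (L t3) - exp (L t2)) - (t3 - t2) * (exp (L t2) - exp (L t1))"
    unfolding a(3) b(3) by algebra
  finally show ?thesis by (simp add: algebra_simps)
qed

text \<open>
  A function is concave if its inverse is increasing and convex. The equivalence states that \<open>\<tau>\<close> is the
  inverse of \<open>P\<close>, in the form in which a comparison with the root of a quadratic equation provides it.
\<close>

lemma concave_inverse:
  fixes P \<tau> :: "real \<Rightarrow> real"
  assumes P: "\<And>t. 0 < t \<Longrightarrow> 0 < P t \<and> P t < 1"
    and iff: "\<And>t z. \<lbrakk>0 < t; 0 < z; z < 1\<rbrakk> \<Longrightarrow> z \<le> P t \<longleftrightarrow> \<tau> z \<le> t"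
    and conv: "convex_on {0<..<1} \<tau>"
    and t: "0 < t1" "t1 < t2" "t2 < t3"
  shows "P t1 * (t3 - t2) + P t3 * (t2 - t1) \<le> P t2 * (t3 - t1)"
proof -
  define u v where "u = (t3 - t2) / (t3 - t1)" and "v = (t2 - t1) / (t3 - t1)"
  have uv: "0 < u" "0 < v" "u + v = 1" using t by (auto simp: u_def v_def add_divide_distrib[symmetric])
  have t2: "t2 = u * t1 + v * t3"
  proof -
    have "u * t1 + v * t3 = ((t3 - t2) * t1 + (t2 - t1) * t3) / (t3 - t1)"
      by (simp add: u_def v_def add_divide_distrib)
    also have "(t3 - t2) * t1 + (t2 - t1) * t3 = t2 * (t3 - t1)" by algebra
    finally show ?thesis using t by simp
  qed
  have p: "0 < P t1" "P t1 < 1" "0 < P t3" "P t3 < 1" using P t by auto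
  define z where "z = u * P t1 + v * P t3"
  have "0 < z" unfolding z_def using uv p by (intro add_pos_pos mult_pos_pos) auto
  moreover have "z < 1"
    unfolding z_def using uv p by (intro convex_bound_lt) auto
  moreover have "\<tau> z \<le> t2"
  proof -
    have "\<tau> z \<le> u * \<tau> (P t1) + v * \<tau> (P t3)"
      using convex_onD[OF conv, of v "P t1" "P t3"] uv p by (simp add: z_def eq_diff_eq[symmetric])
    also have "\<dots> \<le> u * t1 + v * t3"
      using iff[of t1 "P t1"] iff[of t3 "P t3"] p t uv by (intro add_mono mult_left_mono) auto
    finally show ?thesis by (simp add: t2)
  qed
  ultimately have "z \<le> P t2" using iff[of t2 z] t by simp
  then have "z * (t3 - t1) \<le> P t2 * (t3 - t1)" using t by (intro mult_right_mono) auto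
  also have "z * (t3 - t1) = P t1 * (t3 - t2) + P t3 * (t2 - t1)"
  proof -
    have "z = ((t3 - t2) * P t1 + (t2 - t1) * P t3) / (t3 - t1)"
      by (simp add: z_def u_def v_def add_divide_distrib)
    then show ?thesis using t by (simp add: mult.commute)
  qed
  finally show ?thesis .
qed

text \<open>
  Common denominator of the logarithmic derivative of \<open>\<surd>(A B / (C D)) E / T\<close>.
\<close>

lemma log_derivative_sum:
  fixes A B C D E T :: real
  assumes "A \<noteq> 0" "B \<noteq> 0" "C \<noteq> 0" "D \<noteq> 0" "E \<noteq> 0" "T \<noteq> 0"
  shows "(a / A + b / B - c / C - d / D) / 2 + e / E - w / T
    = (a*B*C*D*E*T + b*A*C*D*E*T - c*A*B*D*E*T - d*A*B*C*E*T + 2*e*A*B*C*D*T - 2*w*A*B*C*D*E)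
      / (2 * (A*B*C*D*E*T))"
  using assms by (simp add: field_simps)

lemma crit_eq_exp:
  assumes "0 < h" "0 < k"
  shows "crit h k = exp ((ln (1 + h) + ln (h + k) - ln (1 + h + k) - ln (quot h k + 1)) / 2 + ln (quot h k))"
proof -
  have q: "1 < quot h k" using assms by (rule quot_pos)
  have pos: "0 < (1 + h) * (h + k) / ((1 + h + k) * (quot h k + 1))"
    using assms q by (intro divide_pos_pos mult_pos_pos) auto
  have "sqrt ((1 + h) * (h + k) / ((1 + h + k) * (quot h k + 1)))
      = exp (ln ((1 + h) * (h + k) / ((1 + h + k) * (quot h k + 1))) / 2)"
    using pos by (simp flip: ln_sqrt)
  also have "ln ((1 + h) * (h + k) / ((1 + h + k) * (quot h k + 1)))
      = ln (1 + h) + ln (h + k) - ln (1 + h + k) - ln (quot h k + 1)"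
    using assms q by (simp add: ln_div ln_mult)
  finally show ?thesis using q by (simp add: crit_def exp_add)
qed

text \<open>
  On a vertical line the points are \<open>(h, t h)\<close> with \<open>h\<close> fixed.
\<close>

lemma crit_strictly_convex_vertical:
  assumes h: "0 < h" and t: "0 < t1" "t1 < t2" "t2 < t3"
  shows "crit h (t2 * h) * (t3 - t1) < crit h (t1 * h) * (t3 - t2) + crit h (t3 * h) * (t2 - t1)"
proof -
  define Q where "Q = (\<lambda>t. (1 + t + t\<^sup>2) + h * (1 + t)\<^sup>2)"
  define L where "L = (\<lambda>t. (ln (1 + h) + ln (h * (1 + t)) - ln (1 + h * (1 + t)) - ln (Q t + 1)) / 2 + ln (Q t))"
  define M where "M = (\<lambda>t. (1 + t) * Q t * (1 + h * (1 + t)) * (Q t + 1))"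
  define N where "N = (\<lambda>t. 5 + 13*h + 10*h^2 + 2*h^3 + (13 + 40*h + 38*h^2 + 10*h^3)*t + (14 + 50*h + 58*h^2 + 20*h^3)*t^2
      + (7 + 34*h + 46*h^2 + 20*h^3)*t^3 + (3 + 13*h + 20*h^2 + 10*h^3)*t^4 + (2*h + 4*h^2 +
      2*h^3)*t^5)"
  define N' where "N' = (\<lambda>t. 13 + 40*h + 38*h^2 + 10*h^3 + (28 + 100*h + 116*h^2 + 40*h^3)*t + (21 + 102*h + 138*h^2 +
      60*h^3)*t^2 + (12 + 52*h + 80*h^2 + 40*h^3)*t^3 + (10*h + 20*h^2 + 10*h^3)*t^4)"
  define M' where "M' = (\<lambda>t. 5 + 18*h + 19*h^2 + 6*h^3 + (14 + 58*h + 76*h^2 + 30*h^3)*t + (18 + 84*h + 126*h^2 +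
      60*h^3)*t^2 + (12 + 68*h + 112*h^2 + 60*h^3)*t^3 + (5 + 30*h + 55*h^2 + 30*h^3)*t^4 + (6*h +
      12*h^2 + 6*h^3)*t^5)"
  have Q: "0 < Q t" if "0 < t" for t
    unfolding Q_def using that h by (intro add_pos_nonneg) auto
  have Q': "(Q has_real_derivative (1 + 2 * t) + 2 * h * (1 + t)) (at t)" for t
    unfolding Q_def by (auto intro!: derivative_eq_intros)
  have crit: "crit h (t * h) = exp (L t)" if "0 < t" for t
    using crit_eq_exp[of h "t * h"] quot_ray[of h t] that h by (simp add: L_def Q_def algebra_simps)
  have "exp (L t2) * (t3 - t1) < exp (L t1) * (t3 - t2) + exp (L t3) * (t2 - t1)"
  proof (rule strictly_convex_exp[OF _ _ _ _ _ t])
    fix t :: real assume t: "0 < t"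
    have ht: "0 < h * (1 + t)" using h t by simp
    have ht1: "0 < 1 + h * (1 + t)" "0 < 1 + t" "0 < Q t + 1" using ht t Q[OF t] by linarith+
    show "0 < M t" unfolding M_def by (intro mult_pos_pos ht1 Q t)
    have "(L has_real_derivative (h / (h * (1 + t)) + 0 / 1 - h / (1 + h * (1 + t)) - ((1 + 2 * t) + 2 * h * (1 + t)) / (Q t + 1)) / 2
        + ((1 + 2 * t) + 2 * h * (1 + t)) / Q t - 0 / 1) (at t)"
      unfolding L_def using t h ht Q[OF t] by (auto intro!: derivative_eq_intros Q' ht1)
    also have "h / (h * (1 + t)) = 1 / (1 + t)" using h by simp
    also have "(1 / (1 + t) + 0 / 1 - h / (1 + h * (1 + t)) - ((1 + 2 * t) + 2 * h * (1 + t)) / (Q t + 1)) / 2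
        + ((1 + 2 * t) + 2 * h * (1 + t)) / Q t - 0 / 1 = N t / (2 * M t)"
    proof (subst log_derivative_sum)
      show "1 + h * (1 + t) \<noteq> 0" "Q t + 1 \<noteq> 0" "Q t \<noteq> 0" "1 + t \<noteq> 0"
        using ht1 Q[OF t] by (metis less_irrefl)+
      show "(1*1*(1 + h * (1 + t))*(Q t + 1)*Q t*1 + 0*(1 + t)*(1 + h * (1 + t))*(Q t + 1)*Q t*1
          - h*(1 + t)*1*(Q t + 1)*Q t*1 - ((1 + 2 * t) + 2 * h * (1 + t))*(1 + t)*1*(1 + h * (1 + t))*Q t*1
          + 2*((1 + 2 * t) + 2 * h * (1 + t))*(1 + t)*1*(1 + h * (1 + t))*(Q t + 1)*1
          - 2*0*(1 + t)*1*(1 + h * (1 + t))*(Q t + 1)*Q t) / (2 * ((1 + t)*1*(1 + h * (1 + t))*(Q t + 1)*Q t*1))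
        = N t / (2 * M t)"
        unfolding N_def M_def Q_def by (rule arg_cong2[where f = "(/)"]) algebra+
    qed auto
    finally show "(L has_real_derivative N t / (2 * M t)) (at t)" .
    show "(N has_real_derivative N' t) (at t)"
      unfolding N_def N'_def by (auto intro!: derivative_eq_intros) algebra
    show "(M has_real_derivative M' t) (at t)"
      unfolding M_def M'_def Q_def by (auto intro!: derivative_eq_intros) algebra
    \<comment> \<open>the numerator of \<open>L'\<^sup>2 + L''\<close> over \<open>4 M\<^sup>2\<close>, expanded; every coefficient is positive\<close>
    have "0 < 27 + 110*h + 167*h^2 + 112*h^3 + 28*h^4 + (102 + 474*h + 820*h^2 + 624*h^3 + 176*h^4)*t + (171
      + 904*h + 1756*h^2 + 1496*h^3 + 472*h^4)*t^2 + (190 + 1046*h + 2188*h^2 + 2032*h^3 +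
      704*h^4)*t^3 + (144 + 828*h + 1794*h^2 + 1744*h^3 + 640*h^4)*t^4 + (86 + 486*h + 1044*h^2 +
      1008*h^3 + 368*h^4)*t^5 + (43 + 224*h + 452*h^2 + 408*h^3 + 136*h^4)*t^6 + (14 + 74*h + 140*h^2
      + 112*h^3 + 32*h^4)*t^7 + (3 + 14*h + 23*h^2 + 16*h^3 + 4*h^4)*t^8"
      using t h by (intro add_pos_pos mult_pos_pos zero_less_power) auto
    also have "\<dots> = (N t)\<^sup>2 + 2 * (N' t * M t - N t * M' t)"
      unfolding N_def N'_def M_def M'_def Q_def by algebra
    finally show "0 < (N t)\<^sup>2 + 2 * (N' t * M t - N t * M' t)" .
  qed
  then show ?thesis using t crit by simp
qed

text \<open>
  On a horizontal line the points are \<open>(k / t, k)\<close> with \<open>k\<close> fixed. Multiplying by powers of \<open>t\<close> turns all the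
  quantities in \<open>crit\<close> into polynomials in \<open>t\<close> and \<open>k\<close>; \<open>e\<close> is \<open>t quot\<close>.
\<close>

lemma crit_strictly_convex_horizontal:
  assumes k: "0 < k" and t: "0 < t1" "t1 < t2" "t2 < t3"
  shows "crit (k / t2) k * (t3 - t1) < crit (k / t1) k * (t3 - t2) + crit (k / t3) k * (t2 - t1)"
proof -
  define e where "e = (\<lambda>t. t^3 + t^2 + t + k * (1 + t)^2)"
  define e' where "e' = (\<lambda>t. 3 * t^2 + 2 * t + 1 + 2 * k * (1 + t))"
  define L where "L = (\<lambda>t. (ln k + ln (t + k) + ln (1 + t) - ln ((1 + k) * t + k) - ln (e t + t)) / 2 + ln (e t) - ln t)"
  define M where "M = (\<lambda>t. (1 + t) * (t + k) * e t * t * ((1 + k) * t + k) * (e t + t))"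
  define N where "N = (\<lambda>t. (-2*k^4) + (-10*k^3 - 10*k^4)*t + (-16*k^2 - 36*k^3 - 20*k^4)*t^2 + (-10*k - 39*k^2 - 48*k^3 -
      20*k^4)*t^3 + (-2 - 13*k - 24*k^2 - 26*k^3 - 10*k^4)*t^4 + (9*k + 14*k^2 - 2*k^4)*t^5 + (6 +
      28*k + 28*k^2 + 6*k^3)*t^6 + (8 + 23*k + 17*k^2 + 2*k^3)*t^7 + (4 + 11*k + 4*k^2)*t^8 + (2 +
      2*k)*t^9)"
  define N' where "N' = (\<lambda>t. (-10*k^3 - 10*k^4) + (-32*k^2 - 72*k^3 - 40*k^4)*t + (-30*k - 117*k^2 - 144*k^3 - 60*k^4)*t^2 +
      (-8 - 52*k - 96*k^2 - 104*k^3 - 40*k^4)*t^3 + (45*k + 70*k^2 - 10*k^4)*t^4 + (36 + 168*k +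
      168*k^2 + 36*k^3)*t^5 + (56 + 161*k + 119*k^2 + 14*k^3)*t^6 + (32 + 88*k + 32*k^2)*t^7 + (18 +
      18*k)*t^8)"
  define M' where "M' = (\<lambda>t. k^4 + (10*k^3 + 12*k^4)*t + (27*k^2 + 75*k^3 + 45*k^4)*t^2 + (28*k + 148*k^2 + 212*k^3 +
      80*k^4)*t^3 + (10 + 115*k + 335*k^2 + 310*k^3 + 75*k^4)*t^4 + (30 + 216*k + 420*k^2 + 258*k^3 +
      36*k^4)*t^5 + (49 + 238*k + 315*k^2 + 119*k^3 + 7*k^4)*t^6 + (48 + 160*k + 136*k^2 +
      24*k^3)*t^7 + (27 + 63*k + 27*k^2)*t^8 + (10 + 10*k)*t^9)"
  have e: "0 < e t" if "0 < t" for t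
    unfolding e_def using that k by (intro add_pos_pos) auto
  have e': "(e has_real_derivative e' t) (at t)" for t
    unfolding e_def e'_def by (auto intro!: derivative_eq_intros)
  have crit: "crit (k / t) k = exp (L t)" if t: "0 < t" for t
  proof -
    have h: "0 < k / t" using t k by simp
    have pos: "0 < t + k" "0 < (1 + k) * t + k" "0 < e t + t" "0 < k * (1 + t)" using t k e[OF t] by (auto intro: add_pos_pos)
    have q: "quot (k / t) k = e t / t"
      unfolding quot_def e_def using t k by (simp add: field_simps power2_eq_square power3_eq_cube)
    have eq: "1 + k / t = (t + k) / t" "k / t + k = k * (1 + t) / t" "(t + k) / t + k = ((1 + k) * t + k) / t"
      "e t / t + 1 = (e t + t) / t"
      using t by (simp_all add: field_simps)
    show ?thesis
      unfolding crit_eq_exp[OF h k] q L_def unfolding eq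
      using pos t k e[OF t] by (simp add: ln_div ln_mult)
  qed
  have "exp (L t2) * (t3 - t1) < exp (L t1) * (t3 - t2) + exp (L t3) * (t2 - t1)"
  proof (rule strictly_convex_exp[OF _ _ _ _ _ t])
    fix t :: real assume t: "0 < t"
    have pos: "0 < t + k" "0 < (1 + k) * t + k" "0 < e t + t" "0 < e t" "0 < 1 + t" using t k e[OF t] by (auto intro: add_pos_pos)
    show "0 < M t" unfolding M_def using t pos by (intro mult_pos_pos) auto
    have "(L has_real_derivative (1 / (1 + t) + 1 / (t + k) - (1 + k) / ((1 + k) * t + k) - (e' t + 1) / (e t + t)) / 2
        + e' t / e t - 1 / t) (at t)"
      unfolding L_def using t k pos by (auto intro!: derivative_eq_intros e' pos simp: mult.commute)
    also have "(1 / (1 + t) + 1 / (t + k) - (1 + k) / ((1 + k) * t + k) - (e' t + 1) / (e t + t)) / 2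
        + e' t / e t - 1 / t = N t / (2 * M t)"
    proof (subst log_derivative_sum)
      show "(1 + k) * t + k \<noteq> 0" "e t + t \<noteq> 0" "e t \<noteq> 0" "t \<noteq> 0" "1 + t \<noteq> 0" "t + k \<noteq> 0"
        using t pos by (metis less_irrefl)+
      show "(1*(t + k)*((1 + k) * t + k)*(e t + t)*e t*t + 1*(1 + t)*((1 + k) * t + k)*(e t + t)*e t*t
          - (1 + k)*(1 + t)*(t + k)*(e t + t)*e t*t - (e' t + 1)*(1 + t)*(t + k)*((1 + k) * t + k)*e t*t
          + 2*e' t*(1 + t)*(t + k)*((1 + k) * t + k)*(e t + t)*t
          - 2*1*(1 + t)*(t + k)*((1 + k) * t + k)*(e t + t)*e t) / (2 * ((1 + t)*(t + k)*((1 + k) * t + k)*(e t + t)*e t*t))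
        = N t / (2 * M t)"
        unfolding N_def M_def e_def e'_def by (rule arg_cong2[where f = "(/)"]) algebra+
    qed
    finally show "(L has_real_derivative N t / (2 * M t)) (at t)" .
    show "(N has_real_derivative N' t) (at t)"
      unfolding N_def N'_def by (auto intro!: derivative_eq_intros) algebra
    show "(M has_real_derivative M' t) (at t)"
      unfolding M_def M'_def e_def by (auto intro!: derivative_eq_intros) algebra
    \<comment> \<open>the numerator of \<open>L'\<^sup>2 + L''\<close> over \<open>4 M\<^sup>2\<close>, expanded; every coefficient is positive\<close>
    have "0 < 8*k^8 + (80*k^7 + 88*k^8)*t + (340*k^6 + 792*k^7 + 440*k^8)*t^2 + (792*k^5 + 2992*k^6 +
      3568*k^7 + 1320*k^8)*t^3 + (1100*k^4 + 6144*k^5 + 12060*k^6 + 9672*k^7 + 2640*k^8)*t^4 +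
      (928*k^3 + 7456*k^4 + 22072*k^5 + 29488*k^6 + 17568*k^7 + 3696*k^8)*t^5 + (460*k^2 + 5432*k^3 +
      23803*k^4 + 48720*k^5 + 48768*k^6 + 22512*k^7 + 3696*k^8)*t^6 + (120*k + 2288*k^2 + 15382*k^3 +
      47568*k^4 + 73672*k^5 + 57488*k^6 + 20832*k^7 + 2640*k^8)*t^7 + (12 + 496*k + 5755*k^2 +
      27994*k^3 + 66116*k^4 + 80280*k^5 + 49472*k^6 + 13968*k^7 + 1320*k^8)*t^8 + (40 + 1120*k +
      9642*k^2 + 35956*k^3 + 66808*k^4 + 64408*k^5 + 31200*k^6 + 6672*k^7 + 440*k^8)*t^9 + (84 +
      1760*k + 11471*k^2 + 33638*k^3 + 49854*k^4 + 38128*k^5 + 14188*k^6 + 2168*k^7 + 88*k^8)*t^10 +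
      (128 + 1924*k + 9826*k^2 + 23084*k^3 + 27456*k^4 + 16384*k^5 + 4448*k^6 + 432*k^7 + 8*k^8)*t^11
      + (124 + 1468*k + 6024*k^2 + 11574*k^3 + 10984*k^4 + 4888*k^5 + 868*k^6 + 40*k^7)*t^12 + (80 +
      744*k + 2610*k^2 + 4188*k^3 + 3056*k^4 + 912*k^5 + 80*k^6)*t^13 + (24 + 236*k + 803*k^2 +
      1050*k^3 + 527*k^4 + 80*k^5)*t^14 + (52*k + 170*k^2 + 158*k^3 + 40*k^4)*t^15 + (8*k + 19*k^2 +
      8*k^3)*t^16"
      using t k by (intro add_pos_pos mult_pos_pos zero_less_power) auto
    also have "\<dots> = (N t)\<^sup>2 + 2 * (N' t * M t - N t * M' t)"
      unfolding N_def N'_def M_def M'_def e_def by algebra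
    finally show "0 < (N t)\<^sup>2 + 2 * (N' t * M t - N t * M' t)" .
  qed
  then show ?thesis using t crit by simp
qed

section \<open>Sections by vertical and horizontal lines\<close>

lemma convex_on_identity: "convex S \<Longrightarrow> convex_on S (\<lambda>x. x :: real)"
  by (simp add: convex_on_def)

lemma convex_odds: "convex_on {0<..<1} (\<lambda>z. z / (1 - z :: real))"
proof (rule f''_ge0_imp_convex)
  fix z :: real assume z: "z \<in> {0<..<1}"
  show "((\<lambda>z. z / (1 - z)) has_real_derivative (1 - z) powr (- 2)) (at z)"
    using z by (auto intro!: derivative_eq_intros simp: powr_minus_divide power2_eq_square)
  show "((\<lambda>z. (1 - z) powr (- 2)) has_real_derivative 2 * (1 - z) powr (- 3)) (at z)"
    using z by (auto intro!: derivative_eq_intros)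
qed simp_all

lemma convex_odds_sqrt: "convex_on {0<..<1} (\<lambda>z. z * (1 - z) powr (- 1 / 2))"
proof (rule convex_on_mul)
  show "convex_on {0<..<1} (\<lambda>z. (1 - z) powr (- 1 / 2))"
  proof (rule f''_ge0_imp_convex)
    fix z :: real assume z: "z \<in> {0<..<1}"
    show "((\<lambda>z. (1 - z) powr (- 1 / 2)) has_real_derivative 1 / 2 * (1 - z) powr (- 3 / 2)) (at z)"
      using z by (auto intro!: derivative_eq_intros)
    show "((\<lambda>z. 1 / 2 * (1 - z) powr (- 3 / 2)) has_real_derivative 3 / 4 * (1 - z) powr (- 5 / 2)) (at z)"
      using z by (auto intro!: derivative_eq_intros)
  qed simp_all
  show "mono_on {0<..<1} (\<lambda>z. (1 - z) powr (- 1 / 2 :: real))"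
    by (intro mono_onI powr_mono2') auto
qed (auto intro!: mono_onI convex_on_identity)

text \<open>
  The Euclidean norm is convex and increasing in both nonnegative coordinates.
\<close>

lemma convex_norm_pair:
  fixes f g :: "real \<Rightarrow> real"
  assumes f: "convex_on S f" "\<And>z. z \<in> S \<Longrightarrow> 0 \<le> f z" and g: "convex_on S g" "\<And>z. z \<in> S \<Longrightarrow> 0 \<le> g z"
  shows "convex_on S (\<lambda>z. sqrt ((f z)\<^sup>2 + (g z)\<^sup>2))"
proof (rule convex_onI)
  show S: "convex S" using f(1) by (rule convex_on_imp_convex)
  fix t x y :: real assume t: "0 < t" "t < 1" and xy: "x \<in> S" "y \<in> S"
  let ?z = "(1 - t) *\<^sub>R x + t *\<^sub>R y"
  have z: "?z \<in> S" using S t xy by (intro convexD) auto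
  have "sqrt ((f ?z)\<^sup>2 + (g ?z)\<^sup>2) \<le> sqrt (((1 - t) * f x + t * f y)\<^sup>2 + ((1 - t) * g x + t * g y)\<^sup>2)"
    using convex_onD[OF f(1), of t x y] convex_onD[OF g(1), of t x y] t xy f(2)[OF z] g(2)[OF z]
    by (intro real_sqrt_le_mono add_mono power_mono) auto
  also have "\<dots> \<le> sqrt (((1 - t) * f x)\<^sup>2 + ((1 - t) * g x)\<^sup>2) + sqrt ((t * f y)\<^sup>2 + (t * g y)\<^sup>2)"
    by (rule real_sqrt_sum_squares_triangle_ineq)
  also have "\<dots> = (1 - t) * sqrt ((f x)\<^sup>2 + (g x)\<^sup>2) + t * sqrt ((f y)\<^sup>2 + (g y)\<^sup>2)"
    using t unfolding power_mult_distrib distrib_left[symmetric] real_sqrt_mult by simp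
  finally show "sqrt ((f ?z)\<^sup>2 + (g ?z)\<^sup>2) \<le> (1 - t) * sqrt ((f x)\<^sup>2 + (g x)\<^sup>2) + t * sqrt ((f y)\<^sup>2 + (g y)\<^sup>2)" .
qed

text \<open>
  For fixed \<open>h\<close> the equation of the atoms is affine in \<open>t\<close>, and solving it for \<open>t\<close> gives the inverse function.
\<close>

lemma lower_atom_concave_vertical:
  assumes h: "0 < h" and t: "0 < t1" "t1 < t2" "t2 < t3"
  shows "lower_atom h (t1 * h) * (t3 - t2) + lower_atom h (t3 * h) * (t2 - t1) \<le> lower_atom h (t2 * h) * (t3 - t1)"
proof (rule concave_inverse[where P = "\<lambda>t. lower_atom h (t * h)" and \<tau> = "\<lambda>z. (z + h * (z / (1 - z))) / (1 + h)", OF _ _ _ t])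
  show "0 < lower_atom h (t * h) \<and> lower_atom h (t * h) < 1" if "0 < t" for t
    using that h by (simp add: lower_atom_pos lower_atom_less_1)
  have "convex_on {0<..<1} (\<lambda>z. 1 / (1 + h) * (z + h * (z / (1 - z))))"
    using h by (intro convex_on_cmul convex_on_add convex_odds) (auto simp: convex_on_identity)
  then show "convex_on {0<..<1} (\<lambda>z. (z + h * (z / (1 - z))) / (1 + h))" by simp
  fix t z :: real assume t: "0 < t" and z: "0 < z" "z < 1"
  have k: "0 < t * h" using t h by simp
  have "z\<^sup>2 - atom_sum h (t * h) * z + atom_prod h (t * h) = (1 + h) * (1 - z) * (t - (z + h * (z / (1 - z))) / (1 + h))"
  proof -
    define w where "w = z / (1 - z)"
    define Y where "Y = (z + h * w) / (1 + h)"
    have w: "w * (1 - z) = z" using z by (simp add: w_def)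
    have Y: "(1 + h) * Y = z + h * w" using h by (simp add: Y_def)
    have "(1 + h) * (1 - z) * (t - Y) = (1 + h) * (1 - z) * t - (1 - z) * ((1 + h) * Y)"
      by algebra
    also have "(1 - z) * ((1 + h) * Y) = z * (1 - z) + h * (w * (1 - z))"
      unfolding Y by algebra
    finally have fin: "(1 + h) * (1 - z) * (t - (z + h * (z / (1 - z))) / (1 + h)) = (1 + h) * (1 - z) * t - (z * (1 - z) + h * z)"
      unfolding w by (simp only: Y_def w_def)
    have th: "t * h / h = t" using h by simp
    show ?thesis
      unfolding fin atom_sum_eq[OF h k] atom_prod_eq[OF h k] th by algebra
  qed
  moreover have pos: "0 < (1 + h) * (1 - z)" using h z by simp
  ultimately show "z \<le> lower_atom h (t * h) \<longleftrightarrow> (z + h * (z / (1 - z))) / (1 + h) \<le> t"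
    unfolding le_lower_atom_iff[OF h k z(2)]
    using mult_le_cancel_left_pos[OF pos, of 0 "t - (z + h * (z / (1 - z))) / (1 + h)"] by simp
qed

text \<open>
  For fixed \<open>k\<close> the equation of the atoms becomes \<open>t (t + k - z) = k z / (1 - z)\<close>, which is quadratic in \<open>t\<close>. The
  discriminant of its solution is \<open>(z + k)\<^sup>2 + 4 k z\<^sup>2 / (1 - z)\<close>, a sum of squares of convex functions, so the
  root of the discriminant is convex.
\<close>

lemma lower_atom_concave_horizontal:
  assumes k: "0 < k" and t: "0 < t1" "t1 < t2" "t2 < t3"
  shows "lower_atom (k / t1) k * (t3 - t2) + lower_atom (k / t3) k * (t2 - t1) \<le> lower_atom (k / t2) k * (t3 - t1)"
proof (rule concave_inverse[where P = "\<lambda>t. lower_atom (k / t) k"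
      and \<tau> = "\<lambda>z. (z - k + sqrt ((z + k)\<^sup>2 + (2 * sqrt k * (z * (1 - z) powr (- 1 / 2)))\<^sup>2)) / 2", OF _ _ _ t])
  show "0 < lower_atom (k / t) k \<and> lower_atom (k / t) k < 1" if "0 < t" for t
    using that k by (simp add: lower_atom_pos lower_atom_less_1)
  have "convex_on {0<..<1} (\<lambda>z. 1 / 2 * ((z + - k) + sqrt ((z + k)\<^sup>2 + (2 * sqrt k * (z * (1 - z) powr (- 1 / 2)))\<^sup>2)))"
    using k by (intro convex_on_cmul convex_on_add convex_norm_pair convex_odds_sqrt)
       (auto simp: convex_on_identity convex_on_const)
  then show "convex_on {0<..<1} (\<lambda>z. (z - k + sqrt ((z + k)\<^sup>2 + (2 * sqrt k * (z * (1 - z) powr (- 1 / 2)))\<^sup>2)) / 2)" by simp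
  fix t z :: real assume t: "0 < t" and z: "0 < z" "z < 1"
  have h: "0 < k / t" using t k by simp
  define w where "w = z / (1 - z)"
  have w: "0 < w" "w * (1 - z) = z" using z by (auto simp: w_def)
  define P where "P = (1 - z) powr (- 1 / 2)"
  have "P\<^sup>2 = 1 / (1 - z)"
    using z by (simp add: P_def powr_minus_divide powr_half_sqrt power_divide)
  then have P: "P\<^sup>2 * (1 - z) = 1" and wP: "w = z * P\<^sup>2" using z by (simp_all add: w_def)
  have sq: "(z + k)\<^sup>2 + (2 * sqrt k * (z * (1 - z) powr (- 1 / 2)))\<^sup>2 = (z - k)\<^sup>2 + 4 * k * w"
  proof -
    have "(2 * sqrt k * (z * P))\<^sup>2 = 4 * k * z\<^sup>2 * P\<^sup>2"
      using k by (simp add: power_mult_distrib)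
    then show ?thesis
      unfolding P_def[symmetric] wP using P by (simp only:) algebra
  qed
  have "z\<^sup>2 - atom_sum (k / t) k * z + atom_prod (k / t) k = (1 - z) / t * (t * (t + k - z) - k * w)"
  proof -
    have "(1 - z) / t * (t * (t + k - z) - k * w) = (1 - z) * (t + k - z) - k * (w * (1 - z)) / t"
      using t by (simp add: field_simps)
    then show ?thesis
      unfolding w(2) atom_sum_def atom_prod_def using t k by (simp add: power2_eq_square field_simps)
  qed
  then have "z \<le> lower_atom (k / t) k \<longleftrightarrow> 0 \<le> t * (t + k - z) - k * w"
    unfolding le_lower_atom_iff[OF h k z(2)] using t z by (simp add: zero_le_mult_iff zero_le_divide_iff)
  also have "\<dots> \<longleftrightarrow> sqrt ((z - k)\<^sup>2 + 4 * k * w) \<le> 2 * t + k - z"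
  proof
    assume a: "0 \<le> t * (t + k - z) - k * w"
    moreover have "0 < k * w" using k w by simp
    ultimately have "0 < t * (t + k - z)" by linarith
    then have "0 < t + k - z" using t by (simp add: zero_less_mult_iff)
    moreover have "(z - k)\<^sup>2 + 4 * k * w \<le> (2 * t + k - z)\<^sup>2"
      using a by (simp add: power2_eq_square algebra_simps)
    ultimately show "sqrt ((z - k)\<^sup>2 + 4 * k * w) \<le> 2 * t + k - z"
      using t by (intro real_le_lsqrt) auto
  next
    assume a: "sqrt ((z - k)\<^sup>2 + 4 * k * w) \<le> 2 * t + k - z"
    then have "(z - k)\<^sup>2 + 4 * k * w \<le> (2 * t + k - z)\<^sup>2"
      by (rule sqrt_le_D)
    then show "0 \<le> t * (t + k - z) - k * w" by (simp add: power2_eq_square algebra_simps)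
  qed
  finally show "z \<le> lower_atom (k / t) k \<longleftrightarrow> (z - k + sqrt ((z + k)\<^sup>2 + (2 * sqrt k * (z * (1 - z) powr (- 1 / 2)))\<^sup>2)) / 2 \<le> t"
    unfolding sq by auto
qed

lemma no_three_zeros_vertical:
  assumes h: "0 < h" and k: "0 < k1" "k1 < k2" "k2 < k3"
    and z: "slack h k1 = 0" "slack h k2 = 0" "slack h k3 = 0"
  shows False
proof -
  have t: "0 < k1 / h" "k1 / h < k2 / h" "k2 / h < k3 / h" using h k by (auto simp: divide_strict_right_mono)
  have "k1 / h * h = k1" "k2 / h * h = k2" "k3 / h * h = k3" using h by auto
  then show False
    using crit_strictly_convex_vertical[OF h t] lower_atom_concave_vertical[OF h t] z by (simp add: slack_def)
qed

text \<open>
  The slope decreases with \<open>h\<close> on a horizontal line, so the three points are taken in reverse order.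
\<close>

lemma no_three_zeros_horizontal:
  assumes k: "0 < k" and h: "0 < h1" "h1 < h2" "h2 < h3"
    and z: "slack h1 k = 0" "slack h2 k = 0" "slack h3 k = 0"
  shows False
proof -
  have t: "0 < k / h3" "k / h3 < k / h2" "k / h2 < k / h1" using h k by (auto simp: divide_strict_left_mono)
  have "k / (k / h1) = h1" "k / (k / h2) = h2" "k / (k / h3) = h3" using h k by auto
  then show False
    using crit_strictly_convex_horizontal[OF k t] lower_atom_concave_horizontal[OF k t] z by (simp add: slack_def)
qed

lemma card_two_zeros:
  fixes g :: "real \<Rightarrow> real"
  assumes cont: "continuous_on {0<..} g" and c: "0 < c" "0 < g c"
    and a: "0 < a" "\<And>x. 0 < x \<Longrightarrow> x \<le> a \<Longrightarrow> g x < 0" and b: "\<And>x. b \<le> x \<Longrightarrow> 0 < x \<Longrightarrow> g x < 0"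
    and three: "\<And>x y z. 0 < x \<Longrightarrow> x < y \<Longrightarrow> y < z \<Longrightarrow> g x = 0 \<Longrightarrow> g y = 0 \<Longrightarrow> g z = 0 \<Longrightarrow> False"
  shows "card {x. 0 < x \<and> g x = 0} = 2"
proof -
  have ac: "a < c" using a(2)[of c] c by force
  have bc: "c < max b (c + 1)" "0 < max b (c + 1)" using c by auto
  have cont': "continuous_on {a..c} g" "continuous_on {c..max b (c + 1)} g"
    using a(1) c by (auto intro!: continuous_on_subset[OF cont])
  obtain x where x: "a \<le> x" "x \<le> c" "g x = 0"
    using IVT'[of g a 0 c] a(1) a(2)[of a] c ac cont' by auto
  obtain y where y: "c \<le> y" "y \<le> max b (c + 1)" "g y = 0"
    using IVT2'[of g "max b (c + 1)" 0 c] b[of "max b (c + 1)"] c bc cont' by auto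
  have xy: "0 < x" "x < c" "c < y" using x y a c by (auto simp: less_le)
  have "{x. 0 < x \<and> g x = 0} = {x, y}"
  proof (intro equalityI subsetI)
    fix w assume w: "w \<in> {x. 0 < x \<and> g x = 0}"
    show "w \<in> {x, y}"
    proof (rule ccontr)
      assume "w \<notin> {x, y}"
      then consider "w < x" | "x < w" "w < y" | "y < w" by fastforce
      then show False
        using three[of w x y] three[of x w y] three[of x y w] w x y xy by cases auto
    qed
  qed (use x y xy c in auto)
  then show ?thesis using xy by simp
qed

lemma compact_insert_region_R: "compact (insert 0 region_R)"
  unfolding closure_region_R[symmetric] using bounded_region_R by (rule compact_closure[THEN iffD2])

lemma region_R_nonempty: "region_R \<noteq> {}"
  using curve_eq curve_subset_region_R by (metis empty_iff greaterThan_iff image_subset_iff zero_less_one)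

text \<open>
  The maximum over the compact closure is positive and so is not attained at the origin, the only point
  that the closure adds.
\<close>

lemma region_R_max:
  fixes \<phi> :: "real \<times> real \<Rightarrow> real"
  assumes "continuous_on UNIV \<phi>" "\<phi> 0 = 0" "\<And>z. z \<in> region_R \<Longrightarrow> 0 < \<phi> z"
  obtains z where "z \<in> region_R" "\<And>w. w \<in> region_R \<Longrightarrow> \<phi> w \<le> \<phi> z"
proof -
  have "continuous_on (insert 0 region_R) \<phi>"
    using assms(1) by (rule continuous_on_subset) simp
  then obtain z where z: "z \<in> insert 0 region_R" "\<And>w. w \<in> insert 0 region_R \<Longrightarrow> \<phi> w \<le> \<phi> z"
    using continuous_attains_sup[OF compact_insert_region_R, of \<phi>] by blast
  obtain w where w: "w \<in> region_R" using region_R_nonempty by blast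
  have "z \<noteq> 0" using z(2)[of w] assms(2) assms(3)[OF w] w by auto
  then show thesis using z that by auto
qed

lemma interior_of_ray:
  assumes "(h, k) \<in> region_R" "0 < c" "c < 1"
  shows "0 < slack (c * h) (c * k)"
proof -
  have hk: "0 < h" "0 < k" "0 \<le> slack h k" using assms by (auto simp: region_R_iff_slack)
  have "slack h (k / h * h) < slack (c * h) (k / h * (c * h))"
    using hk assms by (intro slack_antimono_ray) auto
  then show ?thesis using hk by (simp add: mult_ac)
qed

lemma h_M_attained: "\<exists>k. (h_M, k) \<in> region_R"
proof -
  obtain z where z: "z \<in> region_R" "\<And>w. w \<in> region_R \<Longrightarrow> fst w \<le> fst z"
  proof (rule region_R_max[of fst])
    show "0 < fst z" if "z \<in> region_R" for z
      using that region_R_subset_quadrant by (auto simp: quadrant_def)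
  qed (auto intro: continuous_on_fst continuous_on_id)
  have "h_M = fst z"
    unfolding h_M_def using z by (intro Greatest_equality) (auto intro: exI[of _ "snd z"])
  then show ?thesis using z(1) by (metis prod.collapse)
qed

lemma k_M_attained: "\<exists>h. (h, k_M) \<in> region_R"
proof -
  obtain z where z: "z \<in> region_R" "\<And>w. w \<in> region_R \<Longrightarrow> snd w \<le> snd z"
  proof (rule region_R_max[of snd])
    show "0 < snd z" if "z \<in> region_R" for z
      using that region_R_subset_quadrant by (auto simp: quadrant_def)
  qed (auto intro: continuous_on_snd continuous_on_id)
  have "k_M = snd z"
    unfolding k_M_def using z by (intro Greatest_equality) (auto intro: exI[of _ "fst z"])
  then show ?thesis using z(1) by (metis prod.collapse)
qed

lemma card_frontier_vertical:
  assumes a: "0 < a" "a < h_M"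
  shows "card (frontier region_R \<inter> {(a, k) | k. k \<in> UNIV}) = 2"
proof -
  obtain kM where "(h_M, kM) \<in> region_R" using h_M_attained by blast
  moreover from this have kM: "0 < kM" by (simp add: region_R_iff)
  ultimately have c: "0 < slack a (a / h_M * kM)"
    using interior_of_ray[of h_M kM "a / h_M"] a by simp
  have eq: "frontier region_R \<inter> {(a, k) | k. k \<in> UNIV} = Pair a ` {k. 0 < k \<and> slack a k = 0}"
    using a by (auto simp: frontier_region_R curve_def zero_prod_def)
  have "card {k. 0 < k \<and> slack a k = 0} = 2"
  \<comment> \<open>up to \<open>a\<close> and from \<open>b\<close> on one of the two polynomial bounds on the region is violated\<close>
  proof (rule card_two_zeros[where c = "a / h_M * kM" and a = "sqrt (a ^ 3) / 2" and b = "2 * a + 2"])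
    show "continuous_on {0<..} (slack a)"
      using a by (intro continuous_on_slack_compose continuous_intros) auto
    show "0 < a / h_M * kM" using a kM by simp
    show "0 < sqrt (a ^ 3) / 2" using a by simp
    show "slack a k < 0" if k: "0 < k" "k \<le> sqrt (a ^ 3) / 2" for k
    proof (rule ccontr)
      assume "\<not> slack a k < 0"
      then have "a ^ 3 \<le> 2 * k\<^sup>2" using slack_nonneg_bounds(1) a k by simp
      also have "\<dots> \<le> 2 * (sqrt (a ^ 3) / 2)\<^sup>2" using k by (intro mult_left_mono power_mono) auto
      also have "\<dots> = a ^ 3 / 2" using a by (simp add: power_divide)
      finally show False using zero_less_power[of a 3] a by simp
    qed
    show "slack a k < 0" if k: "2 * a + 2 \<le> k" "0 < k" for k
    proof (rule ccontr)
      assume "\<not> slack a k < 0"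
      then have "a\<^sup>2 + a * k + k\<^sup>2 \<le> 2 * a" using slack_nonneg_bounds(2) a k by simp
      moreover have "0 < a\<^sup>2 + a * k" using a k by (simp add: add_pos_pos)
      moreover have "(2 * a + 2) * 1 \<le> k * k" using a k by (intro mult_mono) auto
      ultimately show False by (simp add: power2_eq_square)
    qed
  qed (use c a no_three_zeros_vertical in auto)
  then show ?thesis unfolding eq by (subst card_image) (auto simp: inj_on_def)
qed

lemma card_frontier_horizontal:
  assumes b: "0 < b" "b < k_M"
  shows "card (frontier region_R \<inter> {(h, b) | h. h \<in> UNIV}) = 2"
proof -
  obtain hM where "(hM, k_M) \<in> region_R" using k_M_attained by blast
  moreover from this have hM: "0 < hM" by (simp add: region_R_iff)
  ultimately have c: "0 < slack (b / k_M * hM) b"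
    using interior_of_ray[of hM k_M "b / k_M"] b by simp
  have eq: "frontier region_R \<inter> {(h, b) | h. h \<in> UNIV} = (\<lambda>h. (h, b)) ` {h. 0 < h \<and> slack h b = 0}"
    using b by (auto simp: frontier_region_R curve_def zero_prod_def)
  have "card {h. 0 < h \<and> slack h b = 0} = 2"
  \<comment> \<open>up to \<open>a\<close> and from \<open>b\<close> on one of the two polynomial bounds on the region is violated\<close>
  proof (rule card_two_zeros[where c = "b / k_M * hM" and a = "b\<^sup>2 / 4" and b = "2 * b\<^sup>2 + 1"])
    show "continuous_on {0<..} (\<lambda>h. slack h b)"
      using b by (intro continuous_on_slack_compose continuous_intros) auto
    show "0 < b / k_M * hM" using b hM by simp
    show "0 < b\<^sup>2 / 4" using b by simp
    show "slack h b < 0" if h: "0 < h" "h \<le> b\<^sup>2 / 4" for h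
    proof (rule ccontr)
      assume "\<not> slack h b < 0"
      then have "h\<^sup>2 + h * b + b\<^sup>2 \<le> 2 * h" using slack_nonneg_bounds(2) b h by simp
      moreover have "0 < h\<^sup>2 + h * b" using b h by (simp add: add_pos_pos)
      ultimately show False using h b zero_less_power[of b 2] by linarith
    qed
    show "slack h b < 0" if h: "2 * b\<^sup>2 + 1 \<le> h" "0 < h" for h
    proof (rule ccontr)
      assume "\<not> slack h b < 0"
      then have "h ^ 3 \<le> 2 * b\<^sup>2" using slack_nonneg_bounds(1) b h by simp
      moreover have "1 \<le> h" using h zero_le_power2[of b] by linarith
      then have "h ^ 1 \<le> h ^ 3" by (intro power_increasing) auto
      ultimately show False using h by simp
    qed
  qed (use c b no_three_zeros_horizontal in auto)
  then show ?thesis unfolding eq by (subst card_image) (auto simp: inj_on_def)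
qed

section \<open>Tangent lines of the boundary\<close>

lemma affine_hull_2_scale:
  fixes p v :: "'a::real_vector"
  assumes "c \<noteq> 0"
  shows "affine hull {p, p + c *\<^sub>R v} = affine hull {p, p + v}"
proof -
  have "range (\<lambda>u. p + u *\<^sub>R (c *\<^sub>R v)) = range (\<lambda>u. p + u *\<^sub>R v)"
  proof (intro equalityI subsetI)
    fix y assume "y \<in> range (\<lambda>u. p + u *\<^sub>R v)"
    then obtain u where "y = p + u *\<^sub>R v" by auto
    then have "y = p + (u / c) *\<^sub>R (c *\<^sub>R v)" using assms by simp
    then show "y \<in> range (\<lambda>u. p + u *\<^sub>R (c *\<^sub>R v))" by blast
  qed auto
  then show ?thesis by (simp add: affine_hull_2_alt)
qed

text \<open>
  Near \<open>p\<close> the secant direction is asymptotically orthogonal to the gradient \<open>(A, B)\<close>, but it may approach the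
  tangent from both sides. Rescaling \<open>q - p\<close> by its component \<open>n q\<close> along \<open>(B, - A)\<close>, including the sign of
  that component, gives a spanning point that converges.
\<close>

lemma tangent_line_level_set:
  fixes \<Phi> :: "real \<times> real \<Rightarrow> real"
  assumes D: "(\<Phi> has_derivative (\<lambda>v. A * fst v + B * snd v)) (at p)"
    and p: "p \<in> C" "p islimpt C"
    and zero: "\<Phi> p = 0" "\<forall>\<^sub>F q in at p within C. \<Phi> q = 0"
    and AB: "A \<noteq> 0 \<or> B \<noteq> 0"
  shows "tangent_line_at C p (affine hull {p, p + (B, - A)})"
proof -
  define F where "F = at p within C"
  define N where "N = A\<^sup>2 + B\<^sup>2"
  have N: "0 < N" using AB by (auto simp: N_def sum_power2_gt_zero_iff)
  define g n where "g = (\<lambda>q. A * fst (q - p) + B * snd (q - p))" and "n = (\<lambda>q. B * fst (q - p) - A * snd (q - p))"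
  define r where "r = (\<lambda>q. g q / norm (q - p))"
  have pyth: "(g q)\<^sup>2 + (n q)\<^sup>2 = N * (norm (q - p))\<^sup>2" for q
    unfolding g_def n_def N_def norm_prod_def by simp algebra
  have ne: "\<forall>\<^sub>F q in F. q \<noteq> p"
    unfolding F_def by (simp add: eventually_at_filter)
  have "((\<lambda>q. (1 / norm (q - p)) *\<^sub>R (\<Phi> q - (\<Phi> p + g q))) \<longlongrightarrow> 0) F"
    using has_derivative_at_withinI[OF D, of C] unfolding has_derivative_within F_def g_def by blast
  then have "((\<lambda>q. - r q) \<longlongrightarrow> 0) F"
  proof (rule Lim_transform_eventually)
    show "\<forall>\<^sub>F q in F. (1 / norm (q - p)) *\<^sub>R (\<Phi> q - (\<Phi> p + g q)) = - r q"
      using zero(2) unfolding F_def by eventually_elim (simp add: zero(1) r_def)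
  qed
  then have r: "(r \<longlongrightarrow> 0) F" using tendsto_minus[of "\<lambda>q. - r q" 0 F] by simp
  have "((\<lambda>q. (r q)\<^sup>2) \<longlongrightarrow> 0\<^sup>2) F" by (intro tendsto_intros r)
  then have "\<forall>\<^sub>F q in F. (r q)\<^sup>2 < N" using order_tendstoD(2)[of _ "0\<^sup>2" F N] N by simp
  with ne have good: "\<forall>\<^sub>F q in F. n q \<noteq> 0 \<and> \<bar>g q / n q\<bar> = \<bar>r q\<bar> / sqrt (N - (r q)\<^sup>2)"
  proof eventually_elim
    case (elim q)
    then have w: "0 < norm (q - p)" by simp
    have "g q = r q * norm (q - p)" using w by (simp add: r_def)
    then have n2: "(n q)\<^sup>2 = (N - (r q)\<^sup>2) * (norm (q - p))\<^sup>2"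
      using pyth[of q] by (simp add: algebra_simps power_mult_distrib)
    then have "0 < (n q)\<^sup>2" using elim w by simp
    moreover have "\<bar>n q\<bar> = sqrt (N - (r q)\<^sup>2) * norm (q - p)"
      using w n2 by (metis real_sqrt_abs real_sqrt_mult abs_of_pos)
    ultimately show ?case
      using w by (simp add: r_def abs_mult)
  qed
  have "((\<lambda>q. \<bar>r q\<bar> / sqrt (N - (r q)\<^sup>2)) \<longlongrightarrow> \<bar>0\<bar> / sqrt (N - 0\<^sup>2)) F"
    using N by (intro tendsto_intros r) auto
  then have "((\<lambda>q. \<bar>r q\<bar> / sqrt (N - (r q)\<^sup>2)) \<longlongrightarrow> 0) F" by simp
  then have "((\<lambda>q. \<bar>g q / n q\<bar>) \<longlongrightarrow> 0) F"
    by (rule Lim_transform_eventually) (use good in \<open>auto elim: eventually_mono\<close>)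
  then have gn: "((\<lambda>q. g q / n q) \<longlongrightarrow> 0) F" by (simp only: tendsto_rabs_zero_iff)
  \<comment> \<open>the rescaled secant point; it equals \<open>p + (B, - A)\<close> up to the error \<open>(g q / n q) (A, B)\<close>\<close>
  define b where "b = (\<lambda>q. p + (N / n q) *\<^sub>R (q - p))"
  have bq: "b q = p + ((B, - A) + (g q / n q) *\<^sub>R (A, B))" if "n q \<noteq> 0" for q
  proof -
    have "N *\<^sub>R (q - p) = n q *\<^sub>R (B, - A) + g q *\<^sub>R (A, B)"
    proof (rule prod_eqI)
      show "fst (N *\<^sub>R (q - p)) = fst (n q *\<^sub>R (B, - A) + g q *\<^sub>R (A, B))"
        unfolding N_def n_def g_def by simp algebra
      show "snd (N *\<^sub>R (q - p)) = snd (n q *\<^sub>R (B, - A) + g q *\<^sub>R (A, B))"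
        unfolding N_def n_def g_def by simp algebra
    qed
    then have "(1 / n q) *\<^sub>R (N *\<^sub>R (q - p)) = (1 / n q) *\<^sub>R (n q *\<^sub>R (B, - A) + g q *\<^sub>R (A, B))"
      by simp
    then show ?thesis using that by (simp add: b_def scaleR_add_right add_divide_distrib diff_divide_distrib)
  qed
  have "((\<lambda>q. p + ((B, - A) + (g q / n q) *\<^sub>R (A, B))) \<longlongrightarrow> p + ((B, - A) + 0 *\<^sub>R (A, B))) F"
    by (intro tendsto_intros gn)
  then have "(b \<longlongrightarrow> p + (B, - A)) F"
    by (simp only: scaleR_zero_left add_0_right)
       (rule Lim_transform_eventually, use good in \<open>auto elim!: eventually_mono simp: bq\<close>)
  moreover have "\<forall>\<^sub>F q in F. p \<noteq> b q \<and> affine hull {p, q} = affine hull {p, b q}"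
    using good ne
  proof eventually_elim
    case (elim q)
    then have c: "N / n q \<noteq> 0" using N by simp
    then show ?case
      using affine_hull_2_scale[OF c, of p "q - p"] elim by (simp add: b_def)
  qed
  ultimately have "lines_converge (\<lambda>q. affine hull {p, q}) (affine hull {p, p + (B, - A)}) F"
    unfolding lines_converge_def using AB
    by (intro exI[of _ "\<lambda>_. p"] exI[of _ b] exI[of _ p] exI[of _ "p + (B, - A)"])
       (auto simp: zero_prod_def)
  then show ?thesis
    using p by (simp add: tangent_line_at_def F_def)
qed

text \<open>
  The logarithm of \<open>(lower_atom / crit)\<^sup>2\<close>. It has the same zero set as \<open>slack\<close> and a rational gradient in
  \<open>h\<close>, \<open>k\<close>, the atom and the distance of the atoms.
\<close>

definition level :: "real \<times> real \<Rightarrow> real" where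
  "level z = 2 * ln (lower_atom (fst z) (snd z)) - (ln (1 + fst z) + ln (fst z + snd z) - ln (1 + fst z + snd z)
     - ln (quot (fst z) (snd z) + 1)) - 2 * ln (quot (fst z) (snd z))"

lemma level_eq_0_iff:
  assumes "0 < h" "0 < k"
  shows "level (h, k) = 0 \<longleftrightarrow> slack h k = 0"
proof -
  have c: "0 < crit h k" using crit_eq_exp[OF assms] by simp
  have p: "0 < lower_atom h k" using assms by (rule lower_atom_pos)
  have "level (h, k) = 2 * (ln (lower_atom h k) - ln (crit h k))"
  proof -
    have "ln (crit h k) = (ln (1 + h) + ln (h + k) - ln (1 + h + k) - ln (quot h k + 1)) / 2 + ln (quot h k)"
      by (simp only: crit_eq_exp[OF assms] ln_exp)
    then show ?thesis unfolding level_def fst_conv snd_conv by (simp add: field_simps)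
  qed
  then show ?thesis using c p by (simp add: slack_def)
qed

text \<open>
  Logarithmic partial derivatives, that is \<open>h \<partial>\<^sub>h\<close> and \<open>k \<partial>\<^sub>k\<close>, have finite nonzero limits for \<open>level\<close> at the origin
  along both axes.
\<close>

definition quot_dlog_h :: "real \<Rightarrow> real \<Rightarrow> real" where
  "quot_dlog_h h k = h * (1 + k / h)\<^sup>2 - (2 * (1 + h) * (1 + k / h) * (k / h) - k / h)"

definition quot_dlog_k :: "real \<Rightarrow> real \<Rightarrow> real" where
  "quot_dlog_k h k = 2 * (1 + h) * (1 + k / h) * (k / h) - k / h"

definition level_dlog_h :: "real \<Rightarrow> real \<Rightarrow> real" where
  "level_dlog_h h k = - 2 * (k / h * (1 - lower_atom h k) + lower_atom h k * h) / (lower_atom h k * atom_gap h k)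
     + h / (1 + h + k) - h / (h + k) - h / (1 + h)
     + quot_dlog_h h k * (1 / (quot h k + 1) - 2 / quot h k)"

definition level_dlog_k :: "real \<Rightarrow> real \<Rightarrow> real" where
  "level_dlog_k h k = 2 * ((k + k / h) * (1 - lower_atom h k)) / (lower_atom h k * atom_gap h k)
     + k / (1 + h + k) - k / (h + k)
     + quot_dlog_k h k * (1 / (quot h k + 1) - 2 / quot h k)"

text \<open>
  Differentiating \<open>p\<^sup>2 - s p + r = 0\<close>, with \<open>s\<close> and \<open>r\<close> the sum and the product of the atoms, gives
  \<open>p' = (r' - p s') / D\<close>, where \<open>D\<close> is the distance of the atoms.
\<close>

lemma level_has_derivative:
  assumes h: "0 < h" and k: "0 < k"
  shows "(level has_derivative (\<lambda>v. level_dlog_h h k / h * fst v + level_dlog_k h k / k * snd v)) (at (h, k))"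
proof -
  define p D E where "p = lower_atom h k" and "D = atom_gap h k" and "E = quot h k"
  have p: "0 < p" unfolding p_def using h k by (rule lower_atom_pos)
  have D: "0 < D" unfolding D_def using h k by (rule atom_gap_pos)
  have E: "1 < E" unfolding E_def using h k by (rule quot_pos)
  define s' r' e' where "s' = (\<lambda>v::real\<times>real. (1 - k / h\<^sup>2) * fst v + (1 + 1 / h) * snd v)"
    and "r' = (\<lambda>v::real\<times>real. - (k / h\<^sup>2) * fst v + (1 + 1 / h) * snd v)"
    and "e' = (\<lambda>v::real\<times>real. quot_dlog_h h k / h * fst v + quot_dlog_k h k / k * snd v)"
  have s: "((\<lambda>z. atom_sum (fst z) (snd z)) has_derivative s') (at (h, k))"
    unfolding atom_sum_def s'_def using h
    by (auto intro!: derivative_eq_intros simp: fun_eq_iff field_simps power2_eq_square)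
  have r: "((\<lambda>z. atom_prod (fst z) (snd z)) has_derivative r') (at (h, k))"
    unfolding atom_prod_def r'_def using h
    by (auto intro!: derivative_eq_intros simp: fun_eq_iff field_simps power2_eq_square)
  have e: "((\<lambda>z. quot (fst z) (snd z)) has_derivative e') (at (h, k))"
    unfolding quot_def e'_def quot_dlog_h_def quot_dlog_k_def using h k
    by (auto intro!: derivative_eq_intros simp: fun_eq_iff field_simps power2_eq_square)
  have "((\<lambda>z. (atom_sum (fst z) (snd z))\<^sup>2 - 4 * atom_prod (fst z) (snd z)) has_derivative
      (\<lambda>v. 2 * atom_sum h k * s' v - 4 * r' v)) (at (h, k))"
    by (rule derivative_eq_intros s r refl | simp add: fun_eq_iff)+
  then have d: "((\<lambda>z. atom_gap (fst z) (snd z)) has_derivative (\<lambda>v. (atom_sum h k * s' v - 2 * r' v) / D)) (at (h, k))"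
    unfolding atom_gap_def using atom_disc_pos[OF h k]
    by (auto intro!: derivative_eq_intros s r simp: D_def atom_gap_def fun_eq_iff field_simps)
  have l: "((\<lambda>z. lower_atom (fst z) (snd z)) has_derivative (\<lambda>v. (r' v - p * s' v) / D)) (at (h, k))"
  proof -
    have "((\<lambda>z. lower_atom (fst z) (snd z)) has_derivative (\<lambda>v. (s' v - (atom_sum h k * s' v - 2 * r' v) / D) / 2)) (at (h, k))"
      unfolding lower_atom_def by (rule derivative_eq_intros s d refl | simp)+
    also have "(\<lambda>v. (s' v - (atom_sum h k * s' v - 2 * r' v) / D) / 2) = (\<lambda>v. (r' v - p * s' v) / D)"
      using D by (auto simp: fun_eq_iff p_def lower_atom_def D_def[symmetric] field_simps)
    finally show ?thesis .
  qed
  have "(level has_derivative (\<lambda>v. 2 * ((r' v - p * s' v) / D / p) - (fst v / (1 + h) + (fst v + snd v) / (h + k)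
      - (fst v + snd v) / (1 + h + k) - e' v / (E + 1)) - 2 * (e' v / E))) (at (h, k))"
    unfolding level_def[abs_def] using h k p E
    by (auto intro!: derivative_eq_intros l e simp: fun_eq_iff p_def E_def divide_inverse mult_ac)
  also have "(\<lambda>v. 2 * ((r' v - p * s' v) / D / p) - (fst v / (1 + h) + (fst v + snd v) / (h + k)
      - (fst v + snd v) / (1 + h + k) - e' v / (E + 1)) - 2 * (e' v / E))
    = (\<lambda>v. level_dlog_h h k / h * fst v + level_dlog_k h k / k * snd v)"
  proof
    fix v :: "real \<times> real"
    obtain a b where v: "v = (a, b)" by (cases v)
    define G where "G = 1 / (E + 1) - 2 / E"
    have 1: "r' v - p * s' v = - (k / h * (1 - p) + p * h) * (a / h) + (k + k / h) * (1 - p) * (b / k)"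
      using h k by (simp add: v r'_def s'_def field_simps power2_eq_square)
    have 2: "e' v * G = (quot_dlog_h h k * G) * (a / h) + (quot_dlog_k h k * G) * (b / k)"
      by (simp add: e'_def v algebra_simps)
    have "level_dlog_h h k * (a / h) + level_dlog_k h k * (b / k)
      = 2 * ((- (k / h * (1 - p) + p * h) * (a / h) + (k + k / h) * (1 - p) * (b / k)) / (p * D))
        + (h * (a / h) + k * (b / k)) / (1 + h + k) - (h * (a / h) + k * (b / k)) / (h + k) - h * (a / h) / (1 + h)
        + e' v * G"
      unfolding 2 level_dlog_h_def level_dlog_k_def p_def[symmetric] D_def[symmetric] E_def[symmetric] G_def[symmetric]
      by (simp add: diff_divide_distrib add_divide_distrib algebra_simps)
    also have "\<dots> = 2 * ((r' v - p * s' v) / D / p) + (a + b) / (1 + h + k) - (a + b) / (h + k) - a / (1 + h) + e' v * G"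
      unfolding 1[symmetric] using h k by (simp add: mult.commute)
    finally show "2 * ((r' v - p * s' v) / D / p) - (fst v / (1 + h) + (fst v + snd v) / (h + k)
      - (fst v + snd v) / (1 + h + k) - e' v / (E + 1)) - 2 * (e' v / E)
      = level_dlog_h h k / h * fst v + level_dlog_k h k / k * snd v"
      by (simp add: v G_def algebra_simps)
  qed
  finally show ?thesis .
qed

lemma curve_islimpt:
  assumes "z \<in> curve"
  shows "z islimpt frontier region_R"
proof (rule islimptI)
  fix T assume T: "z \<in> T" "open T"
  define c where "c = (\<lambda>t. (ray_end t, t * ray_end t))"
  obtain t where t: "0 < t" "z = c t" using assms by (auto simp: curve_eq c_def)
  have "(ray_end \<longlongrightarrow> ray_end t) (at t)" using isCont_ray_end[OF t(1)] by (simp add: isCont_def)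
  then have "(c \<longlongrightarrow> c t) (at t)" unfolding c_def by (intro tendsto_intros)
  then have "\<forall>\<^sub>F s in at t. c s \<in> T" using T t by (auto dest: topological_tendstoD)
  moreover have "\<forall>\<^sub>F s in at t. 0 < s" using order_tendstoD(1)[OF tendsto_ident_at t(1)] .
  moreover have "\<forall>\<^sub>F s in at t. s \<noteq> t" by (simp add: eventually_at_filter)
  ultimately have "\<forall>\<^sub>F s in at t. 0 < s \<and> s \<noteq> t \<and> c s \<in> T" by eventually_elim simp
  then obtain s where s: "0 < s" "s \<noteq> t" "c s \<in> T" using eventually_happens'[of "at t"] by auto
  have "c s \<noteq> z" using s t ray_end(1)[of s] by (auto simp: c_def)
  moreover have "c s \<in> frontier region_R" using s by (auto simp: frontier_region_R curve_eq c_def)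
  ultimately show "\<exists>y\<in>frontier region_R. y \<in> T \<and> y \<noteq> z" using s by blast
qed

lemma tangent_line_curve:
  assumes z: "(h, k) \<in> curve" and nz: "level_dlog_h h k \<noteq> 0 \<or> level_dlog_k h k \<noteq> 0"
  shows "tangent_line_at (frontier region_R) (h, k)
    (affine hull {(h, k), (h, k) + (level_dlog_k h k / k, - (level_dlog_h h k / h))})"
proof (rule tangent_line_level_set)
  have hk: "0 < h" "0 < k" "slack h k = 0" using z by (auto simp: curve_def)
  show "(level has_derivative (\<lambda>v. level_dlog_h h k / h * fst v + level_dlog_k h k / k * snd v)) (at (h, k))"
    using hk by (intro level_has_derivative)
  show "(h, k) \<in> frontier region_R" using z by (simp add: frontier_region_R)
  show "(h, k) islimpt frontier region_R" using z by (rule curve_islimpt)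
  show "level (h, k) = 0" using hk by (simp add: level_eq_0_iff)
  show "level_dlog_h h k / h \<noteq> 0 \<or> level_dlog_k h k / k \<noteq> 0" using hk nz by simp
  have "\<forall>\<^sub>F q in at (h, k) within frontier region_R. q \<in> quadrant"
    using topological_tendstoD[OF tendsto_ident_at open_quadrant] hk by (simp add: quadrant_def)
  moreover have "\<forall>\<^sub>F q in at (h, k) within frontier region_R. q \<in> frontier region_R"
    by (simp add: eventually_at_filter)
  ultimately show "\<forall>\<^sub>F q in at (h, k) within frontier region_R. level q = 0"
  proof eventually_elim
    case (elim q)
    then show ?case
      by (cases q) (auto simp: frontier_region_R curve_def quadrant_def zero_prod_def level_eq_0_iff)
  qed
qed

section \<open>Slopes of the boundary near the origin\<close>

lemma lower_atom_alt:
  assumes "0 < h" "0 < k"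
  shows "lower_atom h k = 2 * atom_prod h k / (atom_sum h k + atom_gap h k)"
proof -
  have "atom_sum h k + atom_gap h k = 2 * upper_atom h k" by (simp add: upper_atom_def)
  then show ?thesis
    using atoms_mult[OF assms] upper_atom_gt_1[OF assms] by (simp add: field_simps)
qed

text \<open>
  All quantities extend continuously to \<open>h = t = 0\<close>. Since the atom \<open>p\<close> vanishes there and stands in a
  denominator, it is written as \<open>t P\<close>, where \<open>P\<close> tends to 1.
\<close>

lemma level_dlog_limits_h_axis:
  fixes h k :: "'i \<Rightarrow> real"
  assumes h: "(h \<longlongrightarrow> 0) F" and t: "((\<lambda>i. k i / h i) \<longlongrightarrow> 0) F"
    and pos: "\<forall>\<^sub>F i in F. 0 < h i \<and> 0 < k i"
  shows "((\<lambda>i. level_dlog_h (h i) (k i)) \<longlongrightarrow> - 3) F"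
    and "((\<lambda>i. level_dlog_k (h i) (k i)) \<longlongrightarrow> 2) F"
proof -
  define S where "S = (\<lambda>i. atom_sum (h i) (k i))"
  define D where "D = (\<lambda>i. atom_gap (h i) (k i))"
  define p where "p = (\<lambda>i. lower_atom (h i) (k i))"
  define E where "E = (\<lambda>i. quot (h i) (k i))"
  have "((\<lambda>i. k i / h i * h i) \<longlongrightarrow> 0 * 0) F" by (intro tendsto_mult h t)
  then have "((\<lambda>i. k i / h i * h i) \<longlongrightarrow> 0) F" by simp
  then have k: "(k \<longlongrightarrow> 0) F"
    by (rule Lim_transform_eventually) (use pos in \<open>auto elim!: eventually_mono\<close>)
  have "(S \<longlongrightarrow> 1 + 0 + 0 + 0) F" unfolding S_def atom_sum_def by (intro tendsto_intros h k t)
  then have S: "(S \<longlongrightarrow> 1) F" by simp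
  have "(D \<longlongrightarrow> sqrt (1\<^sup>2 - 4 * (0 + 0))) F"
    unfolding D_def atom_gap_def atom_prod_def S_def[symmetric, THEN fun_cong] by (intro tendsto_intros S k t)
  then have D: "(D \<longlongrightarrow> 1) F" by simp
  have "(p \<longlongrightarrow> (1 - 1) / 2) F"
    unfolding p_def lower_atom_def S_def[symmetric, THEN fun_cong] D_def[symmetric, THEN fun_cong]
    by (intro tendsto_intros S D) simp
  then have p: "(p \<longlongrightarrow> 0) F" by simp
  have "(E \<longlongrightarrow> (1 + 0) * (1 + 0)\<^sup>2 - 0) F" unfolding E_def quot_def by (intro tendsto_intros h t)
  then have E: "(E \<longlongrightarrow> 1) F" by simp
  define P where "P = (\<lambda>i. 2 * (1 + h i) / (S i + D i))"
  have "(P \<longlongrightarrow> 2 * (1 + 0) / (1 + 1)) F" unfolding P_def by (intro tendsto_intros h S D) simp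
  then have P: "(P \<longlongrightarrow> 1) F" by simp
  have P_eq: "\<forall>\<^sub>F i in F. p i = k i / h i * P i"
    using pos by eventually_elim
      (simp add: p_def P_def lower_atom_alt atom_prod_eq S_def D_def)
  have qk: "((\<lambda>i. quot_dlog_k (h i) (k i)) \<longlongrightarrow> 2 * (1 + 0) * (1 + 0) * 0 - 0) F"
    unfolding quot_dlog_k_def by (intro tendsto_intros h t)
  have qh: "((\<lambda>i. quot_dlog_h (h i) (k i)) \<longlongrightarrow> 0 * (1 + 0)\<^sup>2 - (2 * (1 + 0) * (1 + 0) * 0 - 0)) F"
    unfolding quot_dlog_h_def by (intro tendsto_intros h t)
  have "((\<lambda>i. - 2 * ((1 - p i) / P i + h i) / D i + h i / (1 + h i + k i) - 1 / (1 + k i / h i) - h i / (1 + h i)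
      + quot_dlog_h (h i) (k i) * (1 / (E i + 1) - 2 / E i)) \<longlongrightarrow>
      - 2 * ((1 - 0) / 1 + 0) / 1 + 0 / (1 + 0 + 0) - 1 / (1 + 0) - 0 / (1 + 0)
      + (0 * (1 + 0)\<^sup>2 - (2 * (1 + 0) * (1 + 0) * 0 - 0)) * (1 / (1 + 1) - 2 / 1)) F"
    by (intro tendsto_intros h k t p P D E qh) auto
  then have "((\<lambda>i. - 2 * ((1 - p i) / P i + h i) / D i + h i / (1 + h i + k i) - 1 / (1 + k i / h i) - h i / (1 + h i)
      + quot_dlog_h (h i) (k i) * (1 / (E i + 1) - 2 / E i)) \<longlongrightarrow> - 3) F" by simp
  then show "((\<lambda>i. level_dlog_h (h i) (k i)) \<longlongrightarrow> - 3) F"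
  proof (rule Lim_transform_eventually)
    show "\<forall>\<^sub>F i in F. - 2 * ((1 - p i) / P i + h i) / D i + h i / (1 + h i + k i) - 1 / (1 + k i / h i) - h i / (1 + h i)
      + quot_dlog_h (h i) (k i) * (1 / (E i + 1) - 2 / E i) = level_dlog_h (h i) (k i)"
      using pos P_eq
    proof eventually_elim
      case (elim i)
      then have hk: "0 < h i" "0 < k i" by auto
      have D: "0 < D i" unfolding D_def using hk by (rule atom_gap_pos)
      have p: "0 < p i" unfolding p_def using hk by (rule lower_atom_pos)
      then have P: "0 < P i" using elim hk by (simp add: zero_less_mult_iff zero_less_divide_iff)
      have "((1 - p i) / P i + h i) / D i = (k i / h i * (1 - p i) + p i * h i) / (p i * D i)"
        using D p P elim hk by (simp add: field_simps)
      then have 1: "- 2 * ((1 - p i) / P i + h i) / D i = - 2 * (k i / h i * (1 - p i) + p i * h i) / (p i * D i)"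
        by (simp only: times_divide_eq_right[symmetric])
      have 2: "1 / (1 + k i / h i) = h i / (h i + k i)" using hk by (simp add: field_simps)
      show ?case
        unfolding level_dlog_h_def 2 p_def[symmetric, THEN fun_cong] D_def[symmetric, THEN fun_cong] E_def[symmetric, THEN fun_cong]
        by (simp only: 1)
    qed
  qed
  have "((\<lambda>i. 2 * ((1 + h i) * (1 - p i)) / (P i * D i) + k i / (1 + h i + k i) - (k i / h i) / (1 + k i / h i)
      + quot_dlog_k (h i) (k i) * (1 / (E i + 1) - 2 / E i)) \<longlongrightarrow>
      2 * ((1 + 0) * (1 - 0)) / (1 * 1) + 0 / (1 + 0 + 0) - 0 / (1 + 0)
      + (2 * (1 + 0) * (1 + 0) * 0 - 0) * (1 / (1 + 1) - 2 / 1)) F"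
    by (intro tendsto_intros h k t p P D E qk) auto
  then have "((\<lambda>i. 2 * ((1 + h i) * (1 - p i)) / (P i * D i) + k i / (1 + h i + k i) - (k i / h i) / (1 + k i / h i)
      + quot_dlog_k (h i) (k i) * (1 / (E i + 1) - 2 / E i)) \<longlongrightarrow> 2) F" by simp
  then show "((\<lambda>i. level_dlog_k (h i) (k i)) \<longlongrightarrow> 2) F"
  proof (rule Lim_transform_eventually)
    show "\<forall>\<^sub>F i in F. 2 * ((1 + h i) * (1 - p i)) / (P i * D i) + k i / (1 + h i + k i) - (k i / h i) / (1 + k i / h i)
      + quot_dlog_k (h i) (k i) * (1 / (E i + 1) - 2 / E i) = level_dlog_k (h i) (k i)"
      using pos P_eq
    proof eventually_elim
      case (elim i)
      then have hk: "0 < h i" "0 < k i" by auto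
      have D: "0 < D i" unfolding D_def using hk by (rule atom_gap_pos)
      have p: "0 < p i" unfolding p_def using hk by (rule lower_atom_pos)
      then have P: "0 < P i" using elim hk by (simp add: zero_less_mult_iff zero_less_divide_iff)
      have 0: "k i + k i / h i = (1 + h i) * (k i / h i)" using hk by (simp add: field_simps)
      have 1: "2 * ((1 + h i) * (1 - p i)) / (P i * D i) = 2 * ((k i + k i / h i) * (1 - p i)) / (p i * D i)"
        unfolding 0 elim(2) using D P hk by simp
      have 2: "(k i / h i) / (1 + k i / h i) = k i / (h i + k i)" using hk by (simp add: field_simps)
      show ?case
        unfolding level_dlog_k_def 2 p_def[symmetric, THEN fun_cong] D_def[symmetric, THEN fun_cong] E_def[symmetric, THEN fun_cong]
        by (simp only: 1)
    qed
  qed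
qed

text \<open>
  In the variables \<open>k\<close> and \<open>v = h / k\<close> all quantities extend continuously to \<open>k = v = 0\<close> after multiplication
  by the right power of \<open>v\<close>: \<open>S\<close> and \<open>D\<close> are \<open>v\<close> times the sum and the distance of the atoms, \<open>E\<close> and \<open>K\<close> are
  \<open>v\<^sup>2\<close> times \<open>quot\<close> and \<open>quot_dlog_k\<close>.
\<close>

lemma level_dlog_limits_k_axis:
  fixes h k :: "'i \<Rightarrow> real"
  assumes k: "(k \<longlongrightarrow> 0) F" and u: "((\<lambda>i. h i / k i) \<longlongrightarrow> 0) F"
    and pos: "\<forall>\<^sub>F i in F. 0 < h i \<and> 0 < k i"
  shows "((\<lambda>i. level_dlog_h (h i) (k i)) \<longlongrightarrow> 2) F"
    and "((\<lambda>i. level_dlog_k (h i) (k i)) \<longlongrightarrow> - 3) F"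
proof -
  define v where "v = (\<lambda>i. h i / k i)"
  have v: "(v \<longlongrightarrow> 0) F" using u by (simp add: v_def)
  define p where "p = (\<lambda>i. lower_atom (h i) (k i))"
  have "((\<lambda>i. v i * k i) \<longlongrightarrow> 0 * 0) F" by (intro tendsto_mult v k)
  then have "((\<lambda>i. v i * k i) \<longlongrightarrow> 0) F" by simp
  then have h: "(h \<longlongrightarrow> 0) F"
    by (rule Lim_transform_eventually) (use pos in \<open>auto elim!: eventually_mono simp: v_def\<close>)
  define S where "S = (\<lambda>i. (1 + h i) * (1 + v i))"
  define D where "D = (\<lambda>i. sqrt ((S i)\<^sup>2 - 4 * ((1 + h i) * v i)))"
  define P where "P = (\<lambda>i. 2 * (1 + h i) / (S i + D i))"
  define E where "E = (\<lambda>i. (1 + h i) * (1 + v i)\<^sup>2 - v i)"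
  define K where "K = (\<lambda>i. 2 * (1 + h i) * (1 + v i) - v i)"
  define G where "G = (\<lambda>i. 1 / (E i + (v i)\<^sup>2) - 2 / E i)"
  have "(S \<longlongrightarrow> (1 + 0) * (1 + 0)) F" unfolding S_def by (intro tendsto_intros h v)
  then have S: "(S \<longlongrightarrow> 1) F" by simp
  have "(D \<longlongrightarrow> sqrt (1\<^sup>2 - 4 * ((1 + 0) * 0))) F" unfolding D_def by (intro tendsto_intros h v S)
  then have D: "(D \<longlongrightarrow> 1) F" by simp
  have "(P \<longlongrightarrow> 2 * (1 + 0) / (1 + 1)) F" unfolding P_def by (intro tendsto_intros h S D) simp
  then have P: "(P \<longlongrightarrow> 1) F" by simp
  have "(E \<longlongrightarrow> (1 + 0) * (1 + 0)\<^sup>2 - 0) F" unfolding E_def by (intro tendsto_intros h v)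
  then have E: "(E \<longlongrightarrow> 1) F" by simp
  have "(K \<longlongrightarrow> 2 * (1 + 0) * (1 + 0) - 0) F" unfolding K_def by (intro tendsto_intros h v)
  then have K: "(K \<longlongrightarrow> 2) F" by simp
  have "(G \<longlongrightarrow> 1 / (1 + 0\<^sup>2) - 2 / 1) F" unfolding G_def by (intro tendsto_intros E v) auto
  then have G: "(G \<longlongrightarrow> - 1) F" by simp
  have rew: "\<forall>\<^sub>F i in F. level_dlog_h (h i) (k i) = - 2 * ((1 - P i) + P i * h i * v i) / (P i * D i)
        + h i / (1 + h i + k i) - v i / (1 + v i) - h i / (1 + h i) + (h i * (1 + v i)\<^sup>2 - K i) * G i \<and>
      level_dlog_k (h i) (k i) = 2 * ((1 + h i) * (1 - P i)) / (P i * D i)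
        + k i / (1 + h i + k i) - 1 / (1 + v i) + K i * G i"
    using pos
  proof eventually_elim
    case (elim i)
    define x y w where "x = h i" and "y = k i" and "w = v i"
    have hk: "0 < x" "0 < y" using elim by (auto simp: x_def y_def)
    have w: "0 < w" "y / x = 1 / w" "x = w * y" using hk elim by (auto simp: w_def v_def x_def y_def)
    have Sw: "S i = atom_sum x y * w" unfolding S_def atom_sum_eq[OF hk] w(2)
      using w by (simp add: x_def[symmetric] w_def[symmetric] field_simps)
    have Dw: "D i = atom_gap x y * w"
    proof -
      have "(S i)\<^sup>2 - 4 * ((1 + x) * w) = ((atom_sum x y)\<^sup>2 - 4 * atom_prod x y) * w\<^sup>2"
        unfolding Sw atom_prod_eq[OF hk] w(2) using w by (simp add: field_simps power2_eq_square)
      then show ?thesis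
        using w unfolding D_def atom_gap_def by (simp add: x_def[symmetric] w_def[symmetric] real_sqrt_mult)
    qed
    have Pp: "P i = lower_atom x y"
    proof -
      have "P i = 2 * ((1 + x) / w) * w / ((atom_sum x y + atom_gap x y) * w)"
      proof -
        have "2 * ((1 + x) / w) * w = 2 * (1 + x)" using w by simp
        then show ?thesis unfolding P_def Sw Dw by (simp only: x_def distrib_right)
      qed
      also have "\<dots> = lower_atom x y"
        unfolding lower_atom_alt[OF hk] atom_prod_eq[OF hk] w(2) using w by simp
      finally show ?thesis .
    qed
    have Ew: "E i = quot x y * w\<^sup>2" unfolding E_def quot_def w(2)
      using w by (simp add: x_def[symmetric] w_def[symmetric] field_simps power2_eq_square)
    have Kw: "K i = quot_dlog_k x y * w\<^sup>2" unfolding K_def quot_dlog_k_def w(2)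
      using w by (simp add: x_def[symmetric] w_def[symmetric] field_simps power2_eq_square)
    have Hw: "x * (1 + w)\<^sup>2 - K i = quot_dlog_h x y * w\<^sup>2" unfolding Kw quot_dlog_h_def quot_dlog_k_def w(2)
      using w by (simp add: field_simps power2_eq_square)
    have q: "1 < quot x y" using hk by (rule quot_pos)
    have Gw: "G i * w\<^sup>2 = 1 / (quot x y + 1) - 2 / quot x y"
    proof -
      have "E i + (v i)\<^sup>2 = (quot x y + 1) * w\<^sup>2" unfolding Ew by (simp add: w_def algebra_simps)
      then show ?thesis unfolding G_def Ew using w q by (simp add: left_diff_distrib)
    qed
    have p: "0 < lower_atom x y" using hk by (rule lower_atom_pos)
    have d: "0 < atom_gap x y" using hk by (rule atom_gap_pos)
    have 1: "((1 - P i) + P i * x * w) / (P i * D i) = (y / x * (1 - lower_atom x y) + lower_atom x y * x) / (lower_atom x y * atom_gap x y)"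
      unfolding Pp Dw w(2) using w p d by (simp add: field_simps)
    have 2: "((1 + x) * (1 - P i)) / (P i * D i) = ((y + y / x) * (1 - lower_atom x y)) / (lower_atom x y * atom_gap x y)"
    proof -
      have "y + y / x = (1 + x) * (1 / w)" using hk w by (simp add: field_simps)
      then show ?thesis unfolding Pp Dw using w p d by simp
    qed
    have 3: "w / (1 + w) = x / (x + y)" "1 / (1 + w) = y / (x + y)"
    proof -
      have "x + y = (1 + w) * y" unfolding w(3) by algebra
      then show "w / (1 + w) = x / (x + y)" "1 / (1 + w) = y / (x + y)" using w hk by simp_all
    qed
    have 4: "(x * (1 + w)\<^sup>2 - K i) * G i = quot_dlog_h x y * (1 / (quot x y + 1) - 2 / quot x y)"
      unfolding Hw Gw[symmetric] by simp
    have 5: "K i * G i = quot_dlog_k x y * (1 / (quot x y + 1) - 2 / quot x y)"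
      unfolding Kw Gw[symmetric] by simp
    have "level_dlog_h x y = - 2 * (((1 - P i) + P i * x * w) / (P i * D i))
        + x / (1 + x + y) - w / (1 + w) - x / (1 + x) + (x * (1 + w)\<^sup>2 - K i) * G i"
      unfolding 1 3 4 level_dlog_h_def by simp
    moreover have "level_dlog_k x y = 2 * (((1 + x) * (1 - P i)) / (P i * D i))
        + y / (1 + x + y) - 1 / (1 + w) + K i * G i"
      unfolding 2 3 5 level_dlog_k_def by simp
    ultimately show ?case unfolding x_def y_def w_def by simp
  qed
  have "((\<lambda>i. - 2 * ((1 - P i) + P i * h i * v i) / (P i * D i)
        + h i / (1 + h i + k i) - v i / (1 + v i) - h i / (1 + h i) + (h i * (1 + v i)\<^sup>2 - K i) * G i) \<longlongrightarrow>
      - 2 * ((1 - 1) + 1 * 0 * 0) / (1 * 1) + 0 / (1 + 0 + 0) - 0 / (1 + 0) - 0 / (1 + 0) + (0 * (1 + 0)\<^sup>2 - 2) * - 1) F"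
    by (intro tendsto_intros h k v P D K G) auto
  then have "((\<lambda>i. - 2 * ((1 - P i) + P i * h i * v i) / (P i * D i)
        + h i / (1 + h i + k i) - v i / (1 + v i) - h i / (1 + h i) + (h i * (1 + v i)\<^sup>2 - K i) * G i) \<longlongrightarrow> 2) F"
    by simp
  then show "((\<lambda>i. level_dlog_h (h i) (k i)) \<longlongrightarrow> 2) F"
    by (rule Lim_transform_eventually) (rule eventually_mono[OF rew], simp)
  have "((\<lambda>i. 2 * ((1 + h i) * (1 - P i)) / (P i * D i) + k i / (1 + h i + k i) - 1 / (1 + v i) + K i * G i) \<longlongrightarrow>
      2 * ((1 + 0) * (1 - 1)) / (1 * 1) + 0 / (1 + 0 + 0) - 1 / (1 + 0) + 2 * - 1) F"
    by (intro tendsto_intros h k v P D K G) auto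
  then have "((\<lambda>i. 2 * ((1 + h i) * (1 - P i)) / (P i * D i)
        + k i / (1 + h i + k i) - 1 / (1 + v i) + K i * G i) \<longlongrightarrow> - 3) F"
    by simp
  then show "((\<lambda>i. level_dlog_k (h i) (k i)) \<longlongrightarrow> - 3) F"
    by (rule Lim_transform_eventually) (rule eventually_mono[OF rew], simp)
qed

lemma ray_end_tendsto_at_right: "filterlim ray_end (at_right 0) (at_right 0)"
  unfolding filterlim_at
  using ray_end_tendsto_0 eventually_at_right_less[of 0]
  by (auto elim!: eventually_mono simp: ray_end(1) less_imp_neq[THEN not_sym])

lemma ray_end_snd_tendsto_at_right: "filterlim (\<lambda>t. t * ray_end t) (at_right 0) at_top"
proof -
  have "((\<lambda>t. t * ray_end t) \<longlongrightarrow> 0) at_top"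
  proof (rule tendsto_sandwich)
    show "\<forall>\<^sub>F t in at_top. 0 \<le> t * ray_end t"
      using eventually_gt_at_top[of 0] by eventually_elim (simp add: ray_end(1) less_imp_le)
    show "\<forall>\<^sub>F t in at_top. t * ray_end t \<le> 2 * inverse t"
      using eventually_gt_at_top[of 0]
    proof eventually_elim
      case (elim t)
      then show ?case using ray_end_le(2)[of t] by (simp add: field_simps power2_eq_square)
    qed
    have "((\<lambda>t. 2 * inverse t) \<longlongrightarrow> 2 * 0) (at_top :: real filter)"
      by (intro tendsto_mult tendsto_const tendsto_inverse_0_at_top filterlim_ident)
    then show "((\<lambda>t. 2 * inverse t) \<longlongrightarrow> 0) (at_top :: real filter)" by simp
  qed simp
  moreover have "\<forall>\<^sub>F t in at_top. 0 < t * ray_end t"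
    using eventually_gt_at_top[of 0] by eventually_elim (simp add: ray_end(1))
  ultimately show ?thesis
    unfolding filterlim_at by (auto elim!: eventually_mono)
qed

lemma to_origin_along_h_axis_not_bot: "to_origin_along_h_axis (frontier region_R) \<noteq> bot"
proof
  assume bot: "to_origin_along_h_axis (frontier region_R) = bot"
  have "filterlim (\<lambda>t. (ray_end t, t * ray_end t)) (to_origin_along_h_axis (frontier region_R)) (at_right 0)"
    unfolding to_origin_along_h_axis_def filterlim_inf filterlim_filtercomap_iff filterlim_principal
  proof
    have "filterlim (\<lambda>t. (ray_end t, t)) (at_right 0 \<times>\<^sub>F at_right 0) (at_right 0)"
      by (intro filterlim_Pair ray_end_tendsto_at_right filterlim_ident)
    moreover have "\<forall>\<^sub>F t in at_right 0. (ray_end t, t) = ((\<lambda>(h, k). (h, k / h)) \<circ> (\<lambda>t. (ray_end t, t * ray_end t))) t"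
      using eventually_at_right_less[of 0]
      by eventually_elim (simp add: ray_end(1) less_imp_neq[THEN not_sym])
    ultimately show "filterlim ((\<lambda>(h, k). (h, k / h)) \<circ> (\<lambda>t. (ray_end t, t * ray_end t))) (at_right 0 \<times>\<^sub>F at_right 0) (at_right 0)"
      by (subst filterlim_cong[OF refl refl, symmetric])
    show "\<forall>\<^sub>F t in at_right 0. (ray_end t, t * ray_end t) \<in> frontier region_R"
      using eventually_at_right_less[of 0]
      by eventually_elim (auto simp: frontier_region_R curve_eq)
  qed
  then show False
    unfolding bot by (simp add: filterlim_def bot.extremum_unique filtermap_bot_iff)
qed

lemma to_origin_along_k_axis_not_bot: "to_origin_along_k_axis (frontier region_R) \<noteq> bot"
proof
  assume bot: "to_origin_along_k_axis (frontier region_R) = bot"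
  have "filterlim (\<lambda>t. (ray_end t, t * ray_end t)) (to_origin_along_k_axis (frontier region_R)) at_top"
    unfolding to_origin_along_k_axis_def filterlim_inf filterlim_filtercomap_iff filterlim_principal
  proof
    have "filterlim (\<lambda>t. (t * ray_end t, t)) (at_right 0 \<times>\<^sub>F at_top) at_top"
      by (intro filterlim_Pair ray_end_snd_tendsto_at_right filterlim_ident)
    moreover have "\<forall>\<^sub>F t in at_top. (t * ray_end t, t) = ((\<lambda>(h, k). (k, k / h)) \<circ> (\<lambda>t. (ray_end t, t * ray_end t))) t"
      using eventually_gt_at_top[of 0]
      by eventually_elim (simp add: ray_end(1) less_imp_neq[THEN not_sym])
    ultimately show "filterlim ((\<lambda>(h, k). (k, k / h)) \<circ> (\<lambda>t. (ray_end t, t * ray_end t))) (at_right 0 \<times>\<^sub>F at_top) at_top"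
      by (subst filterlim_cong[OF refl refl, symmetric])
    show "\<forall>\<^sub>F t in at_top. (ray_end t, t * ray_end t) \<in> frontier region_R"
      using eventually_gt_at_top[of 0]
      by eventually_elim (auto simp: frontier_region_R curve_eq)
  qed
  then show False
    unfolding bot by (simp add: filterlim_def bot.extremum_unique filtermap_bot_iff)
qed

definition tangent :: "real \<times> real \<Rightarrow> (real \<times> real) set" where
  "tangent z = affine hull {z, z + (level_dlog_k (fst z) (snd z) / snd z, - (level_dlog_h (fst z) (snd z) / fst z))}"

text \<open>
  With \<open>A\<close> and \<open>B\<close> the two logarithmic derivatives and \<open>t\<close> the slope, the tangent direction is
  \<open>(1, - (A / B) t)\<close>, where \<open>A / B\<close> tends to \<open>- 3 / 2\<close> and \<open>t\<close> to 0.
\<close>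

lemma tangents_along_h_axis:
  "tangent_lines_converge (frontier region_R) (to_origin_along_h_axis (frontier region_R)) {(h, k). k = 0}"
proof -
  define F where "F = to_origin_along_h_axis (frontier region_R)"
  have lim: "filterlim (\<lambda>z. (fst z, snd z / fst z)) (at_right 0 \<times>\<^sub>F at_right 0) F"
    unfolding F_def to_origin_along_h_axis_def case_prod_beta
    by (rule filterlim_mono[OF filterlim_filtercomap order_refl inf_le1])
  have mem: "\<forall>\<^sub>F z in F. z \<in> frontier region_R"
    unfolding F_def to_origin_along_h_axis_def by (simp add: eventually_inf_principal)
  have h: "filterlim fst (at_right 0) F" and t: "filterlim (\<lambda>z. snd z / fst z) (at_right 0) F"
    using filterlim_compose[OF filterlim_fst lim] filterlim_compose[OF filterlim_snd lim] by simp_all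
  have h0: "(fst \<longlongrightarrow> 0) F" and t0: "((\<lambda>z. snd z / fst z) \<longlongrightarrow> 0) F"
    and hp: "\<forall>\<^sub>F z in F. 0 < fst z"
    using h t by (auto simp: filterlim_at elim: eventually_mono)
  have crv: "\<forall>\<^sub>F z in F. z \<in> curve"
    using mem hp by eventually_elim (auto simp: frontier_region_R)
  then have pos: "\<forall>\<^sub>F z in F. 0 < fst z \<and> 0 < snd z"
    by eventually_elim (auto simp: curve_def)
  note lims = level_dlog_limits_h_axis[OF h0 t0 pos]
  have nz: "\<forall>\<^sub>F z in F. 0 < level_dlog_k (fst z) (snd z)"
    using order_tendstoD(1)[OF lims(2), of 0] by simp
  define b where "b = (\<lambda>z. z + (1, - (level_dlog_h (fst z) (snd z) / level_dlog_k (fst z) (snd z) * (snd z / fst z))))"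
  have "((\<lambda>z. fst z * (snd z / fst z)) \<longlongrightarrow> 0 * 0) F" by (intro tendsto_mult h0 t0)
  then have "((\<lambda>z. fst z * (snd z / fst z)) \<longlongrightarrow> 0) F" by simp
  then have k0: "(snd \<longlongrightarrow> 0) F"
    by (rule Lim_transform_eventually) (use pos in \<open>auto elim!: eventually_mono\<close>)
  have id0: "((\<lambda>z. z) \<longlongrightarrow> 0) F"
    using tendsto_Pair[OF h0 k0] by (simp add: zero_prod_def)
  have "(b \<longlongrightarrow> 0 + (1, - (- 3 / 2 * 0))) F"
    unfolding b_def by (intro tendsto_intros id0 t0 lims) simp
  then have b: "(b \<longlongrightarrow> (1, 0)) F" by (simp add: zero_prod_def)
  have hull: "\<forall>\<^sub>F z in F. z \<noteq> b z \<and> tangent z = affine hull {z, b z}"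
    using nz pos
  proof eventually_elim
    case (elim z)
    define A B where "A = level_dlog_h (fst z) (snd z)" and "B = level_dlog_k (fst z) (snd z)"
    have c: "B / snd z \<noteq> 0" using elim by (simp add: B_def)
    have "(B / snd z) *\<^sub>R (1, - (A / B * (snd z / fst z))) = (B / snd z, - (A / fst z))"
      using elim by (simp add: B_def)
    then show ?case
      using affine_hull_2_scale[OF c, of z "(1, - (A / B * (snd z / fst z)))"]
      by (simp add: tangent_def b_def A_def B_def zero_prod_def)
  qed
  have "affine hull {0, (1, 0)} = {(h::real, k::real). k = 0}"
    by (auto simp: affine_hull_2_alt zero_prod_def image_iff)
  then have "lines_converge tangent {(h, k). k = 0} F"
    unfolding lines_converge_def using hull b id0
    by (intro exI[of _ "\<lambda>z. z"] exI[of _ b] exI[of _ 0] exI[of _ "(1, 0)"]) (auto simp: zero_prod_def)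
  moreover have "\<forall>\<^sub>F z in F. tangent_line_at (frontier region_R) z (tangent z)"
    using crv nz
  proof eventually_elim
    case (elim z)
    then show ?case using tangent_line_curve[of "fst z" "snd z"] by (simp add: tangent_def)
  qed
  ultimately show ?thesis
    unfolding tangent_lines_converge_def using to_origin_along_h_axis_not_bot by (auto simp: F_def)
qed

text \<open>
  With \<open>A\<close> and \<open>B\<close> the two logarithmic derivatives and \<open>t\<close> the slope, the tangent direction is
  \<open>(- (B / A) / t, 1)\<close>, where \<open>B / A\<close> tends to \<open>- 3 / 2\<close> and \<open>t\<close> to infinity.
\<close>

lemma tangents_along_k_axis:
  "tangent_lines_converge (frontier region_R) (to_origin_along_k_axis (frontier region_R)) {(h, k). h = 0}"
proof -
  define F where "F = to_origin_along_k_axis (frontier region_R)"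
  have lim: "filterlim (\<lambda>z. (snd z, snd z / fst z)) (at_right 0 \<times>\<^sub>F at_top) F"
    unfolding F_def to_origin_along_k_axis_def case_prod_beta
    by (rule filterlim_mono[OF filterlim_filtercomap order_refl inf_le1])
  have mem: "\<forall>\<^sub>F z in F. z \<in> frontier region_R"
    unfolding F_def to_origin_along_k_axis_def by (simp add: eventually_inf_principal)
  have k: "filterlim snd (at_right 0) F" and t: "filterlim (\<lambda>z. snd z / fst z) at_top F"
    using filterlim_compose[OF filterlim_fst lim] filterlim_compose[OF filterlim_snd lim] by simp_all
  have k0: "(snd \<longlongrightarrow> 0) F" and kp: "\<forall>\<^sub>F z in F. 0 < snd z"
    using k by (auto simp: filterlim_at elim: eventually_mono)
  have u0: "((\<lambda>z. fst z / snd z) \<longlongrightarrow> 0) F"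
    using tendsto_inverse_0_at_top[OF t] by simp
  have crv: "\<forall>\<^sub>F z in F. z \<in> curve"
    using mem kp by eventually_elim (auto simp: frontier_region_R)
  then have pos: "\<forall>\<^sub>F z in F. 0 < fst z \<and> 0 < snd z"
    by eventually_elim (auto simp: curve_def)
  note lims = level_dlog_limits_k_axis[OF k0 u0 pos]
  have nz: "\<forall>\<^sub>F z in F. 0 < level_dlog_h (fst z) (snd z)"
    using order_tendstoD(1)[OF lims(1), of 0] by simp
  define b where "b = (\<lambda>z. z + (- (level_dlog_k (fst z) (snd z) / level_dlog_h (fst z) (snd z) * (fst z / snd z)), 1))"
  have "((\<lambda>z. snd z * (fst z / snd z)) \<longlongrightarrow> 0 * 0) F" by (intro tendsto_mult k0 u0)
  then have "((\<lambda>z. snd z * (fst z / snd z)) \<longlongrightarrow> 0) F" by simp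
  then have h0: "(fst \<longlongrightarrow> 0) F"
    by (rule Lim_transform_eventually) (use pos in \<open>auto elim!: eventually_mono\<close>)
  have id0: "((\<lambda>z. z) \<longlongrightarrow> 0) F"
    using tendsto_Pair[OF h0 k0] by (simp add: zero_prod_def)
  have "(b \<longlongrightarrow> 0 + (- (- 3 / 2 * 0), 1)) F"
    unfolding b_def by (intro tendsto_intros id0 u0 lims) simp
  then have b: "(b \<longlongrightarrow> (0, 1)) F" by (simp add: zero_prod_def)
  have hull: "\<forall>\<^sub>F z in F. z \<noteq> b z \<and> tangent z = affine hull {z, b z}"
    using nz pos
  proof eventually_elim
    case (elim z)
    define A B where "A = level_dlog_h (fst z) (snd z)" and "B = level_dlog_k (fst z) (snd z)"
    have c: "- (A / fst z) \<noteq> 0" using elim by (simp add: A_def)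
    have "(- (A / fst z)) *\<^sub>R (- (B / A * (fst z / snd z)), 1) = (B / snd z, - (A / fst z))"
      using elim by (simp add: A_def)
    then show ?case
      using affine_hull_2_scale[OF c, of z "(- (B / A * (fst z / snd z)), 1)"]
      by (simp add: tangent_def b_def A_def B_def zero_prod_def)
  qed
  have "affine hull {0, (0, 1)} = {(h::real, k::real). h = 0}"
    by (auto simp: affine_hull_2_alt zero_prod_def image_iff)
  then have "lines_converge tangent {(h, k). h = 0} F"
    unfolding lines_converge_def using hull b id0
    by (intro exI[of _ "\<lambda>z. z"] exI[of _ b] exI[of _ 0] exI[of _ "(0, 1)"]) (auto simp: zero_prod_def)
  moreover have "\<forall>\<^sub>F z in F. tangent_line_at (frontier region_R) z (tangent z)"
    using crv nz
  proof eventually_elim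
    case (elim z)
    then show ?case using tangent_line_curve[of "fst z" "snd z"] by (simp add: tangent_def)
  qed
  ultimately show ?thesis
    unfolding tangent_lines_converge_def using to_origin_along_k_axis_not_bot by (auto simp: F_def)
qed

section \<open>The boundary of the region\<close>

theorem theorem3p7:
  shows "simply_connected region_R
    \<and> (\<exists>f. polar_loop f (frontier region_R))
    \<and> tangent_lines_converge (frontier region_R)
        (to_origin_along_h_axis (frontier region_R)) {(h, k). k = 0}
    \<and> tangent_lines_converge (frontier region_R)
        (to_origin_along_k_axis (frontier region_R)) {(h, k). h = 0}
    \<and> (\<forall>a. 0 < a \<and> a < h_M \<longrightarrow> card (frontier region_R \<inter> {(a, k) | k. k \<in> UNIV}) = 2)
    \<and> (\<forall>b. 0 < b \<and> b < k_M \<longrightarrow> card (frontier region_R \<inter> {(h, b) | h. h \<in> UNIV}) = 2)"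
  using simply_connected_region_R polar_loop_frontier tangents_along_h_axis tangents_along_k_axis
    card_frontier_vertical card_frontier_horizontal
  by blast

end
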